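(* Suppose that (H3.0) $\{\tau\phi-\Theta\zeta:\phi\in\bar{\mathcal H}_2,\ \zeta\in\mathfrak h\}=\mathfrak h$; (H3.1) $\mathrm{Ran}(\tau^* )\cap\mathcal H_{-1}=\{0\}$; (H4.1) $\|C\phi\|_0\le c\|B\phi\|_0$ for all $\phi\in\mathcal H_1$, for some constant $c$; (H4.2) $C(\mathcal H_2)\subseteq\mathcal H_1$ and $BC\phi=CB\phi$ for all $\phi\in\mathcal H_2$; (H4.3) $\mathrm{Ran}(\bar C^*G(\lambda))\subseteq D(\bar\tau)$ for real $\lambda\neq0$. Let $\lambda\in\mathbb R$, $\lambda\ne0$, and let $$D(\tilde W_\Theta):=\{(\phi_0,\varphi_0,\zeta_\phi)\in\bar{\mathcal H}_1\oplus\mathcal H_0\oplus\mathfrak h_\Theta:\ \phi_0=\phi_\lambda+\bar B^{-1}CB^{-1}G(\lambda)\zeta_\varphi,\ \varphi_0=\varphi_\lambda+G(\lambda)\zeta_\varphi,\ \phi_\lambda\in\bar{\mathcal H}_2,\ \varphi_\lambda\in\mathcal H_1,\ \zeta_\varphi\in\mathfrak h,\ \Theta\zeta_\phi=\bar\tau\phi_0\}.$$ Then $\tilde W_\Theta:D(\tilde W_\Theta)\subseteq\bar{\mathcal H}_1\oplus\mathcal H_0\oplus\mathfrak h_\Theta\to\bar{\mathcal H}_1\oplus\mathcal H_0\oplus\mathfrak h_\Theta$, $$\tilde W_\Theta(\phi_0,\varphi_0,\zeta_\phi):=\left(\varphi_\lambda-\lambda\bar B^{-1}(-C+\lambda)B^{-1}G(\lambda)\zeta_\varphi,\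 C\varphi_\lambda+\bar A\phi_\lambda,\ \zeta_\varphi\right),$$ is a skew-adjoint extension of the restriction of $$\tilde W_g:\bar{\mathcal H}_2\times\mathcal H_1\times\mathfrak h_\Theta\subseteq\bar{\mathcal H}_1\oplus\mathcal H_0\oplus\mathfrak h_\Theta\to\bar{\mathcal H}_1\oplus\mathcal H_0\oplus\mathfrak h_\Theta,\qquad\tilde W_g(\phi,\psi,\zeta)=(\psi,C\psi+\bar A\phi,0),$$ to the dense set $\mathcal N_\Theta:=\{(\phi,\varphi,\zeta)\in\bar{\mathcal H}_2\times\mathcal H_1\times\mathfrak h_\Theta:\tau\phi=\Theta\zeta\}$. The resolvent of $\tilde W_\Theta$ is given by $$(-\tilde W_\Theta+\lambda)^{-1}=(-\tilde W_g+\lambda)^{-1}+G_\Theta(\lambda)\Gamma_\Theta(\lambda)^{-1}\breve G_\Theta(\lambda).$$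
   Context: $\mathsf B(X,Y)$ denotes the bounded everywhere defined linear operators from $X$ to $Y$, and $\mathsf B(X):=\mathsf B(X,X)$. $\mathcal H_0$ is a Hilbert space with scalar product $\langle\cdot,\cdot\rangle_0$ and norm $\|\cdot\|_0$; $B:D(B)\subseteq\mathcal H_0\to\mathcal H_0$ is self-adjoint with $\mathrm{Ker}(B)=\{0\}$. For $k\ge1$, $\mathcal H_k:=D(B^k)$ with scalar product $\langle\phi_1,\phi_2\rangle_k:=\langle B^k\phi_1,B^k\phi_2\rangle_0+\langle\phi_1,\phi_2\rangle_0$. $\mathcal H_{-k}$ is the completion of $\mathcal H_0$ for $\langle(B^{2k}+1)^{-1/2}\phi_1,(B^{2k}+1)^{-1/2}\phi_2\rangle_0$, so $\mathcal H_{-1}\subseteq\mathcal H_{-2}$. $\bar{\mathcal H}_1$ is the completion of $D(B)$ for $[\phi_1,\phi_2]_1:=\langle B\phi_1,B\phi_2\rangle_0$ (so $\mathcal H_1\subseteq\bar{\mathcal H}_1$ densely). $\bar B\in\mathsf B(\bar{\mathcal H}_1,\mathcal H_0)$ is the bounded extension of $B:\mathcal H_1\subseteq\bar{\mathcal H}_1\to\mathcal H_0$; it is boundedly invertible and $\bar B^{-1}$ extends $B^{-1}:\mathrm{Ran}(B)\to\bar{\mathcal H}_1$. For $k\ge1$, $\bar{\mathcal H}_k:=\{\phi\in\bar{\mathcal H}_1:\bar B\phi\in\mathcal H_{k-1}\}$ with scalar product $[\phi_1,\phi_2]_k:=\langle\bar B\phi_1,\bar B\phi_2\rangle_{k-1}$.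 $\bar A:=-B\bar B:\bar{\mathcal H}_2\to\mathcal H_0$. $\mathfrak h$ is a Hilbert space, $\Theta$ a bounded, positive, injective self-adjoint operator on $\mathfrak h$; $\mathfrak h_\Theta$ denotes the Hilbert space given by $\mathfrak h$ endowed with $\langle\zeta_1,\zeta_2\rangle_\Theta:=\langle\Theta\zeta_1,\zeta_2\rangle_{\mathfrak h}$. The scalar product on $\bar{\mathcal H}_1\oplus\mathcal H_0\oplus\mathfrak h_\Theta$ is $\langle\bar B\phi_1,\bar B\phi_2\rangle_0+\langle\psi_1,\psi_2\rangle_0+\langle\zeta_1,\zeta_2\rangle_\Theta$. $\tau\in\mathsf B(\bar{\mathcal H}_2,\mathfrak h)$; $\tau^*\in\mathsf B(\mathfrak h,\mathcal H_{-2})$ is defined by $\langle(B^4+1)^{-1/2}\tau^*\zeta,(B^4+1)^{1/2}\phi\rangle_0=\langle\zeta,\tau\phi\rangle_{\mathfrak h}$, $\zeta\in\mathfrak h$, $\phi\in\mathcal H_2$. $C:\mathcal H_1\subseteq\mathcal H_0\to\mathcal H_0$ is a skew-adjoint operator; under (H4.1), $\bar C\in\mathsf B(\bar{\mathcal H}_1,\mathcal H_0)$ is the bounded extension of $C:\mathcal H_1\subseteq\bar{\mathcal H}_1\to\mathcal H_0$, and $\bar C^*\in\mathsf B(\mathcal H_0,\bar{\mathcal H}_1)$ its adjoint, $\bar C^*=-\bar B^{-1}\bar C\bar B^{-1}$. Under (H4.1)-(H4.2), for real $\lambda\ne0$, $R(\lambda):=(B^2-\lambda C+\lambda^2)^{-1}\in\mathsf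 B(\mathcal H_0,\mathcal H_2)$ exists, and $\bar R(\lambda)\in\mathsf B(\bar{\mathcal H}_1,\bar{\mathcal H}_3)$ is the bounded extension of $R(\lambda):\mathcal H_1\subseteq\bar{\mathcal H}_1\to\bar{\mathcal H}_3$. $J_\nu:\mathcal H_0\to\mathcal H_0$, $\nu>0$, is a fixed family of self-adjoint operators such that: (1) $J_\nu\in\mathsf B(\mathcal H_k,\mathcal H_{k+1})$ for all $k\ge0$; (2) $J_\nu B\phi=BJ_\nu\phi$ and $J_\nu C\phi=CJ_\nu\phi$ for all $\phi\in\mathcal H_1$; (3) $\lim_{\nu\downarrow0}\|J_\nu\phi-\phi\|_0=0$ for all $\phi\in\mathcal H_0$. $\bar J_\nu\in\mathsf B(\bar{\mathcal H}_k,\bar{\mathcal H}_{k+1})$, $k\ge1$, is the bounded extension of $J_\nu$; $\tau_\nu:=\tau\bar J_\nu:\bar{\mathcal H}_1\to\mathfrak h$; $D(\bar\tau):=\{\phi\in\bar{\mathcal H}_1:\lim_{\nu\downarrow0}\tau_\nu\phi\text{ exists in }\mathfrak h\}$ and $\bar\tau\phi:=\lim_{\nu\downarrow0}\tau_\nu\phi$. (One has $\bar{\mathcal H}_2\subseteq D(\bar\tau)$ and $\bar\tau=\tau$ on $\bar{\mathcal H}_2$.) For real $\lambda\neq0$: $\breve G(\lambda):=\tau R(\lambda)$, $G(\lambda):=\breve G(-\lambda)^*\in\mathsf B(\mathfrak h,\mathcal H_0)$, $\breve{\bar G}(\lambda):=\tau\bar R(\lambda)$, $\bar G(\lambda):=\breve{\bar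 G}(-\lambda)^*\in\mathsf B(\mathfrak h,\bar{\mathcal H}_1)$; one has $\mathrm{Ran}(G(\lambda))\subseteq\mathrm{Ran}(B)$ and $\bar G(\lambda)=\bar B^{-1}B^{-1}G(\lambda)\in\mathsf B(\mathfrak h,\bar{\mathcal H}_2)$. Moreover $\breve G_\Theta(\lambda)(\phi,\varphi,\zeta):=\lambda\breve{\bar G}(\lambda)\phi+\breve G(\lambda)(-\bar C\phi+\varphi)-\lambda^{-1}\Theta\zeta$, $G_\Theta(\lambda)\zeta:=(\lambda\bar G(\lambda)\zeta+\bar C^*G(\lambda)\zeta,\,-G(\lambda)\zeta,\,-\lambda^{-1}\zeta)$, $\Gamma_\Theta(\lambda):=-\lambda\tau\bar B^{-1}B^{-1}G(\lambda)-\bar\tau\bar C^*G(\lambda)-\lambda^{-1}\Theta\in\mathsf B(\mathfrak h)$. The operator $\tilde W_g$ is skew-adjoint.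
   Formalization: The formal theorem additionally assumes that τ* is injective (τ has dense range); without it, e.g. for τ = 0, Θ = 1, 𝔥 ≠ 0, the vector ζ_φ (the third component of the value) is not determined, so W̃_Θ is not a well-defined operator and N_Θ is not dense. *)

theory Defs
  imports "HOL-Analysis.Analysis"
begin

text \<open>
  The scalar field is left open between the real and the complex numbers. The class only asks for
  a real normed field with a conjugation; both fields are instances.
\<close>

class rc_scalar = real_normed_field +
  fixes kconj :: "'a \<Rightarrow> 'a" and kre :: "'a \<Rightarrow> real"
  assumes kconj_add: "kconj (x + y) = kconj x + kconj y"
    and kconj_mult: "kconj (x * y) = kconj x * kconj y"
    and kconj_kconj: "kconj (kconj x) = x"
    and kconj_scaleR: "kconj (r *\<^sub>R x) = r *\<^sub>R kconj x"
    and mult_kconj: "x * kconj x = (norm x)\<^sup>2 *\<^sub>R 1"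
    and kre_scaleR: "(2 * kre x) *\<^sub>R 1 = x + kconj x"

instantiation real :: rc_scalar
begin
definition kconj_real :: "real \<Rightarrow> real" where "kconj_real x = x"
definition kre_real :: "real \<Rightarrow> real" where "kre_real x = x"
instance
  by standard (simp_all add: kconj_real_def kre_real_def power2_eq_square)
end

instantiation complex :: rc_scalar
begin
definition kconj_complex :: "complex \<Rightarrow> complex" where "kconj_complex = cnj"
definition kre_complex :: "complex \<Rightarrow> real" where "kre_complex = Re"
instance
  by standard (simp_all add: kconj_complex_def kre_complex_def complex_mult_cnj cmod_power2
      complex_eq_iff)
end


section \<open>Spaces with a scalar product\<close>

text \<open>The scalar product is conjugate linear in the first and linear in the second argument.\<close>

record ('k, 'v) kspace =
  carrier :: "'v set"
  sc :: "'k \<Rightarrow> 'v \<Rightarrow> 'v"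
  ip :: "'v \<Rightarrow> 'v \<Rightarrow> 'k"

definition nrm :: "('k::rc_scalar, 'v) kspace \<Rightarrow> 'v \<Rightarrow> real" where
  "nrm X x = sqrt (kre (ip X x x))"

text \<open>
  A Hilbert space over \<open>'k\<close> whose carrier is a whole type. Completeness comes from the class
  \<open>complete_space\<close>; the last condition makes \<open>nrm X\<close> the norm of the type.
\<close>

definition hilbert_space ::
  "('k::rc_scalar, 'v::{real_inner, complete_space}) kspace \<Rightarrow> bool" where
  "hilbert_space X \<longleftrightarrow>
     carrier X = UNIV \<and>
     vector_space (sc X) \<and>
     (\<forall>r x. sc X (of_real r) x = r *\<^sub>R x) \<and>
     (\<forall>x y z. ip X x (y + z) = ip X x y + ip X x z) \<and>
     (\<forall>a x y. ip X x (sc X a y) = a * ip X x y) \<and>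
     (\<forall>x y. ip X y x = kconj (ip X x y)) \<and>
     (\<forall>x y. kre (ip X x y) = x \<bullet> y)"

definition dense_in :: "('k::rc_scalar, 'v::real_vector) kspace \<Rightarrow> 'v set \<Rightarrow> bool" where
  "dense_in X D \<longleftrightarrow>
     D \<subseteq> carrier X \<and> (\<forall>x\<in>carrier X. \<forall>\<epsilon>>0. \<exists>y\<in>D. nrm X (x - y) < \<epsilon>)"

definition lin_on ::
  "('k::rc_scalar, 'v::real_vector) kspace \<Rightarrow> ('k, 'w::real_vector) kspace \<Rightarrow> ('v \<Rightarrow> 'w) \<Rightarrow> bool"
  where
  "lin_on X Y T \<longleftrightarrow>
     (\<forall>x\<in>carrier X. \<forall>y\<in>carrier X. T (x + y) = T x + T y) \<and>
     (\<forall>a. \<forall>x\<in>carrier X. T (sc X a x) = sc Y a (T x))"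

text \<open>\<open>bops X Y\<close> is $\mathsf B(X,Y)$; values outside the carrier of \<open>X\<close> are irrelevant.\<close>

definition bops ::
  "('k::rc_scalar, 'v::real_vector) kspace \<Rightarrow> ('k, 'w::real_vector) kspace \<Rightarrow> ('v \<Rightarrow> 'w) set" where
  "bops X Y = {T. (\<forall>x\<in>carrier X. T x \<in> carrier Y) \<and> lin_on X Y T \<and>
                  (\<exists>K. \<forall>x\<in>carrier X. nrm Y (T x) \<le> K * nrm X x)}"

text \<open>
  \<open>completion_of P X e\<close>: the Hilbert space \<open>X\<close>, with the canonical map \<open>e\<close>, is a completion of the
  pre-Hilbert space \<open>P\<close>.
\<close>

definition completion_of ::
  "('k::rc_scalar, 'v::real_vector) kspace \<Rightarrow> ('k, 'w::{real_inner, complete_space}) kspace \<Rightarrow>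
   ('v \<Rightarrow> 'w) \<Rightarrow> bool" where
  "completion_of P X e \<longleftrightarrow>
     hilbert_space X \<and> lin_on P X e \<and>
     (\<forall>x\<in>carrier P. \<forall>y\<in>carrier P. ip X (e x) (e y) = ip P x y) \<and>
     dense_in X (e ` carrier P)"

text \<open>
  \<open>bdd_ext X Y e D f\<close> is the bounded extension to \<open>X\<close> of \<open>f : D \<subseteq> X \<rightarrow> Y\<close>, where \<open>D\<close> is seen as a
  subset of \<open>X\<close> through \<open>e\<close>. It is only used with \<open>carrier X = UNIV\<close>.
\<close>

definition bdd_ext ::
  "('k::rc_scalar, 'v::real_vector) kspace \<Rightarrow> ('k, 'w::real_vector) kspace \<Rightarrow>
   ('u \<Rightarrow> 'v) \<Rightarrow> 'u set \<Rightarrow> ('u \<Rightarrow> 'w) \<Rightarrow> 'v \<Rightarrow> 'w" where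
  "bdd_ext X Y e D f = (THE T. T \<in> bops X Y \<and> (\<forall>x\<in>D. T (e x) = f x))"

definition hadj ::
  "('k::rc_scalar, 'v::real_vector) kspace \<Rightarrow> ('k, 'w::real_vector) kspace \<Rightarrow>
   ('v \<Rightarrow> 'w) \<Rightarrow> 'w \<Rightarrow> 'v" where
  "hadj X Y T y = (THE x. x \<in> carrier X \<and> (\<forall>u\<in>carrier X. ip X x u = ip Y y (T u)))"

definition dsum3 ::
  "('k::rc_scalar, 'u) kspace \<Rightarrow> ('k, 'v) kspace \<Rightarrow> ('k, 'w) kspace \<Rightarrow>
   ('k, 'u \<times> 'v \<times> 'w) kspace" where
  "dsum3 X Y Z =
     \<lparr>carrier = carrier X \<times> carrier Y \<times> carrier Z,
      sc = (\<lambda>a (x, y, z). (sc X a x, sc Y a y, sc Z a z)),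
      ip = (\<lambda>(x, y, z) (x', y', z'). ip X x x' + ip Y y y' + ip Z z z')\<rparr>"


section \<open>Unbounded operators, given by their graphs\<close>

definition op_graph :: "'v set \<Rightarrow> ('v \<Rightarrow> 'w) \<Rightarrow> ('v \<times> 'w) set" where
  "op_graph D f = {(x, f x) | x. x \<in> D}"

definition lin_operator ::
  "('k::rc_scalar, 'v::real_vector) kspace \<Rightarrow> ('v \<times> 'v) set \<Rightarrow> bool" where
  "lin_operator X T \<longleftrightarrow>
     T \<subseteq> carrier X \<times> carrier X \<and> single_valued T \<and> (0, 0) \<in> T \<and>
     (\<forall>x y x' y'. (x, y) \<in> T \<longrightarrow> (x', y') \<in> T \<longrightarrow> (x + x', y + y') \<in> T) \<and>
     (\<forall>a x y. (x, y) \<in> T \<longrightarrow> (sc X a x, sc X a y) \<in> T)"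

definition adj_graph ::
  "('k::rc_scalar, 'v) kspace \<Rightarrow> ('v \<times> 'v) set \<Rightarrow> ('v \<times> 'v) set" where
  "adj_graph X T = {(x, y). x \<in> carrier X \<and> y \<in> carrier X \<and>
                            (\<forall>(u, v)\<in>T. ip X x v = ip X y u)}"

definition self_adjoint ::
  "('k::rc_scalar, 'v::real_vector) kspace \<Rightarrow> ('v \<times> 'v) set \<Rightarrow> bool" where
  "self_adjoint X T \<longleftrightarrow> lin_operator X T \<and> dense_in X (Domain T) \<and> adj_graph X T = T"

definition skew_adjoint ::
  "('k::rc_scalar, 'v::real_vector) kspace \<Rightarrow> ('v \<times> 'v) set \<Rightarrow> bool" where
  "skew_adjoint X T \<longleftrightarrow>
     lin_operator X T \<and> dense_in X (Domain T) \<and> adj_graph X T = (\<lambda>(x, y). (x, - y)) ` T"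

definition restr :: "('v \<times> 'w) set \<Rightarrow> 'v set \<Rightarrow> ('v \<times> 'w) set" where
  "restr T N = {(x, y). (x, y) \<in> T \<and> x \<in> N}"

text \<open>\<open>minus_plus T \<lambda>\<close> is the graph of $-T+\lambda$ for real $\lambda$.\<close>

definition minus_plus :: "('v::real_vector \<times> 'v) set \<Rightarrow> real \<Rightarrow> ('v \<times> 'v) set" where
  "minus_plus T l = {(x, - y + l *\<^sub>R x) | x y. (x, y) \<in> T}"

definition in_resolvent_set ::
  "('k::rc_scalar, 'v::real_vector) kspace \<Rightarrow> ('v \<times> 'v) set \<Rightarrow> real \<Rightarrow> bool" where
  "in_resolvent_set X T l \<longleftrightarrow> (\<exists>R\<in>bops X X. (minus_plus T l)\<inverse> = op_graph (carrier X) R)"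

definition resolvent :: "('v::real_vector \<times> 'v) set \<Rightarrow> real \<Rightarrow> 'v \<Rightarrow> 'v" where
  "resolvent T l u = (THE x. (x, u) \<in> minus_plus T l)"

definition positive_op ::
  "('k::rc_scalar, 'v::real_vector) kspace \<Rightarrow> ('v \<Rightarrow> 'v) \<Rightarrow> bool" where
  "positive_op X T \<longleftrightarrow>
     T \<in> bops X X \<and> self_adjoint X (op_graph (carrier X) T) \<and>
     (\<forall>x\<in>carrier X. 0 \<le> kre (ip X (T x) x))"

definition pos_sqrt ::
  "('k::rc_scalar, 'v::real_vector) kspace \<Rightarrow> ('v \<Rightarrow> 'v) \<Rightarrow> 'v \<Rightarrow> 'v" where
  "pos_sqrt X T = (THE S. positive_op X S \<and> S \<circ> S = T)"


section \<open>The data and the spaces built from them\<close>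

text \<open>
  Completions are only determined up to isomorphism, so the data contain arbitrary ones:
  \<open>(Hbar1, emb1)\<close> for $\bar{\mathcal H}_1$, \<open>(Hm1, embm1)\<close> for $\mathcal H_{-1}$ and
  \<open>(Hm2, embm2)\<close> for $\mathcal H_{-2}$. The map \<open>emb1\<close> is meaningful on \<open>domB\<close> only.
\<close>

record ('k, 'h, 'b, 'p, 'q, 'a) wave_data =
  H0 :: "('k, 'h) kspace"
  domB :: "'h set"
  opB :: "'h \<Rightarrow> 'h"
  Hbar1 :: "('k, 'b) kspace"
  emb1 :: "'h \<Rightarrow> 'b"
  Hm1 :: "('k, 'p) kspace"
  embm1 :: "'h \<Rightarrow> 'p"
  Hm2 :: "('k, 'q) kspace"
  embm2 :: "'h \<Rightarrow> 'q"
  haux :: "('k, 'a) kspace"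
  Theta :: "'a \<Rightarrow> 'a"
  tau :: "'b \<Rightarrow> 'a"
  opC :: "'h \<Rightarrow> 'h"
  Jreg :: "real \<Rightarrow> 'h \<Rightarrow> 'h"

primrec domBpow where
  "domBpow d 0 = UNIV"
| "domBpow d (Suc k) = {x \<in> domB d. opB d x \<in> domBpow d k}"

text \<open>$\mathcal H_k$, $k\ge0$.\<close>

definition Hpos where
  "Hpos d k =
     (if k = 0 then H0 d
      else (H0 d)\<lparr>carrier := domBpow d k,
                  ip := \<lambda>x y. ip (H0 d) ((opB d ^^ k) x) ((opB d ^^ k) y) + ip (H0 d) x y\<rparr>)"

text \<open>$(B^{2k}+1)^{-1/2}$, and $\mathcal H_0$ with the scalar product completed to $\mathcal H_{-k}$.\<close>

definition Bsqrt where
  "Bsqrt d k = pos_sqrt (H0 d) (inv_into (domBpow d (2 * k)) (\<lambda>x. (opB d ^^ (2 * k)) x + x))"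

definition preHneg where
  "preHneg d k = (H0 d)\<lparr>ip := \<lambda>x y. ip (H0 d) (Bsqrt d k x) (Bsqrt d k y)\<rparr>"

definition preHbar1 where
  "preHbar1 d = (H0 d)\<lparr>carrier := domB d, ip := \<lambda>x y. ip (H0 d) (opB d x) (opB d y)\<rparr>"

text \<open>The inclusion of $\mathcal H_{-1}$ into $\mathcal H_{-2}$.\<close>

definition incl_neg where
  "incl_neg d = bdd_ext (Hm1 d) (Hm2 d) (embm1 d) UNIV (embm2 d)"

definition Bbar where
  "Bbar d = bdd_ext (Hbar1 d) (H0 d) (emb1 d) (domB d) (opB d)"

definition Binv where
  "Binv d = inv_into (domB d) (opB d)"

definition Bbar_inv where
  "Bbar_inv d = inv (Bbar d)"

text \<open>$\bar{\mathcal H}_k$ for $k\ge1$.\<close>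

definition Hbar where
  "Hbar d k =
     (Hbar1 d)\<lparr>carrier := {x. Bbar d x \<in> carrier (Hpos d (k - 1))},
               ip := \<lambda>x y. ip (Hpos d (k - 1)) (Bbar d x) (Bbar d y)\<rparr>"

definition Abar where
  "Abar d x = - opB d (Bbar d x)"

text \<open>
  $\mathfrak h_\Theta$. Its completeness (i.e. bounded invertibility of \<open>Theta\<close>) is not assumed;
  density, adjoints and boundedness in \<open>Wspace\<close> refer to the norm induced by this scalar product.
\<close>

definition hTheta where
  "hTheta d = (haux d)\<lparr>ip := \<lambda>x y. ip (haux d) (Theta d x) y\<rparr>"

definition Wspace where
  "Wspace d = dsum3 (Hbar1 d) (H0 d) (hTheta d)"

text \<open>
  $\tau^*$: in the defining identity $(B^4+1)^{-1/2}$ acts on $\mathcal H_{-2}$ by continuous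
  extension, and $(B^4+1)^{1/2}$ is the inverse of $(B^4+1)^{-1/2}$.
\<close>

definition tau_adj where
  "tau_adj d \<zeta> =
     (THE u. \<forall>x\<in>carrier (Hpos d 2).
        ip (H0 d) (bdd_ext (Hm2 d) (H0 d) (embm2 d) UNIV (Bsqrt d 2) u) (inv (Bsqrt d 2) x)
        = ip (haux d) \<zeta> (tau d (emb1 d x)))"

definition Jbar where
  "Jbar d \<nu> = bdd_ext (Hbar1 d) (Hbar d 2) (emb1 d) (domB d) (\<lambda>x. emb1 d (Jreg d \<nu> x))"

definition dom_taubar where
  "dom_taubar d = {x. \<exists>l. ((\<lambda>\<nu>. tau d (Jbar d \<nu> x)) \<longlongrightarrow> l) (at_right 0)}"

definition taubar where
  "taubar d x = Lim (at_right 0) (\<lambda>\<nu>. tau d (Jbar d \<nu> x))"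

definition Cbar where
  "Cbar d = bdd_ext (Hbar1 d) (H0 d) (emb1 d) (domB d) (opC d)"

definition Cbar_adj where
  "Cbar_adj d = hadj (Hbar1 d) (H0 d) (Cbar d)"

definition Rop where
  "Rop d l = inv_into (domBpow d 2) (\<lambda>x. opB d (opB d x) - l *\<^sub>R opC d x + l\<^sup>2 *\<^sub>R x)"

definition Rbar where
  "Rbar d l = bdd_ext (Hbar1 d) (Hbar d 3) (emb1 d) (domB d) (\<lambda>x. emb1 d (Rop d l x))"

definition Gbreve where
  "Gbreve d l x = tau d (emb1 d (Rop d l x))"

definition Gop where
  "Gop d l = hadj (H0 d) (haux d) (Gbreve d (- l))"

definition Gbar_breve where
  "Gbar_breve d l x = tau d (Rbar d l x)"

definition Gbar where
  "Gbar d l = hadj (Hbar1 d) (haux d) (Gbar_breve d (- l))"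

definition GTheta_breve where
  "GTheta_breve d l = (\<lambda>(x, y, \<zeta>).
     l *\<^sub>R Gbar_breve d l x + Gbreve d l (- Cbar d x + y) - (1 / l) *\<^sub>R Theta d \<zeta>)"

definition GTheta where
  "GTheta d l \<zeta> =
     (l *\<^sub>R Gbar d l \<zeta> + Cbar_adj d (Gop d l \<zeta>), - Gop d l \<zeta>, - ((1 / l) *\<^sub>R \<zeta>))"

definition GammaTheta where
  "GammaTheta d l \<zeta> =
     - (l *\<^sub>R tau d (Bbar_inv d (Binv d (Gop d l \<zeta>))))
     - taubar d (Cbar_adj d (Gop d l \<zeta>)) - (1 / l) *\<^sub>R Theta d \<zeta>"

definition wave_setting ::
  "('k::rc_scalar, 'h::{real_inner, complete_space}, 'b::{real_inner, complete_space},
    'p::{real_inner, complete_space}, 'q::{real_inner, complete_space},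
    'a::{real_inner, complete_space}) wave_data \<Rightarrow> bool" where
  "wave_setting d \<longleftrightarrow>
     hilbert_space (H0 d) \<and>
     self_adjoint (H0 d) (op_graph (domB d) (opB d)) \<and>
     (\<forall>x\<in>domB d. opB d x = 0 \<longrightarrow> x = 0) \<and>
     completion_of (preHbar1 d) (Hbar1 d) (emb1 d) \<and>
     completion_of (preHneg d 1) (Hm1 d) (embm1 d) \<and>
     completion_of (preHneg d 2) (Hm2 d) (embm2 d) \<and>
     hilbert_space (haux d) \<and>
     positive_op (haux d) (Theta d) \<and> inj (Theta d) \<and>
     tau d \<in> bops (Hbar d 2) (haux d) \<and>
     skew_adjoint (H0 d) (op_graph (domB d) (opC d)) \<and>
     (\<forall>\<nu>>0. self_adjoint (H0 d) (op_graph UNIV (Jreg d \<nu>)) \<and>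
            (\<forall>k. Jreg d \<nu> \<in> bops (Hpos d k) (Hpos d (Suc k))) \<and>
            (\<forall>x\<in>domB d. Jreg d \<nu> (opB d x) = opB d (Jreg d \<nu> x) \<and>
                         Jreg d \<nu> (opC d x) = opC d (Jreg d \<nu> x))) \<and>
     (\<forall>x. ((\<lambda>\<nu>. norm (Jreg d \<nu> x - x)) \<longlongrightarrow> 0) (at_right 0))"


section \<open>The operators\<close>

definition Wg where
  "Wg d = op_graph (carrier (Hbar d 2) \<times> domB d \<times> UNIV)
            (\<lambda>(x, y, \<zeta>). (emb1 d y, opC d y + Abar d x, 0))"

definition NTheta where
  "NTheta d = {(x, y, \<zeta>). x \<in> carrier (Hbar d 2) \<and> y \<in> domB d \<and> tau d x = Theta d \<zeta>}"

text \<open>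
  \<open>WTheta d \<lambda>\<close> is the set of all pairs argument/value produced by the decompositions of the
  argument. That the value does not depend on the decomposition is not built in; it is the
  condition \<open>single_valued\<close> contained in \<open>skew_adjoint\<close>.
\<close>

definition WTheta where
  "WTheta d l =
     {((x0, y0, \<zeta>x),
       (emb1 d yl - l *\<^sub>R Bbar_inv d (- opC d (Binv d (Gop d l \<zeta>y)) + l *\<^sub>R Binv d (Gop d l \<zeta>y)),
        opC d yl + Abar d xl,
        \<zeta>y)) | x0 y0 \<zeta>x xl yl \<zeta>y.
       xl \<in> carrier (Hbar d 2) \<and> yl \<in> domB d \<and>
       x0 = xl + Bbar_inv d (opC d (Binv d (Gop d l \<zeta>y))) \<and>
       y0 = yl + Gop d l \<zeta>y \<and>
       x0 \<in> dom_taubar d \<and> Theta d \<zeta>x = taubar d x0}"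

end

theory Submission
  imports Defs
begin

text \<open>
  Why the theorem is true. The operator $\bar B$ maps $\bar{\mathcal H}_1$ unitarily onto
  $\mathcal H_0$, so the first component \<open>\<phi>\<close> of a state may be replaced by $y=\bar B\phi$. Then
  $C=KB$ with a bounded skew operator \<open>K\<close> that commutes with \<open>B\<close>, the uncoupled operator becomes
  $(y,p)\mapsto(Bp,KBp-By)$, and \<open>\<tau>\<close> becomes a functional \<open>t\<close> on the domain of \<open>B\<close> that is continuous
  for the graph norm. In these variables the coupled operator maps $(y,p,a)$ to $(v,q,\zeta)$ where
  $v=Bp-t^*\zeta$, $q=-B(y-Kp)$ and $\Theta a=\bar\tau y$, the first equation being tested against the
  domain of \<open>B\<close> (\<open>wave_rel\<close>, \<open>WTheta_iff\<close>). This description contains neither \<open>\<lambda>\<close> nor a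
  decomposition of the argument; the decompositions come back by subtracting a potential
  (\<open>wave_rel_decompose\<close>). The charge \<open>\<zeta>\<close> is determined by the state, because by the hypotheses on
  $\tau^*$ no nonzero multiple $t^*\zeta$ lies in the base space (\<open>transversal\<close>,
  \<open>wave_rel_unique\<close>).

  Skew-symmetry is a Green identity (\<open>green\<close>). Its only ill-defined terms pair \<open>B\<close> with vectors outside
  its domain; after inserting the regularization \<open>J \<nu>\<close> they cancel, since \<open>B (J \<nu>)\<close> is symmetric and \<open>K\<close>
  is skew.

  For surjectivity of $\lambda-\tilde W_\Theta$ one solves the uncoupled equation and corrects
  the boundary condition by a potential (\<open>krein_solution\<close>). Both the uncoupled solution and the
  potential come from the form of $B^2-\lambda C+\lambda^2$, which is coercive on the domain of \<open>B\<close>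
  because $C$ contributes nothing on the diagonal. The correction requires $\Gamma_\Theta(\lambda)$ to be
  invertible. The Green identity of a potential with itself shows that the real part of
  $\langle-\lambda\Gamma_\Theta(\lambda)\zeta,\zeta\rangle$ is
  $\lambda^2\|F\|^2+\langle\Theta\zeta,\zeta\rangle$, with \<open>F\<close> the state of the potential. By
  the surjectivity of $\tau\phi-\Theta\zeta$ and the uniform boundedness principle this energy controls
  $\|\zeta\|^2$ (\<open>weyl_coercive\<close>), so $\Gamma_\Theta(\lambda)$ is invertible by the
  Lax-Milgram lemma.

  A densely defined skew-symmetric operator \<open>W\<close> for which $\lambda-W$ and $-\lambda-W$ are onto is
  skew-adjoint, and its resolvent at \<open>\<lambda>\<close> is bounded (\<open>skew_adjointI\<close>,
  \<open>in_resolvent_setI\<close>). Both facts are algebraic, and so they hold for the norm of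
  $\mathfrak h_\Theta$, which may be incomplete. Density of $\mathcal N_\Theta$ is a duality
  argument: what is orthogonal to the kernel of the surjective map $(y,a)\mapsto ty-\Theta a$ is in the
  range of its adjoint, and is then zero by transversality (\<open>trace_condition_dense\<close>).

  The scalar field enters only through homogeneity: a scalar product is determined by its real part,
  and that is the inner product of the type. All the analysis is therefore carried out over the
  real numbers.
\<close>

section \<open>Bounded operators on real Hilbert spaces\<close>

lemma convergent_if_dist_le:
  fixes f :: "nat \<Rightarrow> 'b::complete_space"
  assumes g: "Cauchy g" and le: "\<And>m n. dist (f m) (f n) \<le> K * dist (g m) (g n)"
  shows "\<exists>L. f \<longlonglongrightarrow> L"
proof -
  have "Cauchy f"
  proof (rule metric_CauchyI)
    fix e :: real assume "e > 0"
    then have "e / (\<bar>K\<bar> + 1) > 0" by simp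
    then obtain M where M: "\<forall>m\<ge>M. \<forall>n\<ge>M. dist (g m) (g n) < e / (\<bar>K\<bar> + 1)"
      using metric_CauchyD[OF g] by blast
    have "dist (f m) (f n) < e" if "M \<le> m" "M \<le> n" for m n
    proof -
      have "dist (f m) (f n) \<le> (\<bar>K\<bar> + 1) * dist (g m) (g n)"
        by (rule order_trans[OF le]) (intro mult_right_mono, auto)
      also have "\<dots> < (\<bar>K\<bar> + 1) * (e / (\<bar>K\<bar> + 1))"
        using M that by (intro mult_strict_left_mono) auto
      finally show ?thesis by simp
    qed
    then show "\<exists>M. \<forall>m\<ge>M. \<forall>n\<ge>M. dist (f m) (f n) < e" by blast
  qed
  then show ?thesis using Cauchy_convergent convergent_def by blast
qed

text \<open>
  The minimizing sequence of the distance is Cauchy by the parallelogram law; orthogonality is the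
  first-order condition at the minimum.
\<close>

lemma orthogonal_projection_exists:
  fixes S :: "'a::{real_inner, complete_space} set"
  assumes cl: "closed S" and sub: "subspace S"
  obtains p where "p \<in> S" "\<And>q. q \<in> S \<Longrightarrow> (x - p) \<bullet> q = 0"
proof -
  define N where "N s = (norm (x - s))\<^sup>2" for s
  define d where "d = Inf (N ` S)"
  have ne: "N ` S \<noteq> {}" using subspace_0[OF sub] by auto
  have bdd: "bdd_below (N ` S)" by (intro bdd_belowI2[where m = 0]) (simp add: N_def)
  have dle: "d \<le> N s" if "s \<in> S" for s
    unfolding d_def by (intro cInf_lower bdd imageI that)
  have "\<exists>s\<in>S. N s < d + 1 / Suc n" for n
    using cInf_lessD[OF ne, of "d + 1 / Suc n"] by (auto simp: d_def)
  then obtain s where sS: "\<And>n. s n \<in> S" and sN: "\<And>n. N (s n) < d + 1 / Suc n"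
    by metis
  have para: "(norm (s m - s n))\<^sup>2 \<le> 2 * (1 / Suc m + 1 / Suc n)" for m n
  proof -
    have "(1/2) *\<^sub>R (s m + s n) \<in> S"
      by (intro subspace_scale subspace_add sub sS)
    then have "d \<le> N ((1/2) *\<^sub>R (s m + s n))" by (rule dle)
    moreover have "(norm (s m - s n))\<^sup>2 = 2 * N (s m) + 2 * N (s n) - 4 * N ((1/2) *\<^sub>R (s m + s n))"
      unfolding N_def power2_norm_eq_inner
      by (simp add: inner_diff_left inner_diff_right inner_add_left inner_add_right inner_commute
          algebra_simps)
    ultimately show ?thesis using sN[of m] sN[of n] by simp
  qed
  have "Cauchy s"
  proof (rule metric_CauchyI)
    fix e :: real assume e: "e > 0"
    obtain M where M: "1 / real (Suc M) < e\<^sup>2 / 4"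
      using e reals_Archimedean[of "e\<^sup>2/4"] by (auto simp: inverse_eq_divide)
    show "\<exists>M. \<forall>m\<ge>M. \<forall>n\<ge>M. dist (s m) (s n) < e"
    proof (intro exI allI impI)
      fix m n assume "M \<le> m" "M \<le> n"
      then have "1 / real (Suc m) \<le> 1 / real (Suc M)" "1 / real (Suc n) \<le> 1 / real (Suc M)"
        by (simp_all add: divide_simps)
      then have "1 / real (Suc m) < e\<^sup>2 / 4" "1 / real (Suc n) < e\<^sup>2 / 4"
        using M by (blast intro: le_less_trans)+
      then have "2 * (1 / real (Suc m) + 1 / real (Suc n)) < 2 * (e\<^sup>2 / 4 + e\<^sup>2 / 4)"
        by (intro mult_strict_left_mono add_strict_mono) auto
      also have "2 * (e\<^sup>2 / 4 + e\<^sup>2 / 4) = e\<^sup>2" by simp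
      finally have "(norm (s m - s n))\<^sup>2 < e\<^sup>2" using para[of m n] by (rule le_less_trans[rotated])
      then show "dist (s m) (s n) < e" using e by (simp add: dist_norm power2_less_imp_less)
    qed
  qed
  then obtain p where p: "s \<longlonglongrightarrow> p" using Cauchy_convergent convergent_def by blast
  have pS: "p \<in> S" using closed_sequentially[OF cl] sS p by blast
  have "(\<lambda>n. N (s n)) \<longlonglongrightarrow> N p" unfolding N_def by (intro tendsto_intros p)
  moreover have "(\<lambda>n. d + 1 / real (Suc n)) \<longlonglongrightarrow> d + 0"
    by (intro tendsto_intros lim_1_over_n[THEN LIMSEQ_Suc])
  ultimately have Np: "N p \<le> d"
    using LIMSEQ_le[of "\<lambda>n. N (s n)" "N p" "\<lambda>n. d + 1 / real (Suc n)" "d + 0"] sN less_imp_le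
    by auto
  have "(x - p) \<bullet> q = 0" if q: "q \<in> S" for q
  proof (cases "q = 0")
    case False
    define b where "b = (x - p) \<bullet> q"
    \<comment> \<open>The quadratic \<open>r \<mapsto> N (p + r q)\<close> has its minimum at \<open>r = t\<close>, so \<open>t = 0\<close>.\<close>
    define t where "t = b / (q \<bullet> q)"
    have qq: "q \<bullet> q > 0" using False by simp
    have "p + t *\<^sub>R q \<in> S" by (intro subspace_add subspace_scale sub pS q)
    then have "N p \<le> N (p + t *\<^sub>R q)" using Np dle order_trans by blast
    also have "N (p + t *\<^sub>R q) = N p - 2 * t * b + t * t * (q \<bullet> q)"
      unfolding N_def b_def power2_norm_eq_inner
      by (simp add: inner_diff_left inner_diff_right inner_add_left inner_add_right inner_commute
          algebra_simps)
    finally have "b * b \<le> 0" using qq by (simp add: t_def field_simps)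
    then have "b = 0" by (auto simp: mult_le_0_iff)
    then show ?thesis by (simp add: b_def)
  qed simp
  with pS that show ?thesis by blast
qed

lemma closure_subspace_eq_UNIV:
  fixes S :: "'a::{real_inner, complete_space} set"
  assumes sub: "subspace S" and orth: "\<And>z. (\<And>s. s \<in> S \<Longrightarrow> z \<bullet> s = 0) \<Longrightarrow> z = 0"
  shows "closure S = UNIV"
proof -
  have subc: "subspace (closure S)"
  proof (rule subspaceI)
    show "0 \<in> closure S" using subspace_0[OF sub] closure_subset by blast
  next
    fix x y assume "x \<in> closure S" "y \<in> closure S"
    then obtain u v where uv: "\<And>n. u n \<in> S" "u \<longlonglongrightarrow> x" "\<And>n. v n \<in> S" "v \<longlonglongrightarrow> y"
      by (auto simp: closure_sequential)
    then have "(\<lambda>n. u n + v n) \<longlonglongrightarrow> x + y" by (intro tendsto_intros)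
    then show "x + y \<in> closure S"
      using uv subspace_add[OF sub]
      unfolding closure_sequential by (intro exI[of _ "\<lambda>n. u n + v n"]) auto
  next
    fix r x assume "x \<in> closure S"
    then obtain u where u: "\<And>n. u n \<in> S" "u \<longlonglongrightarrow> x" by (auto simp: closure_sequential)
    then have "(\<lambda>n. r *\<^sub>R u n) \<longlonglongrightarrow> r *\<^sub>R x" by (intro tendsto_intros)
    then show "r *\<^sub>R x \<in> closure S"
      using u subspace_scale[OF sub]
      unfolding closure_sequential by (intro exI[of _ "\<lambda>n. r *\<^sub>R u n"]) auto
  qed
  have "x \<in> closure S" for x
  proof -
    obtain p where p: "p \<in> closure S" "\<And>q. q \<in> closure S \<Longrightarrow> (x - p) \<bullet> q = 0"
      using orthogonal_projection_exists[OF closed_closure subc] by metis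
    then have "x - p = 0" using closure_subset by (intro orth) blast
    then show ?thesis using p by simp
  qed
  then show ?thesis by auto
qed

lemma orthogonal_to_dense:
  fixes z :: "'a::real_inner"
  assumes "closure S = UNIV" and "\<And>s. s \<in> S \<Longrightarrow> z \<bullet> s = 0"
  shows "z = 0"
proof -
  have "closed {s. z \<bullet> s = 0}"
    by (intro closed_Collect_eq continuous_intros)
  then have "closure S \<subseteq> {s. z \<bullet> s = 0}"
    using assms(2) by (intro closure_minimal) auto
  then have "z \<in> {s. z \<bullet> s = 0}" using assms(1) by blast
  then show ?thesis by simp
qed

lemma continuous_eq_on_dense:
  fixes f g :: "'a::topological_space \<Rightarrow> 'b::t2_space"
  assumes "closure S = UNIV" and "continuous_on UNIV f" "continuous_on UNIV g"
    and "\<And>s. s \<in> S \<Longrightarrow> f s = g s"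
  shows "f x = g x"
proof -
  have "closed {x. f x = g x}" by (intro closed_Collect_eq assms)
  then have "closure S \<subseteq> {x. f x = g x}" using assms(4) by (intro closure_minimal) auto
  then show ?thesis using assms(1) by auto
qed

lemma riesz_representation:
  fixes f :: "'a::{real_inner, complete_space} \<Rightarrow> real"
  assumes f: "bounded_linear f"
  obtains g where "\<And>x. f x = g \<bullet> x"
proof (cases "\<forall>x. f x = 0")
  case True
  then show ?thesis using that[of 0] by simp
next
  case False
  interpret bounded_linear f by (rule f)
  from False obtain x0 where x0: "f x0 \<noteq> 0" by auto
  have cl: "closed {x. f x = 0}"
    by (intro closed_Collect_eq continuous_intros linear_continuous_on[OF f])
  have sub: "subspace {x. f x = 0}"
    by (auto simp: subspace_def zero add scale)
  obtain p where p: "f p = 0" "\<And>q. f q = 0 \<Longrightarrow> (x0 - p) \<bullet> q = 0"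
    using orthogonal_projection_exists[OF cl sub, of x0] by auto
  define n where "n = x0 - p"
  have fn: "f n \<noteq> 0" using x0 p by (simp add: n_def diff)
  then have nn: "n \<bullet> n \<noteq> 0" using zero by auto
  have "f x = ((f n / (n \<bullet> n)) *\<^sub>R n) \<bullet> x" for x
  proof -
    have "f (x - (f x / f n) *\<^sub>R n) = 0" using fn by (simp add: diff scale)
    then have "n \<bullet> (x - (f x / f n) *\<^sub>R n) = 0" unfolding n_def by (rule p(2))
    then show ?thesis using fn nn by (simp add: inner_diff_right field_simps)
  qed
  then show ?thesis by (rule that)
qed

text \<open>
  Let \<open>A\<close> represent the form and \<open>g\<close> the functional. For small \<open>r > 0\<close>, coercivity makes
  \<open>x \<mapsto> x - r (A x - g)\<close> a contraction, and its fixed point solves \<open>A x = g\<close>.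
\<close>

lemma lax_milgram:
  fixes a :: "'a::{real_inner, complete_space} \<Rightarrow> 'a \<Rightarrow> real"
  assumes a: "bounded_bilinear a" and c: "c > 0" and coer: "\<And>x. c * (norm x)\<^sup>2 \<le> a x x"
    and f: "bounded_linear f"
  obtains x where "\<And>y. a x y = f y"
proof -
  interpret a: bounded_bilinear a by (rule a)
  obtain K where K: "K > 0" "\<And>x y. norm (a x y) \<le> norm x * norm y * K"
    using a.pos_bounded by blast
  have "\<exists>A. \<forall>y. a x y = A \<bullet> y" for x
    using riesz_representation[OF a.bounded_linear_right] by metis
  then obtain A where A: "\<And>x y. a x y = A x \<bullet> y" by metis
  obtain g where g: "\<And>y. f y = g \<bullet> y" using riesz_representation[OF f] by metis
  have Adiff: "A (x - y) = A x - A y" for x y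
    by (rule vector_eq_rdot[THEN iffD1]) (simp add: inner_diff_left A[symmetric] a.diff_left)
  have Ab: "norm (A x) \<le> K * norm x" for x
  proof (cases "A x = 0")
    case False
    have "norm (A x) * norm (A x) = a x (A x)"
      by (simp add: A power2_norm_eq_inner[symmetric] power2_eq_square)
    also have "\<dots> \<le> norm x * norm (A x) * K" using K(2)[of x "A x"] by simp
    finally show ?thesis using False by (simp add: mult.commute)
  qed (use K in simp)
  \<comment> \<open>With \<open>M \<ge> c\<close> and the step \<open>r = c / M\<^sup>2\<close>, the contraction factor is the square root of \<open>1 - (c / M)\<^sup>2\<close>.\<close>
  define M where "M = max K c"
  define r where "r = c / M\<^sup>2"
  have M: "M > 0" "K \<le> M" "c \<le> M" using K by (auto simp: M_def)
  have r: "r > 0" using c M by (simp add: r_def)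
  define q where "q = sqrt (1 - (c / M)\<^sup>2)"
  have cM: "0 < c / M" "c / M \<le> 1" using c M by simp_all
  have q01: "0 \<le> q" "q < 1"
    using cM power_le_one[of "c/M" 2] by (auto simp: q_def)
  have qq: "q\<^sup>2 = 1 - (c / M)\<^sup>2"
    using cM power_le_one[of "c/M" 2] by (simp add: q_def)
  define \<Phi> where "\<Phi> x = x - r *\<^sub>R (A x - g)" for x
  have contr: "dist (\<Phi> x) (\<Phi> y) \<le> q * dist x y" for x y
  proof -
    define z where "z = x - y"
    have "\<Phi> x - \<Phi> y = z - r *\<^sub>R A z"
      by (simp add: \<Phi>_def z_def Adiff algebra_simps)
    then have "(norm (\<Phi> x - \<Phi> y))\<^sup>2 = (norm (z - r *\<^sub>R A z))\<^sup>2" by (rule arg_cong)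
    also have "\<dots> = (norm z)\<^sup>2 - 2 * r * a z z + r\<^sup>2 * (norm (A z))\<^sup>2"
      unfolding A power2_norm_eq_inner
      by (simp add: inner_diff_left inner_diff_right inner_commute algebra_simps power2_eq_square)
    also have "\<dots> \<le> (norm z)\<^sup>2 - 2 * r * (c * (norm z)\<^sup>2) + r\<^sup>2 * (M * norm z)\<^sup>2"
    proof -
      have "norm (A z) \<le> M * norm z"
        using Ab[of z] M(2) mult_right_mono[of K M "norm z"] by simp
      then have "(norm (A z))\<^sup>2 \<le> (M * norm z)\<^sup>2" by (intro power_mono) auto
      then have "r\<^sup>2 * (norm (A z))\<^sup>2 \<le> r\<^sup>2 * (M * norm z)\<^sup>2" by (intro mult_left_mono) auto
      moreover have "2 * r * (c * (norm z)\<^sup>2) \<le> 2 * r * a z z"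
        using coer[of z] r by (intro mult_left_mono) auto
      ultimately show ?thesis by linarith
    qed
    also have "\<dots> = (q * norm z)\<^sup>2"
      unfolding power_mult_distrib qq r_def using M
      by (simp add: field_simps power2_eq_square)
    finally have "norm (\<Phi> x - \<Phi> y) \<le> q * norm z"
      using q01 by (meson mult_nonneg_nonneg norm_ge_zero power2_le_imp_le)
    then show ?thesis by (simp add: dist_norm z_def)
  qed
  obtain x where x: "\<Phi> x = x" using banach_fix_type[of q \<Phi>] q01 contr by blast
  then have "A x = g" using r by (simp add: \<Phi>_def)
  then show ?thesis using that[of x] A g by simp
qed

text \<open>
  By the Baire category theorem one of the closed sets on which all \<open>T i\<close> are bounded by \<open>n\<close>
  contains a ball.
\<close>

lemma uniform_boundedness:
  fixes T :: "'i \<Rightarrow> 'a::{real_normed_vector, complete_space} \<Rightarrow> 'b::real_normed_vector"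
  assumes lin: "\<And>i. i \<in> I \<Longrightarrow> bounded_linear (T i)"
    and pt: "\<And>x. \<exists>C. \<forall>i\<in>I. norm (T i x) \<le> C"
  obtains C where "C > 0" "\<And>i x. i \<in> I \<Longrightarrow> norm (T i x) \<le> C * norm x"
proof -
  define E where "E n = {x. \<forall>i\<in>I. norm (T i x) \<le> real n}" for n
  have clE: "closed (E n)" for n
  proof -
    have "E n = (\<Inter>i\<in>I. {x. norm (T i x) \<le> real n})" by (auto simp: E_def)
    moreover have "closed {x. norm (T i x) \<le> real n}" if "i \<in> I" for i
      by (intro closed_Collect_le continuous_intros linear_continuous_on lin that)
    ultimately show ?thesis by auto
  qed
  have UE: "(\<Union>n. E n) = UNIV"
  proof -
    have "\<exists>n. x \<in> E n" for x
    proof -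
      obtain C where C: "\<forall>i\<in>I. norm (T i x) \<le> C" using pt by blast
      obtain n where "C \<le> real n" using real_arch_simple by blast
      then have "x \<in> E n" using C order_trans unfolding E_def by blast
      then show ?thesis ..
    qed
    then show ?thesis by auto
  qed
  have "\<exists>n. interior (E n) \<noteq> {}"
  proof (rule ccontr)
    assume "\<not> (\<exists>n. interior (E n) \<noteq> {})"
    then have "Met_TC.mtopology interior_of \<Union>(range E) = {}"
      using clE complete_UNIV
      by (intro Met_TC.metric_Baire_category_alt) auto
    then show False using UE by simp
  qed
  then obtain n x0 where "x0 \<in> interior (E n)" by auto
  then obtain e where e: "e > 0" "cball x0 e \<subseteq> E n"
    by (meson interior_subset mem_interior_cball order_trans)
  have "norm (T i x) \<le> (2 * real n / e + 1) * norm x" if i: "i \<in> I" for i x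
  proof (cases "x = 0")
    case True
    then show ?thesis using linear_0[OF bounded_linear.linear[OF lin[OF i]]] by simp
  next
    case False
    interpret bounded_linear "T i" by (rule lin[OF i])
    define y where "y = (e / norm x) *\<^sub>R x"
    have ny: "norm y = e" using False e by (simp add: y_def)
    have "x0 + y \<in> E n" "x0 \<in> E n" using e ny by (auto simp: dist_norm)
    then have "norm (T i (x0 + y)) \<le> n" "norm (T i x0) \<le> n" using i by (auto simp: E_def)
    moreover have "T i y = T i (x0 + y) - T i x0" by (simp add: add)
    ultimately have "norm (T i y) \<le> 2 * n"
      using norm_triangle_ineq4[of "T i (x0 + y)" "T i x0"] by simp
    then have "e / norm x * norm (T i x) \<le> 2 * n" using e by (simp add: y_def scale)
    then have "norm (T i x) \<le> 2 * n / e * norm x" using False e by (simp add: field_simps)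
    also have "\<dots> \<le> (2 * real n / e + 1) * norm x" by (intro mult_right_mono) auto
    finally show ?thesis .
  qed
  moreover have "2 * real n / e + 1 > 0" using e by (simp add: add_nonneg_pos)
  ultimately show ?thesis using that by blast
qed

text \<open>
  A quadratic functional is coercive as soon as its unit ball is weakly bounded: by the uniform
  boundedness principle that ball is then bounded in norm.
\<close>

lemma coercive_if_weakly_bounded:
  fixes E :: "'b::{real_inner, complete_space} \<Rightarrow> real"
  assumes scale: "\<And>r x. E (r *\<^sub>R x) = r\<^sup>2 * E x" and nonneg: "\<And>x. 0 \<le> E x"
    and weak: "\<And>h. \<exists>C. \<forall>x. E x \<le> 1 \<longrightarrow> \<bar>x \<bullet> h\<bar> \<le> C"
  obtains c where "c > 0" "\<And>x. c * (norm x)\<^sup>2 \<le> E x"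
proof -
  obtain C where C: "C > 0" "\<And>x h. x \<in> {x. E x \<le> 1} \<Longrightarrow> norm (x \<bullet> h) \<le> C * norm h"
  proof (rule uniform_boundedness[of "{x. E x \<le> 1}" "\<lambda>x h. x \<bullet> h"])
    show "bounded_linear (\<lambda>h. x \<bullet> h)" for x :: 'b by (rule bounded_linear_inner_right)
    show "\<exists>C. \<forall>x\<in>{x. E x \<le> 1}. norm (x \<bullet> h) \<le> C" for h using weak[of h] by auto
  qed blast
  have ball: "norm x \<le> C" if "E x \<le> 1" for x
  proof (cases "x = 0")
    case False
    have "norm x * norm x \<le> C * norm x"
      using C(2)[of x x] that by (simp add: power2_norm_eq_inner[symmetric] power2_eq_square)
    then show ?thesis using False by simp
  qed (use C in simp)
  have "1 / C\<^sup>2 * (norm x)\<^sup>2 \<le> E x" for x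
  proof (cases "E x = 0")
    case True
    have "E ((2 * C / norm x) *\<^sub>R x) \<le> 1" unfolding scale True by simp
    then have "norm ((2 * C / norm x) *\<^sub>R x) \<le> C" by (rule ball)
    then have "x = 0" using C(1) by (cases "x = 0") auto
    then show ?thesis using True by simp
  next
    case False
    then have pos: "E x > 0" using nonneg[of x] by simp
    have "E ((1 / sqrt (E x)) *\<^sub>R x) \<le> 1" unfolding scale using pos by (simp add: power_divide)
    then have "norm ((1 / sqrt (E x)) *\<^sub>R x) \<le> C" by (rule ball)
    then have "norm x \<le> C * sqrt (E x)" using pos by (simp add: field_simps)
    then have "(norm x)\<^sup>2 \<le> (C * sqrt (E x))\<^sup>2" by (rule power_mono) simp
    also have "\<dots> = C\<^sup>2 * E x" using pos by (simp add: power_mult_distrib)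
    finally show ?thesis using C(1) by (simp add: field_simps)
  qed
  moreover have "1 / C\<^sup>2 > 0" using C(1) by simp
  ultimately show ?thesis by (rule that[rotated])
qed

text \<open>
  A closed range argument in disguise: surjectivity of \<open>M\<close> makes its adjoint \<open>M'\<close> bounded below,
  so that the equation \<open>M (M' \<xi>) = M f\<close> is solvable, and \<open>f - M' \<xi>\<close> lies in the kernel of \<open>M\<close> and
  is orthogonal to it.
\<close>

lemma annihilator_of_kernel:
  fixes M :: "'a::{real_inner, complete_space} \<Rightarrow> 'b::{real_inner, complete_space}"
  assumes M: "bounded_linear M" and surj: "surj M"
    and f: "\<And>z. M z = 0 \<Longrightarrow> f \<bullet> z = 0"
  obtains \<xi> where "\<And>z. f \<bullet> z = \<xi> \<bullet> M z"
proof -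
  interpret M: bounded_linear M by (rule M)
  have "\<exists>g. \<forall>z. \<xi> \<bullet> M z = g \<bullet> z" for \<xi>
    using riesz_representation[OF bounded_linear_compose[OF bounded_linear_inner_right M]] by metis
  then obtain M' where M': "\<And>\<xi> z. \<xi> \<bullet> M z = M' \<xi> \<bullet> z" by metis
  obtain k where k: "\<And>z. norm (M z) \<le> norm z * k" using M.bounded by blast
  have M'lin: "bounded_linear M'"
  proof (rule bounded_linear_intro[where K = k])
    show "M' (x + y) = M' x + M' y" for x y
      by (rule vector_eq_rdot[THEN iffD1]) (simp add: inner_add_left flip: M')
    show "M' (r *\<^sub>R x) = r *\<^sub>R M' x" for r x
      by (rule vector_eq_rdot[THEN iffD1]) (simp flip: M')
    show "norm (M' x) \<le> norm x * k" for x
    proof (cases "M' x = 0")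
      case True
      have "0 \<le> norm (M' x) * k" using k[of "M' x"] norm_ge_zero order_trans by blast
      show ?thesis
      proof (cases "x = 0")
        case False
        obtain z where "M z = x" using surj by (metis surjD)
        then have "z \<noteq> 0" using False M.zero by auto
        moreover have "0 \<le> norm z * k" using k[of z] norm_ge_zero order_trans by blast
        ultimately have "0 \<le> k" by (simp add: zero_le_mult_iff)
        then show ?thesis using True by simp
      qed (use True in simp)
    next
      case False
      have "norm (M' x) * norm (M' x) = x \<bullet> M (M' x)"
        by (simp add: M' power2_norm_eq_inner[symmetric] power2_eq_square)
      also have "\<dots> \<le> norm x * norm (M (M' x))" by (rule norm_cauchy_schwarz)
      also have "\<dots> \<le> norm x * (norm (M' x) * k)" by (intro mult_left_mono k) auto
      finally show ?thesis using False by (simp add: algebra_simps)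
    qed
  qed
  interpret M': bounded_linear M' by (rule M'lin)
  have bil: "bounded_bilinear (\<lambda>x y. M' x \<bullet> M' y)"
    by (rule bounded_bilinear.comp[OF bounded_bilinear_inner M'lin M'lin])
  obtain c where c: "c > 0" "\<And>x. c * (norm x)\<^sup>2 \<le> M' x \<bullet> M' x"
  proof (rule coercive_if_weakly_bounded[of "\<lambda>x. M' x \<bullet> M' x"])
    show "M' (r *\<^sub>R x) \<bullet> M' (r *\<^sub>R x) = r\<^sup>2 * (M' x \<bullet> M' x)" for r x
      by (simp add: M'.scale power2_eq_square)
    show "0 \<le> M' x \<bullet> M' x" for x by simp
    fix h
    obtain z where z: "h = M z" using surj by (metis surjD)
    have "\<bar>x \<bullet> h\<bar> \<le> norm z" if "M' x \<bullet> M' x \<le> 1" for x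
    proof -
      have "(norm (M' x))\<^sup>2 \<le> 1\<^sup>2" using that by (simp add: power2_norm_eq_inner)
      then have "norm (M' x) \<le> 1" by (rule power2_le_imp_le) simp
      have "\<bar>x \<bullet> h\<bar> \<le> norm (M' x) * norm z" unfolding z M' by (rule Cauchy_Schwarz_ineq2)
      also have "\<dots> \<le> 1 * norm z" by (intro mult_right_mono \<open>norm (M' x) \<le> 1\<close>) simp
      finally show ?thesis by simp
    qed
    then show "\<exists>C. \<forall>x. M' x \<bullet> M' x \<le> 1 \<longrightarrow> \<bar>x \<bullet> h\<bar> \<le> C" by blast
  qed blast
  obtain \<xi> where \<xi>: "\<And>\<eta>. M' \<xi> \<bullet> M' \<eta> = f \<bullet> M' \<eta>"
    by (rule lax_milgram[OF bil c bounded_linear_compose[OF bounded_linear_inner_right M'lin]]) blast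
  define z where "z = f - M' \<xi>"
  have "M z \<bullet> \<eta> = 0" for \<eta>
    using \<xi>[of \<eta>] M'[of \<eta> z] by (simp add: z_def inner_diff_left inner_diff_right inner_commute)
  then have "M z = 0" by (metis inner_eq_zero_iff)
  then have "f \<bullet> z = 0" "M' \<xi> \<bullet> z = 0" using f M'[of \<xi> z] by auto
  then have "z \<bullet> z = 0" by (simp add: z_def inner_diff_left)
  then have "f = M' \<xi>" by (simp add: z_def)
  then show ?thesis using that[of \<xi>] M' by simp
qed

definition linear_map_on :: "'u::real_vector set \<Rightarrow> ('u \<Rightarrow> 'w::real_vector) \<Rightarrow> bool" where
  "linear_map_on D f \<longleftrightarrow> subspace D \<and>
     (\<forall>x\<in>D. \<forall>y\<in>D. f (x + y) = f x + f y) \<and> (\<forall>r. \<forall>x\<in>D. f (r *\<^sub>R x) = r *\<^sub>R f x)"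

lemma linear_map_onD:
  assumes "linear_map_on D f"
  shows "subspace D"
    and "\<And>x y. x \<in> D \<Longrightarrow> y \<in> D \<Longrightarrow> f (x + y) = f x + f y"
    and "\<And>r x. x \<in> D \<Longrightarrow> f (r *\<^sub>R x) = r *\<^sub>R f x"
    and "f 0 = 0"
    and "\<And>x. x \<in> D \<Longrightarrow> f (- x) = - f x"
    and "\<And>x y. x \<in> D \<Longrightarrow> y \<in> D \<Longrightarrow> f (x - y) = f x - f y"
proof -
  show s: "subspace D" and a: "\<And>x y. x \<in> D \<Longrightarrow> y \<in> D \<Longrightarrow> f (x + y) = f x + f y"
    and h: "\<And>r x. x \<in> D \<Longrightarrow> f (r *\<^sub>R x) = r *\<^sub>R f x"
    using assms by (auto simp: linear_map_on_def)
  show "f 0 = 0" using h[of 0 0] subspace_0[OF s] by simp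
  show m: "f (- x) = - f x" if "x \<in> D" for x using h[of x "-1"] that by simp
  show "f (x - y) = f x - f y" if "x \<in> D" "y \<in> D" for x y
    using a[of x "- y"] m[of y] that subspace_neg[OF s] by simp
qed

lemma subspace_linear_map_on_image:
  assumes f: "linear_map_on D f" shows "subspace (f ` D)"
proof (rule subspaceI)
  show "0 \<in> f ` D"
    using linear_map_onD(1,4)[OF f] subspace_0 by (metis image_eqI)
  show "u + v \<in> f ` D" if "u \<in> f ` D" "v \<in> f ` D" for u v
  proof -
    from that obtain x y where xy: "x \<in> D" "y \<in> D" "u = f x" "v = f y" by blast
    then have "u + v = f (x + y)" using linear_map_onD(2)[OF f] by simp
    then show ?thesis using xy subspace_add[OF linear_map_onD(1)[OF f]] by blast
  qed
  show "r *\<^sub>R u \<in> f ` D" if u: "u \<in> f ` D" for r u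
  proof -
    from u obtain x where x: "x \<in> D" "u = f x" by blast
    then have "r *\<^sub>R u = f (r *\<^sub>R x)" using linear_map_onD(3)[OF f] by simp
    then show ?thesis using x subspace_scale[OF linear_map_onD(1)[OF f]] by blast
  qed
qed

text \<open>
  The domain \<open>D\<close> is seen as a dense subspace through \<open>e\<close>, as for the canonical map into a
  completion.
\<close>

lemma bounded_extension:
  fixes e :: "'u::real_vector \<Rightarrow> 'v::real_normed_vector"
    and f :: "'u \<Rightarrow> 'w::{real_normed_vector, complete_space}"
  assumes e: "linear_map_on D e" and f: "linear_map_on D f"
    and dense: "closure (e ` D) = UNIV"
    and bound: "\<And>x. x \<in> D \<Longrightarrow> norm (f x) \<le> K * norm (e x)"
  obtains T where "bounded_linear T" "\<And>x. x \<in> D \<Longrightarrow> T (e x) = f x"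
    "\<And>v. norm (T v) \<le> K * norm v"
proof -
  note sub = linear_map_onD(1)[OF e]
  note el = linear_map_onD[OF e] and fl = linear_map_onD[OF f]
  have key: "(\<lambda>n. f (s n)) \<longlonglongrightarrow> L" if "\<And>n. s n \<in> D" "\<And>n. s' n \<in> D" "(\<lambda>n. e (s n)) \<longlonglongrightarrow> v"
    "(\<lambda>n. e (s' n)) \<longlonglongrightarrow> v" "(\<lambda>n. f (s' n)) \<longlonglongrightarrow> L" for s s' v L
  proof -
    have "(\<lambda>n. f (s n) - f (s' n)) \<longlonglongrightarrow> 0"
    proof (rule Lim_null_comparison)
      show "\<forall>\<^sub>F n in sequentially. norm (f (s n) - f (s' n)) \<le> K * norm (e (s n) - e (s' n))"
        using bound[OF subspace_diff[OF sub that(1) that(2)]] that(1,2) el(6) fl(6)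
        by (auto intro!: always_eventually)
      have "(\<lambda>n. K * norm (e (s n) - e (s' n))) \<longlonglongrightarrow> K * norm (v - v)"
        by (intro tendsto_intros that)
      then show "(\<lambda>n. K * norm (e (s n) - e (s' n))) \<longlonglongrightarrow> 0" by simp
    qed
    from tendsto_add[OF this that(5)] show ?thesis by simp
  qed
  have "\<exists>s L. (\<forall>n. s n \<in> D) \<and> (\<lambda>n. e (s n)) \<longlonglongrightarrow> v \<and> (\<lambda>n. f (s n)) \<longlonglongrightarrow> L" for v
  proof -
    have "v \<in> closure (e ` D)" using dense by simp
    then obtain t where t: "\<And>n. t n \<in> e ` D" "t \<longlonglongrightarrow> v" by (auto simp: closure_sequential)
    then have "\<forall>n. \<exists>u\<in>D. t n = e u" by blast
    then obtain s where s: "\<And>n. s n \<in> D" "\<And>n. t n = e (s n)" by metis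
    have es: "(\<lambda>n. e (s n)) \<longlonglongrightarrow> v" using t(2) unfolding s(2)[symmetric] .
    have "\<exists>L. (\<lambda>n. f (s n)) \<longlonglongrightarrow> L"
    proof (rule convergent_if_dist_le[OF LIMSEQ_imp_Cauchy[OF es]])
      show "dist (f (s m)) (f (s n)) \<le> K * dist (e (s m)) (e (s n))" for m n
        using bound[OF subspace_diff[OF sub s(1) s(1)], of m n] s(1) el(6) fl(6)
        by (simp add: dist_norm)
    qed
    then show ?thesis using s es by blast
  qed
  then obtain S T where S: "\<And>v n. S v n \<in> D" "\<And>v. (\<lambda>n. e (S v n)) \<longlonglongrightarrow> v"
    and T: "\<And>v. (\<lambda>n. f (S v n)) \<longlonglongrightarrow> T v" by metis
  have T_lim: "(\<lambda>n. f (s n)) \<longlonglongrightarrow> T v" if "\<And>n. s n \<in> D" "(\<lambda>n. e (s n)) \<longlonglongrightarrow> v" for s v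
    by (rule key[OF that(1) S(1) that(2) S(2) T])
  have Tb: "norm (T v) \<le> K * norm v" for v
  proof (rule LIMSEQ_le)
    show "(\<lambda>n. norm (f (S v n))) \<longlonglongrightarrow> norm (T v)" by (intro tendsto_intros T)
    show "(\<lambda>n. K * norm (e (S v n))) \<longlonglongrightarrow> K * norm v" by (intro tendsto_intros S)
    show "\<exists>N. \<forall>n\<ge>N. norm (f (S v n)) \<le> K * norm (e (S v n))" using bound S(1) by blast
  qed
  have add: "T (u + v) = T u + T v" for u v
  proof (rule LIMSEQ_unique)
    have "(\<lambda>n. e (S u n + S v n)) \<longlonglongrightarrow> u + v"
      using tendsto_add[OF S(2) S(2), of u v] S(1) el(2) by simp
    then show "(\<lambda>n. f (S u n + S v n)) \<longlonglongrightarrow> T (u + v)"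
      by (intro T_lim subspace_add sub S)
    show "(\<lambda>n. f (S u n + S v n)) \<longlonglongrightarrow> T u + T v"
      using tendsto_add[OF T T, of u v] S(1) fl(2) by simp
  qed
  have scale: "T (r *\<^sub>R v) = r *\<^sub>R T v" for r v
  proof (rule LIMSEQ_unique)
    have "(\<lambda>n. e (r *\<^sub>R S v n)) \<longlonglongrightarrow> r *\<^sub>R v"
      using tendsto_scaleR[OF tendsto_const S(2), of r v] S(1) el(3) by simp
    then show "(\<lambda>n. f (r *\<^sub>R S v n)) \<longlonglongrightarrow> T (r *\<^sub>R v)"
      by (intro T_lim subspace_scale sub S)
    show "(\<lambda>n. f (r *\<^sub>R S v n)) \<longlonglongrightarrow> r *\<^sub>R T v"
      using tendsto_scaleR[OF tendsto_const T, of r v] S(1) fl(3) by simp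
  qed
  have "bounded_linear T"
    by (rule bounded_linear_intro[OF add scale, of K]) (use Tb in \<open>simp add: mult.commute\<close>)
  moreover have "T (e x) = f x" if "x \<in> D" for x
    by (rule LIMSEQ_unique[OF T_lim[of "\<lambda>_. x" "e x"]]) (use that in auto)
  ultimately show ?thesis using that Tb by blast
qed

section \<open>Square roots of positive operators\<close>

definition pos_symmetric :: "('a::real_inner \<Rightarrow> 'a) \<Rightarrow> bool" where
  "pos_symmetric P \<longleftrightarrow> bounded_linear P \<and> (\<forall>x y. P x \<bullet> y = x \<bullet> P y) \<and> (\<forall>x. 0 \<le> P x \<bullet> x)"

lemma pos_symmetric_Cauchy_Schwarz:
  assumes P: "pos_symmetric P"
  shows "(P x \<bullet> y)\<^sup>2 \<le> (P x \<bullet> x) * (P y \<bullet> y)"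
proof -
  interpret bounded_linear P using P by (simp add: pos_symmetric_def)
  have sym: "P u \<bullet> v = P v \<bullet> u" for u v
    using P by (simp add: pos_symmetric_def inner_commute)
  have pos: "0 \<le> P u \<bullet> u" for u using P unfolding pos_symmetric_def by blast
  have quad: "0 \<le> (P x \<bullet> x) * r\<^sup>2 + 2 * (P x \<bullet> y) * r * s + (P y \<bullet> y) * s\<^sup>2" for r s
  proof -
    have "0 \<le> P (r *\<^sub>R x + s *\<^sub>R y) \<bullet> (r *\<^sub>R x + s *\<^sub>R y)" by (rule pos)
    also have "\<dots> = (P x \<bullet> x) * r\<^sup>2 + 2 * (P x \<bullet> y) * r * s + (P y \<bullet> y) * s\<^sup>2"
      using sym[of y x]
      by (simp add: add scale inner_add_left inner_add_right algebra_simps power2_eq_square)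
    finally show ?thesis .
  qed
  show ?thesis
  proof (cases "P y \<bullet> y = 0")
    case False
    then have yy: "P y \<bullet> y > 0" using pos[of y] by simp
    have "0 \<le> (P x \<bullet> x) * (P y \<bullet> y)\<^sup>2 - (P x \<bullet> y)\<^sup>2 * (P y \<bullet> y)"
      using quad[of "P y \<bullet> y" "- (P x \<bullet> y)"] by (simp add: algebra_simps power2_eq_square)
    then have "(P x \<bullet> y)\<^sup>2 * (P y \<bullet> y) \<le> (P x \<bullet> x) * (P y \<bullet> y) * (P y \<bullet> y)"
      by (simp add: power2_eq_square algebra_simps)
    then show ?thesis using yy by simp
  next
    case True
    have "P x \<bullet> y = 0"
    proof (rule ccontr)
      assume ne: "P x \<bullet> y \<noteq> 0"
      define s where "s = - (P x \<bullet> x + 1) / (2 * (P x \<bullet> y))"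
      have "0 \<le> P x \<bullet> x + 2 * (P x \<bullet> y) * s" using quad[of 1 s] True by simp
      also have "2 * (P x \<bullet> y) * s = - (P x \<bullet> x + 1)" using ne by (simp add: s_def)
      finally show False by simp
    qed
    then show ?thesis using True by simp
  qed
qed

lemma pos_symmetric_eq_0:
  assumes P: "pos_symmetric P" and "P x \<bullet> x = 0"
  shows "P x = 0"
  using pos_symmetric_Cauchy_Schwarz[OF P, of x "P x"] assms(2) by simp

lemma pos_symmetric_contraction:
  assumes A: "pos_symmetric A" and le: "\<And>x. A x \<bullet> x \<le> (norm x)\<^sup>2"
  shows "norm (A x) \<le> norm x"
proof (cases "A x = 0")
  case False
  have "((norm (A x))\<^sup>2)\<^sup>2 = (A x \<bullet> A x)\<^sup>2" by (simp add: power2_norm_eq_inner)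
  also have "\<dots> \<le> (A x \<bullet> x) * (A (A x) \<bullet> A x)" by (rule pos_symmetric_Cauchy_Schwarz[OF A])
  also have "\<dots> \<le> (norm x)\<^sup>2 * (norm (A x))\<^sup>2"
    using A unfolding pos_symmetric_def by (intro mult_mono le) (simp, blast)
  finally have "(norm (A x))\<^sup>2 \<le> (norm x)\<^sup>2"
    using False by (simp add: power2_eq_square)
  then show ?thesis using power2_le_imp_le norm_ge_zero by blast
qed simp

text \<open>
  For \<open>0 \<le> A \<le> 1\<close>, the limit \<open>Z\<close> of these iterates satisfies \<open>Z = (A + Z\<^sup>2) / 2\<close>, that is
  \<open>(1 - Z)\<^sup>2 = 1 - A\<close>.
\<close>

fun sqrt_step :: "('a::real_normed_vector \<Rightarrow> 'a) \<Rightarrow> nat \<Rightarrow> 'a \<Rightarrow> 'a" where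
  "sqrt_step A 0 x = 0"
| "sqrt_step A (Suc n) x = (1/2) *\<^sub>R (A x + sqrt_step A n (sqrt_step A n x))"

text \<open>
  The same iteration for the number \<open>A = 1\<close>. It is increasing with limit at most 1, and it
  dominates the norms of the operator iterates and of their increments.
\<close>

fun sqrt_bound :: "nat \<Rightarrow> real" where
  "sqrt_bound 0 = 0"
| "sqrt_bound (Suc n) = (1 + (sqrt_bound n)\<^sup>2) / 2"

lemma sqrt_bound_props: "0 \<le> sqrt_bound n \<and> sqrt_bound n \<le> 1 \<and> sqrt_bound n \<le> sqrt_bound (Suc n)"
proof (induction n)
  case (Suc n)
  have "(sqrt_bound (Suc n))\<^sup>2 \<le> 1" using Suc power_le_one[of "sqrt_bound n" 2]
    by (intro power_le_one) auto
  moreover have "0 \<le> sqrt_bound (Suc n)" "sqrt_bound (Suc n) \<le> 1"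
    using Suc power_le_one[of "sqrt_bound n" 2] by auto
  moreover have "sqrt_bound (Suc n) \<le> sqrt_bound (Suc (Suc n))"
  proof -
    have "(sqrt_bound n)\<^sup>2 \<le> (sqrt_bound (Suc n))\<^sup>2" using Suc by (intro power_mono) auto
    then show ?thesis by (simp only: sqrt_bound.simps(2)) simp
  qed
  ultimately show ?case by blast
qed simp

text \<open>
  After scaling, \<open>P = M (1 - A)\<close> with \<open>0 \<le> A \<le> 1\<close>, and the square root is a multiple of \<open>1 - Z\<close>,
  with \<open>Z\<close> the limit of the iteration. The iterates are polynomials in \<open>A\<close>, so every bounded
  operator that commutes with \<open>P\<close> commutes with the square root.
\<close>

lemma pos_symmetric_sqrt_exists:
  fixes P :: "'a::{real_inner, complete_space} \<Rightarrow> 'a"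
  assumes P: "pos_symmetric P"
  obtains Q where "pos_symmetric Q" "\<And>x. Q (Q x) = P x"
    "\<And>T x. bounded_linear T \<Longrightarrow> (\<And>x. T (P x) = P (T x)) \<Longrightarrow> T (Q x) = Q (T x)"
proof -
  interpret P: bounded_linear P using P by (simp add: pos_symmetric_def)
  obtain M where M: "M > 0" "\<And>x. norm (P x) \<le> norm x * M" using P.pos_bounded by blast
  define A where "A x = x - (1/M) *\<^sub>R P x" for x
  have Alin: "bounded_linear A"
    unfolding A_def by (intro bounded_linear_sub bounded_linear_ident
        bounded_linear_const_scaleR P.bounded_linear_axioms)
  have Asym: "A x \<bullet> y = x \<bullet> A y" for x y
    using P by (simp add: A_def pos_symmetric_def inner_diff_left inner_diff_right)
  have PM: "P x \<bullet> x \<le> M * (norm x)\<^sup>2" for x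
  proof -
    have "P x \<bullet> x \<le> norm (P x) * norm x" by (rule norm_cauchy_schwarz)
    also have "\<dots> \<le> (norm x * M) * norm x" by (intro mult_right_mono M) auto
    finally show ?thesis by (simp add: power2_eq_square algebra_simps)
  qed
  have Apos: "0 \<le> A x \<bullet> x" for x
    using PM[of x] M(1) by (simp add: A_def inner_diff_left power2_norm_eq_inner field_simps)
  have A: "pos_symmetric A" using Alin Asym Apos by (simp add: pos_symmetric_def)
  have A1: "norm (A x) \<le> norm x" for x
  proof (rule pos_symmetric_contraction[OF A])
    show "A x \<bullet> x \<le> (norm x)\<^sup>2" for x
    proof -
      have "0 \<le> P x \<bullet> x" using P unfolding pos_symmetric_def by blast
      then show ?thesis using M(1) by (simp add: A_def inner_diff_left power2_norm_eq_inner)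
    qed
  qed
  define Y where "Y = sqrt_step A"
  define y where "y = sqrt_bound"
  have Y0: "Y 0 x = 0" and YS: "Y (Suc n) x = (1/2) *\<^sub>R (A x + Y n (Y n x))" for n x
    by (simp_all add: Y_def)
  have y0: "y 0 = 0" and yS: "y (Suc n) = (1 + (y n)\<^sup>2) / 2" for n by (simp_all add: y_def)
  have y01: "0 \<le> y n" "y n \<le> 1" "y n \<le> y (Suc n)" for n
    using sqrt_bound_props[of n] unfolding y_def by auto
  have Ylin: "bounded_linear (Y n)" for n
  proof (induction n)
    case 0 show ?case by (simp add: Y0[abs_def] bounded_linear_zero)
  next
    case (Suc n)
    show ?case unfolding YS[abs_def]
      by (intro bounded_linear_const_scaleR bounded_linear_add Alin
          bounded_linear_compose[OF Suc Suc])
  qed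
  have Ysym: "Y n x \<bullet> z = x \<bullet> Y n z" for n x z
  proof (induction n arbitrary: x z)
    case 0 show ?case by (simp add: Y0)
  next
    case (Suc n) show ?case
      by (simp add: YS inner_add_left inner_add_right Asym Suc)
  qed
  have Yb: "norm (Y n x) \<le> y n * norm x" for n x
  proof (induction n arbitrary: x)
    case 0 show ?case by (simp add: Y0 y0)
  next
    case (Suc n)
    have "norm (Y n (Y n x)) \<le> y n * (y n * norm x)"
      using Suc[of "Y n x"] mult_left_mono[OF Suc[of x] y01(1)] by (rule order_trans)
    then have "norm (A x + Y n (Y n x)) \<le> norm x + (y n)\<^sup>2 * norm x"
      using A1[of x] norm_triangle_ineq[of "A x" "Y n (Y n x)"] by (simp add: power2_eq_square)
    moreover have "norm (Y (Suc n) x) = norm (A x + Y n (Y n x)) / 2"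
      unfolding YS norm_scaleR by simp
    ultimately show ?case by (simp add: yS algebra_simps)
  qed
  have Yd: "norm (Y (Suc n) x - Y n x) \<le> (y (Suc n) - y n) * norm x" for n x
  proof (induction n arbitrary: x)
    case 0
    show ?case using A1[of x] by (simp add: YS Y0 yS y0)
  next
    case (Suc n)
    interpret Yn: bounded_linear "Y n" by (rule Ylin)
    interpret YSn: bounded_linear "Y (Suc n)" by (rule Ylin)
    define \<delta> where "\<delta> = y (Suc n) - y n"
    have \<delta>: "0 \<le> \<delta>" using y01 by (simp add: \<delta>_def)
    have eq: "Y (Suc (Suc n)) x - Y (Suc n) x
        = (1/2) *\<^sub>R (Y (Suc n) (Y (Suc n) x - Y n x) + (Y (Suc n) (Y n x) - Y n (Y n x)))"
      using YS[of "Suc n" x] YS[of n x] by (simp add: YSn.diff scaleR_right_diff_distrib scaleR_right_distrib)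
    have "norm (Y (Suc n) (Y (Suc n) x - Y n x)) \<le> y (Suc n) * (\<delta> * norm x)"
      using Yb[of "Suc n" "Y (Suc n) x - Y n x"] mult_left_mono[OF Suc[of x] y01(1)[of "Suc n"]]
      unfolding \<delta>_def by (rule order_trans)
    moreover have "norm (Y (Suc n) (Y n x) - Y n (Y n x)) \<le> \<delta> * (y n * norm x)"
      using Suc[of "Y n x"] mult_left_mono[OF Yb[of n x] \<delta>] unfolding \<delta>_def by (rule order_trans)
    ultimately have "norm (Y (Suc n) (Y (Suc n) x - Y n x) + (Y (Suc n) (Y n x) - Y n (Y n x)))
        \<le> y (Suc n) * (\<delta> * norm x) + \<delta> * (y n * norm x)"
      by (intro norm_triangle_le) linarith
    then have "norm (Y (Suc (Suc n)) x - Y (Suc n) x) \<le> (1/2) * (y (Suc n) * (\<delta> * norm x) + \<delta> * (y n * norm x))"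
      unfolding eq by simp
    also have "\<dots> = (y (Suc (Suc n)) - y (Suc n)) * norm x"
    proof -
      have "y (Suc (Suc n)) - y (Suc n) = (1/2) * (y (Suc n) + y n) * (y (Suc n) - y n)"
        unfolding yS[of "Suc n"] by (subst (2) yS) (simp add: field_simps power2_eq_square)
      moreover have "(1/2) * (y (Suc n) * (\<delta> * norm x) + \<delta> * (y n * norm x))
          = (1/2) * (y (Suc n) + y n) * \<delta> * norm x"
        by (simp add: field_simps)
      ultimately show ?thesis by (simp only: \<delta>_def)
    qed
    finally show ?case .
  qed
  have Ydd: "norm (Y (n + k) x - Y n x) \<le> (y (n + k) - y n) * norm x" for n k x
  proof (induction k)
    case (Suc k)
    have "norm (Y (n + Suc k) x - Y n x) \<le> norm (Y (Suc (n + k)) x - Y (n + k) x) + norm (Y (n + k) x - Y n x)"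
      using norm_triangle_ineq[of "Y (Suc (n + k)) x - Y (n + k) x" "Y (n + k) x - Y n x"] by simp
    also have "\<dots> \<le> (y (Suc (n + k)) - y (n + k)) * norm x + (y (n + k) - y n) * norm x"
      by (intro add_mono Yd Suc)
    finally show ?case by (simp add: algebra_simps)
  qed simp
  have "convergent y" by (rule Bseq_mono_convergent)
      (auto intro!: BseqI'[of _ 1] lift_Suc_mono_le y01 simp: y01)
  then have Cy: "Cauchy y" using convergent_Cauchy by blast
  have "\<exists>L. (\<lambda>n. Y n x) \<longlonglongrightarrow> L" for x
  proof (rule convergent_if_dist_le[OF Cy])
    have *: "dist (Y m x) (Y n x) \<le> norm x * dist (y m) (y n)" if "n \<le> m" for m n
      using Ydd[of n "m - n" x] that mult_left_mono[OF abs_ge_self norm_ge_zero[of x], of "y m - y n"]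
      by (simp add: dist_norm mult.commute)
    show "dist (Y m x) (Y n x) \<le> norm x * dist (y m) (y n)" for m n
      using *[of n m] *[of m n] by (cases "n \<le> m") (auto simp: dist_commute)
  qed
  then obtain Z where Z: "\<And>x. (\<lambda>n. Y n x) \<longlonglongrightarrow> Z x" by metis
  have Zb: "norm (Z x) \<le> norm x" for x
  proof (rule LIMSEQ_le_const2[OF tendsto_norm[OF Z]])
    have "norm (Y n x) \<le> norm x" for n
      using Yb[of n x] mult_right_mono[OF y01(2)[of n] norm_ge_zero[of x]] by simp
    then show "\<exists>N. \<forall>n\<ge>N. norm (Y n x) \<le> norm x" by blast
  qed
  have Zlin: "bounded_linear Z"
  proof (rule bounded_linear_intro[where K = 1])
    show "Z (x + z) = Z x + Z z" for x z
    proof (rule LIMSEQ_unique[OF Z])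
      show "(\<lambda>n. Y n (x + z)) \<longlonglongrightarrow> Z x + Z z"
        unfolding linear_add[OF bounded_linear.linear[OF Ylin]] by (intro tendsto_intros Z)
    qed
    show "Z (r *\<^sub>R x) = r *\<^sub>R Z x" for r x
    proof (rule LIMSEQ_unique[OF Z])
      show "(\<lambda>n. Y n (r *\<^sub>R x)) \<longlonglongrightarrow> r *\<^sub>R Z x"
        unfolding linear_scale[OF bounded_linear.linear[OF Ylin]] by (intro tendsto_intros Z)
    qed
    show "norm (Z x) \<le> norm x * 1" for x using Zb by simp
  qed
  interpret Z: bounded_linear Z by (rule Zlin)
  have Zsym: "Z x \<bullet> z = x \<bullet> Z z" for x z
  proof (rule LIMSEQ_unique)
    show "(\<lambda>n. Y n x \<bullet> z) \<longlonglongrightarrow> Z x \<bullet> z" by (intro tendsto_intros Z)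
    show "(\<lambda>n. Y n x \<bullet> z) \<longlonglongrightarrow> x \<bullet> Z z" unfolding Ysym by (intro tendsto_intros Z)
  qed
  have YY: "(\<lambda>n. Y n (Y n x)) \<longlonglongrightarrow> Z (Z x)" for x
  proof -
    have "(\<lambda>n. Y n (Y n x) - Y n (Z x)) \<longlonglongrightarrow> 0"
    proof (rule Lim_null_comparison)
      show "\<forall>\<^sub>F n in sequentially. norm (Y n (Y n x) - Y n (Z x)) \<le> norm (Y n x - Z x)"
      proof (intro always_eventually allI)
        fix n
        interpret Yn: bounded_linear "Y n" by (rule Ylin)
        have "norm (Y n (Y n x) - Y n (Z x)) \<le> y n * norm (Y n x - Z x)"
          using Yb[of n "Y n x - Z x"] by (simp add: Yn.diff)
        also have "\<dots> \<le> 1 * norm (Y n x - Z x)" by (intro mult_right_mono y01) auto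
        finally show "norm (Y n (Y n x) - Y n (Z x)) \<le> norm (Y n x - Z x)" by simp
      qed
      show "(\<lambda>n. norm (Y n x - Z x)) \<longlonglongrightarrow> 0"
        using tendsto_norm[OF tendsto_diff[OF Z[of x] tendsto_const[of "Z x"]]] by simp
    qed
    from tendsto_add[OF this Z[of "Z x"]] show ?thesis by simp
  qed
  have ZZ: "Z (Z x) = 2 *\<^sub>R Z x - A x" for x
  proof -
    have "(\<lambda>n. Y (Suc n) x) \<longlonglongrightarrow> (1/2) *\<^sub>R (A x + Z (Z x))"
      unfolding YS by (intro tendsto_intros YY)
    then have "Z x = (1/2) *\<^sub>R (A x + Z (Z x))"
      using LIMSEQ_Suc[OF Z[of x]] LIMSEQ_unique by blast
    then have "2 *\<^sub>R Z x = 2 *\<^sub>R ((1/2) *\<^sub>R (A x + Z (Z x)))" by (rule arg_cong)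
    also have "\<dots> = A x + Z (Z x)" by simp
    finally have "2 *\<^sub>R Z x = A x + Z (Z x)" .
    then show ?thesis by simp
  qed
  define Q where "Q x = sqrt M *\<^sub>R (x - Z x)" for x
  have Qlin: "bounded_linear Q" unfolding Q_def
    by (intro bounded_linear_const_scaleR bounded_linear_sub bounded_linear_ident Zlin)
  have "0 \<le> Q x \<bullet> x" for x
  proof -
    have "Z x \<bullet> x \<le> norm (Z x) * norm x" by (rule norm_cauchy_schwarz)
    also have "\<dots> \<le> norm x * norm x" by (intro mult_right_mono Zb) auto
    finally have "Z x \<bullet> x \<le> x \<bullet> x" by (simp add: power2_norm_eq_inner[symmetric] power2_eq_square)
    then show ?thesis using M by (simp add: Q_def inner_diff_left)
  qed
  moreover have "Q x \<bullet> z = x \<bullet> Q z" for x z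
    by (simp add: Q_def inner_diff_left inner_diff_right Zsym)
  ultimately have "pos_symmetric Q" using Qlin by (simp add: pos_symmetric_def)
  moreover have "Q (Q x) = P x" for x
  proof -
    have "Q (Q x) = (sqrt M * sqrt M) *\<^sub>R (x - Z x - (Z x - Z (Z x)))"
      by (simp only: Q_def Z.scale Z.diff scaleR_right_diff_distrib[symmetric] scaleR_scaleR)
    also have "x - Z x - (Z x - Z (Z x)) = (1/M) *\<^sub>R P x" by (simp add: ZZ A_def scaleR_2)
    finally show ?thesis using M by simp
  qed
  moreover have "T (Q x) = Q (T x)" if T: "bounded_linear T" and TP: "\<And>x. T (P x) = P (T x)" for T x
  proof -
    interpret T: bounded_linear T by (rule T)
    have TA: "T (A x) = A (T x)" for x by (simp add: A_def T.diff T.scale TP)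
    have TY: "T (Y n x) = Y n (T x)" for n x
    proof (induction n arbitrary: x)
      case 0 show ?case by (simp add: Y0 T.zero)
    next
      case (Suc n) show ?case by (simp add: YS T.scale T.add TA Suc)
    qed
    have "T (Z x) = Z (T x)"
    proof (rule LIMSEQ_unique)
      show "(\<lambda>n. T (Y n x)) \<longlonglongrightarrow> T (Z x)" by (intro T.tendsto Z)
      show "(\<lambda>n. T (Y n x)) \<longlonglongrightarrow> Z (T x)" unfolding TY by (rule Z)
    qed
    then show ?thesis by (simp add: Q_def T.scale T.diff)
  qed
  ultimately show ?thesis by (rule that)
qed

text \<open>
  With \<open>y = Q x - Q' x\<close>, commutation gives \<open>(Q + Q') y = 0\<close>. Both \<open>\<langle>Q y, y\<rangle>\<close> and \<open>\<langle>Q' y, y\<rangle>\<close> are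
  nonnegative, hence \<open>Q y = Q' y = 0\<close> and \<open>\<parallel>y\<parallel>\<^sup>2 = \<langle>(Q - Q') y, x\<rangle> = 0\<close>.
\<close>

lemma pos_symmetric_sqrt_unique:
  fixes Q Q' :: "'a::{real_inner, complete_space} \<Rightarrow> 'a"
  assumes Q: "pos_symmetric Q" and Q': "pos_symmetric Q'"
    and comm: "\<And>x. Q (Q' x) = Q' (Q x)" and eq: "\<And>x. Q (Q x) = Q' (Q' x)"
  shows "Q = Q'"
proof
  fix x
  interpret Q: bounded_linear Q using Q by (simp add: pos_symmetric_def)
  interpret Q': bounded_linear Q' using Q' by (simp add: pos_symmetric_def)
  have sQ: "Q u \<bullet> v = u \<bullet> Q v" and sQ': "Q' u \<bullet> v = u \<bullet> Q' v" for u v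
    using Q Q' by (auto simp: pos_symmetric_def)
  define y where "y = Q x - Q' x"
  have "Q y \<bullet> y + Q' y \<bullet> y = (Q y + Q' y) \<bullet> y" by (simp add: inner_add_left)
  also have "Q y + Q' y = 0" by (simp add: y_def Q.diff Q'.diff comm eq)
  finally have s: "Q y \<bullet> y + Q' y \<bullet> y = 0" by simp
  have "0 \<le> Q y \<bullet> y" "0 \<le> Q' y \<bullet> y" using Q Q' by (auto simp: pos_symmetric_def)
  with s have "Q y \<bullet> y = 0" "Q' y \<bullet> y = 0" by auto
  then have "Q y = 0" "Q' y = 0" using pos_symmetric_eq_0 Q Q' by blast+
  have "y \<bullet> y = (Q x - Q' x) \<bullet> y" by (simp add: y_def)
  also have "\<dots> = x \<bullet> Q y - x \<bullet> Q' y" by (simp add: inner_diff_left sQ sQ')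
  also have "\<dots> = 0" using \<open>Q y = 0\<close> \<open>Q' y = 0\<close> by simp
  finally show "Q x = Q' x" by (simp add: y_def)
qed

section \<open>Unbounded self-adjoint operators\<close>

text \<open>
  Self-adjointness in terms of the real scalar product: \<open>maximal\<close> says that the domain of the
  adjoint is contained in \<open>D\<close>.
\<close>

locale selfadjoint =
  fixes D :: "'h::{real_inner, complete_space} set" and B :: "'h \<Rightarrow> 'h"
  assumes lin: "linear_map_on D B"
    and dense: "closure D = UNIV"
    and sym: "\<And>x y. x \<in> D \<Longrightarrow> y \<in> D \<Longrightarrow> B x \<bullet> y = x \<bullet> B y"
    and maximal: "\<And>x y. (\<And>z. z \<in> D \<Longrightarrow> x \<bullet> B z = y \<bullet> z) \<Longrightarrow> x \<in> D \<and> B x = y"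
begin

lemmas sub = linear_map_onD(1)[OF lin]
lemmas B_simps = linear_map_onD(2-)[OF lin]

lemma D_simps [simp]:
  "0 \<in> D"
  "x \<in> D \<Longrightarrow> y \<in> D \<Longrightarrow> x + y \<in> D"
  "x \<in> D \<Longrightarrow> y \<in> D \<Longrightarrow> x - y \<in> D"
  "x \<in> D \<Longrightarrow> - x \<in> D"
  "x \<in> D \<Longrightarrow> r *\<^sub>R x \<in> D"
  using sub by (auto simp: subspace_0 subspace_add subspace_diff subspace_neg subspace_scale)

lemma closed_graph:
  assumes "\<And>n::nat. s n \<in> D" "s \<longlonglongrightarrow> x" "(\<lambda>n. B (s n)) \<longlonglongrightarrow> y"
  shows "x \<in> D" "B x = y"
proof -
  have "x \<in> D \<and> B x = y"
  proof (rule maximal)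
    fix z assume z: "z \<in> D"
    show "x \<bullet> B z = y \<bullet> z"
    proof (rule LIMSEQ_unique)
      show "(\<lambda>n. s n \<bullet> B z) \<longlonglongrightarrow> x \<bullet> B z" by (intro tendsto_intros assms)
      show "(\<lambda>n. s n \<bullet> B z) \<longlonglongrightarrow> y \<bullet> z"
        using tendsto_inner[OF assms(3) tendsto_const[of z]] sym[OF assms(1) z] by simp
    qed
  qed
  then show "x \<in> D" "B x = y" by auto
qed

definition D2 :: "'h set" where "D2 = {x \<in> D. B x \<in> D}"

lemma D2D: "x \<in> D2 \<Longrightarrow> x \<in> D" "x \<in> D2 \<Longrightarrow> B x \<in> D"
  by (auto simp: D2_def)

lemma square_linear: "linear_map_on D2 (\<lambda>x. B (B x))"
  by (auto simp: linear_map_on_def subspace_def D2_def B_simps)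

text \<open>The projection of \<open>(f, 0)\<close> to the closed graph of \<open>B\<close> solves $(B^2+1)x=f$.\<close>

lemma square_plus_one_surj: "\<exists>x\<in>D2. B (B x) + x = f"
proof -
  define S where "S = {(x, B x) | x. x \<in> D}"
  have "subspace S"
    unfolding S_def subspace_def
    by (auto simp: B_simps zero_prod_def intro!: exI[of _ 0] intro: B_simps[symmetric])
  moreover have "closed S"
    unfolding closed_sequential_limits
  proof (intro allI impI, elim conjE)
    fix s l assume s: "\<forall>n. s n \<in> S" and l: "s \<longlonglongrightarrow> l"
    have s': "fst (s n) \<in> D" "snd (s n) = B (fst (s n))" for n
      using s[rule_format, of n] by (auto simp: S_def)
    have l': "(\<lambda>n. fst (s n)) \<longlonglongrightarrow> fst l" "(\<lambda>n. B (fst (s n))) \<longlonglongrightarrow> snd l"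
      using tendsto_fst[OF l] tendsto_snd[OF l] by (simp_all add: s'(2))
    show "l \<in> S" using closed_graph[OF s'(1) l'] by (cases l) (auto simp: S_def)
  qed
  ultimately obtain p where p: "p \<in> S" "\<And>q. q \<in> S \<Longrightarrow> ((f, 0) - p) \<bullet> q = 0"
    using orthogonal_projection_exists[of S "(f, 0)"] by metis
  then obtain x where x: "x \<in> D" "p = (x, B x)" by (auto simp: S_def)
  have "B x \<in> D \<and> B (B x) = f - x"
  proof (rule maximal)
    fix z assume "z \<in> D"
    then have "((f, 0) - p) \<bullet> (z, B z) = 0" by (intro p) (auto simp: S_def)
    then show "B x \<bullet> B z = (f - x) \<bullet> z" by (simp add: x inner_prod_def)
  qed
  then show ?thesis using x by (auto simp: D2_def intro!: bexI[of _ x])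
qed

lemma square_sym: "x \<in> D2 \<Longrightarrow> y \<in> D2 \<Longrightarrow> B (B x) \<bullet> y = x \<bullet> B (B y)"
  using sym[of "B x" y] sym[of x "B y"] by (auto simp: D2_def)

definition P :: "'h \<Rightarrow> 'h" where "P = inv_into D2 (\<lambda>x. B (B x) + x)"

lemma inner_square_plus_one:
  assumes "x \<in> D2" "z \<in> D" shows "(B (B x) + x) \<bullet> z = B x \<bullet> B z + x \<bullet> z"
  using assms sym[of "B x" z] by (simp add: inner_add_left D2_def)

lemma square_plus_one_inj:
  assumes "x \<in> D2" "y \<in> D2" "B (B x) + x = B (B y) + y"
  shows "x = y"
proof -
  define z where "z = x - y"
  have z: "z \<in> D2" using assms linear_map_onD(1)[OF square_linear] by (simp add: z_def subspace_diff)
  have "B (B z) + z = 0"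
    using assms by (simp add: z_def D2_def B_simps algebra_simps)
  then have "B z \<bullet> B z + z \<bullet> z = 0" using inner_square_plus_one[OF z D2D(1)[OF z]] by simp
  then have "z \<bullet> z = 0" by (metis inner_ge_zero add_nonneg_eq_0_iff)
  then show ?thesis by (simp add: z_def)
qed

lemma P_solves: "P f \<in> D2" "B (B (P f)) + P f = f"
proof -
  have "f \<in> (\<lambda>x. B (B x) + x) ` D2" using square_plus_one_surj[of f] by force
  from inv_into_into[OF this] f_inv_into_f[OF this]
  show "P f \<in> D2" "B (B (P f)) + P f = f" unfolding P_def by simp_all
qed

lemma P_eqI: "x \<in> D2 \<Longrightarrow> B (B x) + x = f \<Longrightarrow> P f = x"
  using square_plus_one_inj[of "P f" x] P_solves[of f] by simp

lemma P_energy: "f \<bullet> P g = B (P f) \<bullet> B (P g) + P f \<bullet> P g"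
  using inner_square_plus_one[OF P_solves(1) D2D(1)[OF P_solves(1)], of f g] P_solves(2)[of f] by simp

lemma P_pos_symmetric: "pos_symmetric P"
proof -
  have add: "P (f + g) = P f + P g" for f g
  proof (rule P_eqI)
    show "P f + P g \<in> D2" using linear_map_onD(1)[OF square_linear] P_solves(1) by (simp add: subspace_add)
    show "B (B (P f + P g)) + (P f + P g) = f + g"
      using linear_map_onD(2)[OF square_linear, OF P_solves(1) P_solves(1), of f g] P_solves(2)[of f] P_solves(2)[of g] by (simp add: algebra_simps)
  qed
  have scale: "P (r *\<^sub>R f) = r *\<^sub>R P f" for r f
  proof (rule P_eqI)
    show "r *\<^sub>R P f \<in> D2" using linear_map_onD(1)[OF square_linear] P_solves(1) by (simp add: subspace_scale)
    show "B (B (r *\<^sub>R P f)) + r *\<^sub>R P f = r *\<^sub>R f"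
      using linear_map_onD(3)[OF square_linear, OF P_solves(1), of r f] P_solves(2)[of f] by (metis scaleR_right_distrib)
  qed
  have e: "(norm (P f))\<^sup>2 \<le> f \<bullet> P f" for f
    using P_energy[of f f] by (simp add: power2_norm_eq_inner)
  have "norm (P f) \<le> norm f * 1" for f
  proof (cases "P f = 0")
    case False
    have "norm (P f) * norm (P f) \<le> norm f * norm (P f)"
      using e[of f] norm_cauchy_schwarz[of f "P f"] by (simp add: power2_eq_square)
    then show ?thesis using False by simp
  qed simp
  then have "bounded_linear P" by (intro bounded_linear_intro add scale)
  moreover have "P f \<bullet> g = f \<bullet> P g" for f g
    using P_energy[of f g] P_energy[of g f] by (simp add: inner_commute)
  moreover have "0 \<le> P f \<bullet> f" for f
    using e[of f] by (simp add: inner_commute) (metis order_trans zero_le_power2)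
  ultimately show ?thesis by (simp add: pos_symmetric_def)
qed

text \<open>
  The operator $(B^2+1)^{-1/2}$. It maps the Hilbert space unitarily onto \<open>D\<close> with the graph norm
  of \<open>B\<close> (\<open>S_isometry\<close>, \<open>range_S\<close>), and so it turns questions about that graph norm into questions
  about bounded operators.
\<close>

definition S :: "'h \<Rightarrow> 'h" where
  "S = (SOME Q. pos_symmetric Q \<and> (\<forall>x. Q (Q x) = P x) \<and>
     (\<forall>T. bounded_linear T \<longrightarrow> (\<forall>x. T (P x) = P (T x)) \<longrightarrow> (\<forall>x. T (Q x) = Q (T x))))"

lemma S_root: "pos_symmetric S" "S (S x) = P x"
  "bounded_linear T \<Longrightarrow> (\<And>x. T (P x) = P (T x)) \<Longrightarrow> T (S x) = S (T x)"
proof -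
  have "\<exists>Q. pos_symmetric Q \<and> (\<forall>x. Q (Q x) = P x) \<and>
     (\<forall>T. bounded_linear T \<longrightarrow> (\<forall>x. T (P x) = P (T x)) \<longrightarrow> (\<forall>x. T (Q x) = Q (T x)))"
    using pos_symmetric_sqrt_exists[OF P_pos_symmetric] by metis
  from someI_ex[OF this, folded S_def]
  show "pos_symmetric S" "S (S x) = P x"
    "bounded_linear T \<Longrightarrow> (\<And>x. T (P x) = P (T x)) \<Longrightarrow> T (S x) = S (T x)"
    by blast+
qed

lemma S_linear: "bounded_linear S" and S_sym: "S x \<bullet> y = x \<bullet> S y"
  using S_root(1) unfolding pos_symmetric_def by blast+

lemma S_inj: "S x = 0 \<Longrightarrow> x = 0"
proof -
  assume "S x = 0"
  then have "P x = 0" using S_root(2)[of x] linear_0[OF bounded_linear.linear[OF S_linear]] by simp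
  then show "x = 0" using P_solves(2)[of x] B_simps(3) by simp
qed

text \<open>
  Any square root of \<open>P\<close> commutes with \<open>P\<close>, hence with \<open>S\<close>.
\<close>

lemma S_unique:
  assumes "pos_symmetric Q" "\<And>x. Q (Q x) = P x"
  shows "Q = S"
proof (rule pos_symmetric_sqrt_unique[OF assms(1) S_root(1)])
  have "bounded_linear Q" using assms(1) by (simp add: pos_symmetric_def)
  then show "Q (S x) = S (Q x)" for x using assms(2) by (intro S_root(3)) metis+
  show "Q (Q x) = S (S x)" for x using assms(2) S_root(2) by simp
qed

lemma S_range_dense: "closure (range S) = UNIV"
proof (rule closure_subspace_eq_UNIV)
  show "subspace (range S)"
    by (intro linear_subspace_image bounded_linear.linear[OF S_linear] subspace_UNIV)
  fix z assume "\<And>s. s \<in> range S \<Longrightarrow> z \<bullet> s = 0"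
  then have "S z \<bullet> S z = 0" using S_sym[of z "S z"] by simp
  then show "z = 0" using S_inj by simp
qed

text \<open>
  For \<open>x = S y\<close> the norm identity is the energy identity of \<open>P = S \<circ> S\<close>. Such \<open>x\<close> are dense and
  the graph of \<open>B\<close> is closed.
\<close>

lemma S_in_D: "S x \<in> D" and S_isometry: "(norm (B (S x)))\<^sup>2 + (norm (S x))\<^sup>2 = (norm x)\<^sup>2"
proof -
  interpret bounded_linear S by (rule S_linear)
  have SSD: "S (S y) \<in> D" for y using P_solves(1)[of y] S_root(2) by (simp add: D2_def)
  have iso: "(norm (B (S (S y))))\<^sup>2 + (norm (S (S y)))\<^sup>2 = (norm (S y))\<^sup>2" for y
    using P_energy[of y y] S_sym[of y "S y"] by (simp add: S_root(2) power2_norm_eq_inner)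
  have "x \<in> closure (range S)" using S_range_dense by simp
  then obtain t where t: "\<And>n. t n \<in> range S" "t \<longlonglongrightarrow> x" by (auto simp: closure_sequential)
  then have "\<forall>n. \<exists>y. t n = S y" by blast
  then obtain y where y: "\<And>n. t n = S (y n)" by metis
  have lim: "(\<lambda>n. S (t n)) \<longlonglongrightarrow> S x" by (intro tendsto t)
  have "\<exists>L. (\<lambda>n. B (S (t n))) \<longlonglongrightarrow> L"
  proof (rule convergent_if_dist_le[OF LIMSEQ_imp_Cauchy[OF t(2)], of _ 1])
    fix m n
    have "B (S (t m)) - B (S (t n)) = B (S (S (y m - y n)))"
      using SSD by (simp add: y diff B_simps)
    moreover have "t m - t n = S (y m - y n)" by (simp add: y diff)
    moreover have "(norm (B (S (S (y m - y n)))))\<^sup>2 \<le> (norm (S (y m - y n)))\<^sup>2"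
      using iso[of "y m - y n"] zero_le_power2[of "norm (S (S (y m - y n)))"] by linarith
    ultimately show "dist (B (S (t m))) (B (S (t n))) \<le> 1 * dist (t m) (t n)"
      using power2_le_imp_le by (simp add: dist_norm)
  qed
  then obtain L where L: "(\<lambda>n. B (S (t n))) \<longlonglongrightarrow> L" by blast
  have StD: "S (t n) \<in> D" for n using SSD by (simp add: y)
  show "S x \<in> D" by (rule closed_graph(1)[OF StD lim L])
  have BL: "B (S x) = L" by (rule closed_graph(2)[OF StD lim L])
  show "(norm (B (S x)))\<^sup>2 + (norm (S x))\<^sup>2 = (norm x)\<^sup>2"
  proof (rule LIMSEQ_unique)
    show "(\<lambda>n. (norm (B (S (t n))))\<^sup>2 + (norm (S (t n)))\<^sup>2) \<longlonglongrightarrow> (norm (B (S x)))\<^sup>2 + (norm (S x))\<^sup>2"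
      unfolding BL by (intro tendsto_intros L lim)
    show "(\<lambda>n. (norm (B (S (t n))))\<^sup>2 + (norm (S (t n)))\<^sup>2) \<longlonglongrightarrow> (norm x)\<^sup>2"
      unfolding y iso unfolding y[symmetric] by (intro tendsto_intros t)
  qed
qed

lemma BS_linear: "bounded_linear (\<lambda>x. B (S x))"
proof -
  interpret bounded_linear S by (rule S_linear)
  show ?thesis
  proof (rule bounded_linear_intro[where K = 1])
    show "B (S (x + y)) = B (S x) + B (S y)" for x y by (simp add: add B_simps S_in_D)
    show "B (S (r *\<^sub>R x)) = r *\<^sub>R B (S x)" for r x by (simp add: scale B_simps S_in_D)
    have "(norm (B (S x)))\<^sup>2 \<le> (norm x)\<^sup>2" for x
      using S_isometry[of x] zero_le_power2[of "norm (S x)"] by linarith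
    then show "norm (B (S x)) \<le> norm x * 1" for x using power2_le_imp_le by force
  qed
qed

text \<open>
  The functional \<open>p \<mapsto> \<langle>B z, B S p\<rangle> + \<langle>z, S p\<rangle>\<close> is represented by some \<open>x\<close>; testing with \<open>p = S y\<close>
  shows \<open>S x = z\<close>.
\<close>

lemma range_S: "range S = D"
proof
  show "range S \<subseteq> D" using S_in_D by auto
  show "D \<subseteq> range S"
  proof
    fix z assume z: "z \<in> D"
    have "bounded_linear (\<lambda>p. B z \<bullet> B (S p) + z \<bullet> S p)"
      by (intro bounded_linear_add bounded_linear_compose[OF bounded_linear_inner_right]
          BS_linear S_linear)
    then obtain x where x: "\<And>p. B z \<bullet> B (S p) + z \<bullet> S p = x \<bullet> p"
      by (rule riesz_representation) blast
    have "S x = z"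
    proof (rule vector_eq_rdot[THEN iffD1], rule allI)
      fix y
      have "S x \<bullet> y = B z \<bullet> B (P y) + z \<bullet> P y" using x[of "S y"] by (simp add: S_sym S_root(2))
      also have "\<dots> = (B (B (P y)) + P y) \<bullet> z"
        using inner_square_plus_one[OF P_solves(1) z, of y] by (simp add: inner_commute)
      finally show "S x \<bullet> y = z \<bullet> y" by (simp add: P_solves(2) inner_commute)
    qed
    then show "z \<in> range S" by auto
  qed
qed

lemma orthogonal_to_D2:
  assumes "\<And>x. x \<in> D2 \<Longrightarrow> z \<bullet> x = 0" shows "z = 0"
proof -
  have "S z \<bullet> S z = z \<bullet> P z" by (simp add: S_sym S_root(2))
  then have "S z = 0" using assms[OF P_solves(1)] by simp
  then show ?thesis by (rule S_inj)
qed

text \<open>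
  A symmetric operator \<open>T\<close> for which \<open>T + 1\<close> is onto is self-adjoint.
\<close>

lemma selfadjoint_square: "selfadjoint D2 (\<lambda>x. B (B x))"
proof
  show "linear_map_on D2 (\<lambda>x. B (B x))" by (rule square_linear)
  show "closure D2 = UNIV"
    by (intro closure_subspace_eq_UNIV linear_map_onD(1)[OF square_linear] orthogonal_to_D2)
  show "B (B x) \<bullet> y = x \<bullet> B (B y)" if "x \<in> D2" "y \<in> D2" for x y by (rule square_sym[OF that])
  fix x y assume xy: "\<And>z. z \<in> D2 \<Longrightarrow> x \<bullet> B (B z) = y \<bullet> z"
  have "x - P (y + x) = 0"
  proof -
    have "(x - P (y + x)) \<bullet> (B (B z) + z) = 0" if z: "z \<in> D2" for z
    proof -
      have "P (y + x) \<bullet> (B (B z) + z) = (y + x) \<bullet> z"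
        using square_sym[OF P_solves(1) z, of "y + x"] P_solves(2)[of "y + x"]
        by (metis inner_add_left inner_add_right)
      then show ?thesis using xy[OF z] by (simp add: inner_diff_left inner_add_left inner_add_right)
    qed
    from this[OF P_solves(1)] have "(x - P (y + x)) \<bullet> f = 0" for f by (simp add: P_solves(2))
    from this[of "x - P (y + x)"] show ?thesis by simp
  qed
  then show "x \<in> D2 \<and> B (B x) = y" using P_solves[of "y + x"] by simp
qed

end

locale injective_selfadjoint = selfadjoint +
  assumes inj: "\<And>x. x \<in> D \<Longrightarrow> B x = 0 \<Longrightarrow> x = 0"
begin

lemma B_inj_on: "inj_on B D"
proof (rule inj_onI)
  fix x y assume "x \<in> D" "y \<in> D" "B x = B y"
  then have "x - y = 0" using inj[of "x - y"] by (simp add: B_simps)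
  then show "x = y" by simp
qed

text \<open>
  If \<open>z = (B\<^sup>2 + 1) p\<close> is orthogonal to all \<open>B x\<close>, then \<open>B p\<close> is orthogonal to the range of
  \<open>B\<^sup>2 + 1\<close>.
\<close>

lemma orthogonal_to_B_D2:
  assumes z: "\<And>x. x \<in> D2 \<Longrightarrow> z \<bullet> B x = 0" shows "z = 0"
proof -
  define p where "p = P z"
  have p: "p \<in> D2" "B (B p) + p = z" using P_solves[of z] by (auto simp: p_def)
  have "B p \<bullet> (B (B x) + x) = 0" if x: "x \<in> D2" for x
  proof -
    have "z \<bullet> B x = B (B p) \<bullet> B x + p \<bullet> B x" by (simp add: inner_add_left flip: p(2))
    also have "\<dots> = B p \<bullet> B (B x) + B p \<bullet> x"
      using sym[of "B p" "B x"] sym[of p x] p(1) x by (simp add: D2_def)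
    finally show ?thesis using z[OF x] by (simp add: inner_add_right)
  qed
  from this[OF P_solves(1), of "B p"] have "B p = 0" by (simp add: P_solves(2))
  then have "p = 0" using inj p(1) by (auto simp: D2_def)
  then show ?thesis using p(2) B_simps(3) by simp
qed

lemma range_B_dense: "closure (B ` D) = UNIV"
proof (rule closure_subspace_eq_UNIV)
  show "subspace (B ` D)"
    by (rule subspace_linear_map_on_image[OF lin])
  fix z assume "\<And>s. s \<in> B ` D \<Longrightarrow> z \<bullet> s = 0"
  then show "z = 0" by (intro orthogonal_to_B_D2) (auto simp: D2_def)
qed

end

section \<open>The damped wave operator after transport to the base space\<close>

text \<open>
  The abstract setting in one Hilbert space. The damping operator is \<open>K B\<close> with \<open>K\<close> bounded, skew
  and commuting with \<open>B\<close>; the trace \<open>t\<close> is a vector-valued functional on \<open>D\<close> that is continuous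
  for the graph norm of \<open>B\<close>.
\<close>

locale wave_pencil = injective_selfadjoint D B
  for D :: "'h::{real_inner, complete_space} set" and B +
  fixes K :: "'h \<Rightarrow> 'h" and t :: "'h \<Rightarrow> 'a::{real_inner, complete_space}"
  assumes K_linear: "bounded_linear K"
    and K_skew: "K x \<bullet> y = - (x \<bullet> K y)"
    and K_D: "x \<in> D \<Longrightarrow> K x \<in> D" and BK: "x \<in> D \<Longrightarrow> B (K x) = K (B x)"
    and t_lin: "linear_map_on D t"
    and t_bound: "\<exists>c. \<forall>y\<in>D. norm (t y) \<le> c * (norm (B y) + norm y)"
begin

lemmas t_simps = linear_map_onD(2-)[OF t_lin]
lemmas K_simps = linear_simps[OF K_linear] linear_0[OF bounded_linear.linear[OF K_linear]]

lemma B_K_inner_self: "x \<in> D \<Longrightarrow> B x \<bullet> K x = 0"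
proof -
  assume x: "x \<in> D"
  have "B x \<bullet> K x = x \<bullet> K (B x)" using sym[OF x K_D[OF x]] BK[OF x] by simp
  also have "\<dots> = - (B x \<bullet> K x)" using K_skew[of x "B x"] by (simp add: inner_commute)
  finally show ?thesis by simp
qed

text \<open>
  The form of $B^2-\mu KB+\mu^2$. Its middle term vanishes on the diagonal because \<open>K\<close> is skew and
  commutes with \<open>B\<close>, so the form is coercive for the graph norm of \<open>B\<close>.
\<close>

definition wform :: "real \<Rightarrow> 'h \<Rightarrow> 'h \<Rightarrow> real" where
  "wform \<mu> x y = B x \<bullet> B y + \<mu> * (B x \<bullet> K y) + \<mu>\<^sup>2 * (x \<bullet> y)"

lemma wform_self: "x \<in> D \<Longrightarrow> wform \<mu> x x = (norm (B x))\<^sup>2 + \<mu>\<^sup>2 * (norm x)\<^sup>2"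
  by (simp add: wform_def B_K_inner_self power2_norm_eq_inner)

lemma wform_eq_0:
  assumes "\<mu> \<noteq> 0" "x \<in> D" "wform \<mu> x x = 0" shows "x = 0"
proof -
  have "(norm (B x))\<^sup>2 + \<mu>\<^sup>2 * (norm x)\<^sup>2 = 0" using wform_self assms by simp
  then have "\<mu>\<^sup>2 * (norm x)\<^sup>2 = 0" by (simp add: add_nonneg_eq_0_iff)
  then show ?thesis using assms(1) by simp
qed

lemma wform_linear_left:
  "x \<in> D \<Longrightarrow> x' \<in> D \<Longrightarrow> wform \<mu> (x + x') y = wform \<mu> x y + wform \<mu> x' y"
  "x \<in> D \<Longrightarrow> wform \<mu> (r *\<^sub>R x) y = r * wform \<mu> x y"
  "x \<in> D \<Longrightarrow> x' \<in> D \<Longrightarrow> wform \<mu> (x - x') y = wform \<mu> x y - wform \<mu> x' y"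
  by (simp_all add: wform_def B_simps inner_add_left inner_diff_left algebra_simps)

text \<open>
  Lax-Milgram on \<open>D\<close> with its graph norm, parametrized by the unitary map \<open>S\<close>.
\<close>

lemma wform_solvable:
  assumes mu: "\<mu> \<noteq> 0" and f: "linear_map_on D f"
    and bound: "\<And>y. y \<in> D \<Longrightarrow> \<bar>f y\<bar> \<le> c * (norm (B y) + norm y)"
  obtains x where "x \<in> D" "\<And>y. y \<in> D \<Longrightarrow> wform \<mu> x y = f y"
proof -
  define m where "m = min 1 (\<mu>\<^sup>2)"
  have m: "m > 0" "m \<le> 1" "m \<le> \<mu>\<^sup>2" using mu by (auto simp: m_def)
  interpret S: bounded_linear S by (rule S_linear)
  have eq: "(\<lambda>p q. wform \<mu> (S p) (S q)) = (\<lambda>p q. (B (S p), \<mu> *\<^sub>R B (S p), \<mu>\<^sup>2 *\<^sub>R S p) \<bullet> (B (S q), K (S q), S q))"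
    by (intro ext) (simp add: wform_def inner_prod_def)
  have bil: "bounded_bilinear (\<lambda>p q. wform \<mu> (S p) (S q))"
    unfolding eq
    by (intro bounded_bilinear.comp[OF bounded_bilinear_inner] bounded_linear_Pair BS_linear S_linear
        bounded_linear_const_scaleR bounded_linear_compose[OF K_linear])
  have coer: "m * (norm p)\<^sup>2 \<le> wform \<mu> (S p) (S p)" for p
  proof -
    have "m * (norm p)\<^sup>2 = m * (norm (B (S p)))\<^sup>2 + m * (norm (S p))\<^sup>2"
      by (simp add: distrib_left flip: S_isometry[of p])
    also have "\<dots> \<le> 1 * (norm (B (S p)))\<^sup>2 + \<mu>\<^sup>2 * (norm (S p))\<^sup>2"
      by (intro add_mono mult_right_mono m) auto
    finally show ?thesis by (simp add: wform_self S_in_D)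
  qed
  have le1: "norm (B (S p)) \<le> norm p" "norm (S p) \<le> norm p" for p
  proof -
    have "(norm (B (S p)))\<^sup>2 \<le> (norm p)\<^sup>2" "(norm (S p))\<^sup>2 \<le> (norm p)\<^sup>2"
      using S_isometry[of p] zero_le_power2[of "norm (S p)"] zero_le_power2[of "norm (B (S p))"]
      by linarith+
    then show "norm (B (S p)) \<le> norm p" "norm (S p) \<le> norm p"
      using power2_le_imp_le norm_ge_zero by blast+
  qed
  have fl: "bounded_linear (\<lambda>p. f (S p))"
  proof (rule bounded_linear_intro)
    show "f (S (p + q)) = f (S p) + f (S q)" for p q
      using linear_map_onD(2)[OF f S_in_D S_in_D] by (simp add: S.add)
    show "f (S (r *\<^sub>R p)) = r *\<^sub>R f (S p)" for r p
      using linear_map_onD(3)[OF f S_in_D] by (simp add: S.scale)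
    show "norm (f (S p)) \<le> norm p * (2 * \<bar>c\<bar>)" for p
    proof -
      have "norm (f (S p)) \<le> c * (norm (B (S p)) + norm (S p))" using bound[OF S_in_D] by simp
      also have "\<dots> \<le> \<bar>c\<bar> * (norm (B (S p)) + norm (S p))" by (intro mult_right_mono) auto
      also have "\<dots> \<le> \<bar>c\<bar> * (norm p + norm p)" by (intro mult_left_mono add_mono le1) auto
      finally show ?thesis by (simp add: algebra_simps)
    qed
  qed
  obtain p where p: "\<And>q. wform \<mu> (S p) (S q) = f (S q)"
    by (rule lax_milgram[OF bil m(1) coer fl]) blast
  have "wform \<mu> (S p) y = f y" if "y \<in> D" for y
    using p that range_S by (metis imageE)
  then show ?thesis using that[of "S p"] S_in_D by blast
qed

lemma wform_unique:
  assumes "\<mu> \<noteq> 0" "x \<in> D" "x' \<in> D" "\<And>y. y \<in> D \<Longrightarrow> wform \<mu> x y = wform \<mu> x' y"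
  shows "x = x'"
proof -
  have "wform \<mu> (x - x') (x - x') = 0"
    using assms(4)[of "x - x'"] assms(2,3) by (simp add: wform_linear_left)
  then have "x - x' = 0" by (rule wform_eq_0[OF assms(1), rotated]) (use assms in simp)
  then show ?thesis by simp
qed

subsection \<open>The quadratic operator pencil and the potentials\<close>

definition R :: "real \<Rightarrow> 'h \<Rightarrow> 'h" where
  "R \<mu> = inv_into D2 (\<lambda>x. B (B x) - \<mu> *\<^sub>R K (B x) + \<mu>\<^sup>2 *\<^sub>R x)"

lemma wform_D2:
  assumes "x \<in> D2" "y \<in> D"
  shows "wform \<mu> x y = (B (B x) - \<mu> *\<^sub>R K (B x) + \<mu>\<^sup>2 *\<^sub>R x) \<bullet> y"
  using assms sym[of "B x" y] K_skew[of "B x" y]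
  by (simp add: wform_def D2_def inner_add_left inner_diff_left)

lemma pencil_inj:
  assumes "\<mu> \<noteq> 0" "x \<in> D2" "x' \<in> D2"
    "B (B x) - \<mu> *\<^sub>R K (B x) + \<mu>\<^sup>2 *\<^sub>R x = B (B x') - \<mu> *\<^sub>R K (B x') + \<mu>\<^sup>2 *\<^sub>R x'"
  shows "x = x'"
  using assms D2D by (intro wform_unique[OF assms(1)]) (auto simp: wform_D2)

text \<open>
  The variational solution \<open>x\<close> has \<open>B x\<close> in the domain of the adjoint of \<open>B\<close>, which is \<open>D\<close>.
\<close>

lemma R_solves:
  assumes mu: "\<mu> \<noteq> 0"
  shows "R \<mu> f \<in> D2" "B (B (R \<mu> f)) - \<mu> *\<^sub>R K (B (R \<mu> f)) + \<mu>\<^sup>2 *\<^sub>R R \<mu> f = f"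
proof -
  have "linear_map_on D (\<lambda>y. f \<bullet> y)" using sub by (simp add: linear_map_on_def inner_add_right)
  moreover have "\<bar>f \<bullet> y\<bar> \<le> norm f * (norm (B y) + norm y)" for y
    by (rule order_trans[OF Cauchy_Schwarz_ineq2[of f y]]) (intro mult_left_mono, auto)
  ultimately obtain x where x: "x \<in> D" "\<And>y. y \<in> D \<Longrightarrow> wform \<mu> x y = f \<bullet> y"
    using wform_solvable[OF mu] by metis
  have "B x \<in> D \<and> B (B x) = f + \<mu> *\<^sub>R K (B x) - \<mu>\<^sup>2 *\<^sub>R x"
  proof (rule maximal)
    fix z assume "z \<in> D"
    then show "B x \<bullet> B z = (f + \<mu> *\<^sub>R K (B x) - \<mu>\<^sup>2 *\<^sub>R x) \<bullet> z"
      using x(2)[of z] K_skew[of "B x" z] by (simp add: wform_def inner_add_left inner_diff_left)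
  qed
  then have "f \<in> (\<lambda>x. B (B x) - \<mu> *\<^sub>R K (B x) + \<mu>\<^sup>2 *\<^sub>R x) ` D2"
    using x(1) by (intro image_eqI[of _ _ x]) (auto simp: D2_def)
  from inv_into_into[OF this] f_inv_into_f[OF this]
  show "R \<mu> f \<in> D2" "B (B (R \<mu> f)) - \<mu> *\<^sub>R K (B (R \<mu> f)) + \<mu>\<^sup>2 *\<^sub>R R \<mu> f = f"
    unfolding R_def by simp_all
qed

lemma R_D: "\<mu> \<noteq> 0 \<Longrightarrow> R \<mu> f \<in> D" "\<mu> \<noteq> 0 \<Longrightarrow> B (R \<mu> f) \<in> D"
  using R_solves(1) by (auto simp: D2_def)

lemma R_eqI:
  assumes "\<mu> \<noteq> 0" "x \<in> D2" "B (B x) - \<mu> *\<^sub>R K (B x) + \<mu>\<^sup>2 *\<^sub>R x = f"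
  shows "R \<mu> f = x"
  by (rule pencil_inj[OF assms(1) R_solves(1)[OF assms(1)] assms(2)]) (simp only: R_solves(2)[OF assms(1)] assms(3))

lemma BBR: "\<mu> \<noteq> 0 \<Longrightarrow> B (B (R \<mu> f)) = f + \<mu> *\<^sub>R K (B (R \<mu> f)) - \<mu>\<^sup>2 *\<^sub>R R \<mu> f"
  using R_solves(2)[of \<mu> f] by (simp add: algebra_simps)

lemma R_linear:
  assumes mu: "\<mu> \<noteq> 0"
  shows "R \<mu> (f + g) = R \<mu> f + R \<mu> g" "R \<mu> (r *\<^sub>R f) = r *\<^sub>R R \<mu> f"
    "R \<mu> (f - g) = R \<mu> f - R \<mu> g"
proof -
  note s = linear_map_onD(1)[OF square_linear]
  note m = R_solves(1)[OF mu] and d = R_D[OF mu]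
  show "R \<mu> (f + g) = R \<mu> f + R \<mu> g"
    by (rule R_eqI[OF mu]) (use m d in \<open>simp_all add: subspace_add[OF s] B_simps K_simps BBR[OF mu] algebra_simps\<close>)
  show "R \<mu> (r *\<^sub>R f) = r *\<^sub>R R \<mu> f"
    by (rule R_eqI[OF mu]) (use m d in \<open>simp_all add: subspace_scale[OF s] B_simps K_simps BBR[OF mu] algebra_simps\<close>)
  show "R \<mu> (f - g) = R \<mu> f - R \<mu> g"
    by (rule R_eqI[OF mu]) (use m d in \<open>simp_all add: subspace_diff[OF s] B_simps K_simps BBR[OF mu] algebra_simps\<close>)
qed

lemma R_B:
  assumes mu: "\<mu> \<noteq> 0" and x: "x \<in> D"
  shows "R \<mu> (B x) = B (R \<mu> x)"
proof (rule R_eqI[OF mu])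
  note d = R_D[OF mu, of x]
  have "B (B (R \<mu> x)) \<in> D" unfolding BBR[OF mu] using d x K_D by simp
  then show "B (R \<mu> x) \<in> D2" using d by (simp add: D2_def)
  show "B (B (B (R \<mu> x))) - \<mu> *\<^sub>R K (B (B (R \<mu> x))) + \<mu>\<^sup>2 *\<^sub>R B (R \<mu> x) = B x"
    by (subst BBR[OF mu]) (use d x K_D in \<open>simp add: B_simps BK\<close>)
qed

lemma R_K:
  assumes mu: "\<mu> \<noteq> 0"
  shows "R \<mu> (K x) = K (R \<mu> x)"
proof (rule R_eqI[OF mu])
  note d = R_D[OF mu, of x]
  show "K (R \<mu> x) \<in> D2" using d K_D by (simp add: D2_def BK)
  show "B (B (K (R \<mu> x))) - \<mu> *\<^sub>R K (B (K (R \<mu> x))) + \<mu>\<^sup>2 *\<^sub>R K (R \<mu> x) = K x"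
    using d K_D by (simp add: BK BBR[OF mu] K_simps)
qed

lemma R_bounds:
  assumes mu: "\<mu> \<noteq> 0"
  obtains c where "c > 0"
    "\<And>f. norm (B (B (R \<mu> f))) \<le> c * norm f" "\<And>f. norm (B (R \<mu> f)) \<le> c * norm f"
    "\<And>f. norm (R \<mu> f) \<le> c * norm f"
proof -
  obtain k where k: "k > 0" "\<And>x. norm (K x) \<le> norm x * k"
    using bounded_linear.pos_bounded[OF K_linear] by blast
  have e: "(norm (B (R \<mu> f)))\<^sup>2 + \<mu>\<^sup>2 * (norm (R \<mu> f))\<^sup>2 \<le> norm f * norm (R \<mu> f)" for f
    using wform_self[OF R_D(1)[OF mu], of \<mu> f] wform_D2[OF R_solves(1)[OF mu] R_D(1)[OF mu], of \<mu> f f]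
      R_solves(2)[OF mu, of f] norm_cauchy_schwarz[of f "R \<mu> f"] by simp
  have b0: "\<mu>\<^sup>2 * norm (R \<mu> f) \<le> norm f" for f
  proof (cases "R \<mu> f = 0")
    case False
    have "\<mu>\<^sup>2 * (norm (R \<mu> f))\<^sup>2 \<le> norm f * norm (R \<mu> f)"
      using e[of f] zero_le_power2[of "norm (B (R \<mu> f))"] by linarith
    then have "\<mu>\<^sup>2 * norm (R \<mu> f) * norm (R \<mu> f) \<le> norm f * norm (R \<mu> f)"
      by (simp add: power2_eq_square[of "norm (R \<mu> f)"] mult.assoc)
    then show ?thesis using False by simp
  qed simp
  then have b1: "norm (R \<mu> f) \<le> 1 / \<mu>\<^sup>2 * norm f" for f using mu by (simp add: field_simps)
  have b2: "norm (B (R \<mu> f)) \<le> 1 / \<bar>\<mu>\<bar> * norm f" for f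
  proof -
    have "(norm (B (R \<mu> f)))\<^sup>2 \<le> norm f * norm (R \<mu> f)"
    proof -
      have "0 \<le> \<mu>\<^sup>2 * (norm (R \<mu> f))\<^sup>2" by simp
      then show ?thesis using e[of f] by linarith
    qed
    also have "\<dots> \<le> norm f * (1 / \<mu>\<^sup>2 * norm f)" by (intro mult_left_mono b1) simp
    also have "\<dots> = (1 / \<bar>\<mu>\<bar> * norm f)\<^sup>2" by (simp add: power2_eq_square)
    finally show ?thesis by (rule power2_le_imp_le) simp
  qed
  have b3: "norm (B (B (R \<mu> f))) \<le> (2 + k) * norm f" for f
  proof -
    have "norm (B (B (R \<mu> f))) \<le> norm f + norm (\<mu> *\<^sub>R K (B (R \<mu> f))) + norm (\<mu>\<^sup>2 *\<^sub>R R \<mu> f)"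
      unfolding BBR[OF mu]
      by (rule order_trans[OF norm_triangle_ineq4]) (intro add_right_mono norm_triangle_ineq)
    also have "norm (\<mu> *\<^sub>R K (B (R \<mu> f))) \<le> \<bar>\<mu>\<bar> * ((1 / \<bar>\<mu>\<bar> * norm f) * k)"
      unfolding norm_scaleR
      by (intro mult_left_mono order_trans[OF k(2)] mult_right_mono b2) (use k in auto)
    also have "\<bar>\<mu>\<bar> * ((1 / \<bar>\<mu>\<bar> * norm f) * k) = k * norm f" using mu by simp
    also have "norm (\<mu>\<^sup>2 *\<^sub>R R \<mu> f) \<le> norm f" using b0[of f] by simp
    finally show ?thesis by (simp add: algebra_simps)
  qed
  define c where "c = (2 + k) + 1 / \<bar>\<mu>\<bar> + 1 / \<mu>\<^sup>2"
  have c: "2 + k \<le> c" "1 / \<bar>\<mu>\<bar> \<le> c" "1 / \<mu>\<^sup>2 \<le> c" "c > 0"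
    using k(1) by (auto simp: c_def add_nonneg_nonneg add_pos_nonneg)
  have up: "x \<le> c * norm f" if "x \<le> b * norm f" "b \<le> c" for x b and f :: 'h
    using that mult_right_mono[OF that(2) norm_ge_zero[of f]] by linarith
  show ?thesis
    by (rule that[OF c(4) up[OF b3 c(1)] up[OF b2 c(2)] up[OF b1 c(3)]])
qed

text \<open>
  The potential of the charge \<open>\<zeta>\<close>: the solution of the variational equation whose right-hand side
  is the trace functional \<open>y \<mapsto> \<langle>\<zeta>, t y\<rangle>\<close>. Its image \<open>B (pot \<mu> \<zeta>)\<close> is $G(\mu)\zeta$. Starting from
  \<open>pot\<close> instead of $G$ makes it evident that $G(\mu)\zeta$ lies in the range of \<open>B\<close>.
\<close>

definition pot :: "real \<Rightarrow> 'a \<Rightarrow> 'h" where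
  "pot \<mu> \<zeta> = (THE x. x \<in> D \<and> (\<forall>y\<in>D. wform \<mu> x y = \<zeta> \<bullet> t y))"

lemma pot_solves:
  assumes mu: "\<mu> \<noteq> 0"
  shows "pot \<mu> \<zeta> \<in> D" "\<And>y. y \<in> D \<Longrightarrow> wform \<mu> (pot \<mu> \<zeta>) y = \<zeta> \<bullet> t y"
proof -
  obtain c where c: "\<And>y. y \<in> D \<Longrightarrow> norm (t y) \<le> c * (norm (B y) + norm y)" using t_bound by blast
  have "linear_map_on D (\<lambda>y. \<zeta> \<bullet> t y)"
    using sub by (simp add: linear_map_on_def inner_add_right t_simps)
  moreover have "\<bar>\<zeta> \<bullet> t y\<bar> \<le> norm \<zeta> * c * (norm (B y) + norm y)" if "y \<in> D" for y
    using Cauchy_Schwarz_ineq2[of \<zeta> "t y"] mult_left_mono[OF c[OF that] norm_ge_zero[of \<zeta>]] by simp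
  ultimately obtain x where x: "x \<in> D" "\<And>y. y \<in> D \<Longrightarrow> wform \<mu> x y = \<zeta> \<bullet> t y"
    using wform_solvable[OF mu] by metis
  have "pot \<mu> \<zeta> \<in> D \<and> (\<forall>y\<in>D. wform \<mu> (pot \<mu> \<zeta>) y = \<zeta> \<bullet> t y)"
    unfolding pot_def
  proof (rule theI)
    show "x \<in> D \<and> (\<forall>y\<in>D. wform \<mu> x y = \<zeta> \<bullet> t y)" using x by blast
    fix x' assume "x' \<in> D \<and> (\<forall>y\<in>D. wform \<mu> x' y = \<zeta> \<bullet> t y)"
    then show "x' = x" using x by (intro wform_unique[OF mu]) auto
  qed
  then show "pot \<mu> \<zeta> \<in> D" "\<And>y. y \<in> D \<Longrightarrow> wform \<mu> (pot \<mu> \<zeta>) y = \<zeta> \<bullet> t y" by auto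
qed

lemma pot_eqI:
  assumes "\<mu> \<noteq> 0" "x \<in> D" "\<And>y. y \<in> D \<Longrightarrow> wform \<mu> x y = \<zeta> \<bullet> t y"
  shows "pot \<mu> \<zeta> = x"
  using pot_solves[OF assms(1)] assms by (intro wform_unique[OF assms(1)]) auto

lemma pot_linear:
  assumes mu: "\<mu> \<noteq> 0"
  shows "bounded_linear (pot \<mu>)" "bounded_linear (\<lambda>\<zeta>. B (pot \<mu> \<zeta>))"
proof -
  note d = pot_solves(1)[OF mu]
  have add: "pot \<mu> (x + y) = pot \<mu> x + pot \<mu> y" for x y
    by (rule pot_eqI[OF mu]) (use d in \<open>simp_all add: wform_linear_left pot_solves(2)[OF mu] inner_add_left\<close>)
  have scale: "pot \<mu> (r *\<^sub>R x) = r *\<^sub>R pot \<mu> x" for r x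
    by (rule pot_eqI[OF mu]) (use d in \<open>simp_all add: wform_linear_left pot_solves(2)[OF mu]\<close>)
  obtain c where c: "\<And>y. y \<in> D \<Longrightarrow> norm (t y) \<le> c * (norm (B y) + norm y)" using t_bound by blast
  define m where "m = min 1 (\<mu>\<^sup>2)"
  have m: "m > 0" "m \<le> 1" "m \<le> \<mu>\<^sup>2" using mu by (auto simp: m_def)
  have sum: "norm (B (pot \<mu> \<zeta>)) + norm (pot \<mu> \<zeta>) \<le> 2 * \<bar>c\<bar> / m * norm \<zeta>" (is "?s \<le> _") for \<zeta>
  proof (cases "?s = 0")
    case True
    then show ?thesis using m by simp
  next
    case False
    then have s: "?s > 0" by (simp add: add_nonneg_nonneg order_less_le)
    have "?s\<^sup>2 \<le> 2 * ((norm (B (pot \<mu> \<zeta>)))\<^sup>2 + (norm (pot \<mu> \<zeta>))\<^sup>2)"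
      using sum_squares_bound[of "norm (B (pot \<mu> \<zeta>))" "norm (pot \<mu> \<zeta>)"] by (simp add: power2_sum)
    then have "m * ?s\<^sup>2 \<le> 2 * (m * (norm (B (pot \<mu> \<zeta>)))\<^sup>2 + m * (norm (pot \<mu> \<zeta>))\<^sup>2)"
      using mult_left_mono[of _ _ m] m by (fastforce simp: algebra_simps)
    also have "\<dots> \<le> 2 * (1 * (norm (B (pot \<mu> \<zeta>)))\<^sup>2 + \<mu>\<^sup>2 * (norm (pot \<mu> \<zeta>))\<^sup>2)"
      by (intro mult_left_mono add_mono mult_right_mono m) auto
    also have "\<dots> = 2 * (\<zeta> \<bullet> t (pot \<mu> \<zeta>))"
      using wform_self[OF d[of \<zeta>], of \<mu>] pot_solves(2)[OF mu d[of \<zeta>], of \<zeta>] by simp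
    also have "\<dots> \<le> 2 * (norm \<zeta> * norm (t (pot \<mu> \<zeta>)))" using norm_cauchy_schwarz[of \<zeta>] by simp
    also have "\<dots> \<le> 2 * (norm \<zeta> * (\<bar>c\<bar> * ?s))"
    proof -
      have "norm (t (pot \<mu> \<zeta>)) \<le> c * ?s" using c[OF d] .
      also have "\<dots> \<le> \<bar>c\<bar> * ?s" by (intro mult_right_mono) auto
      finally show ?thesis by (intro mult_left_mono) auto
    qed
    finally have "m * ?s * ?s \<le> 2 * \<bar>c\<bar> * norm \<zeta> * ?s" by (simp add: power2_eq_square algebra_simps)
    then have "m * ?s \<le> 2 * \<bar>c\<bar> * norm \<zeta>" using s mult_right_le_imp_le by blast
    then show ?thesis using m by (simp add: field_simps)
  qed
  show "bounded_linear (pot \<mu>)"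
  proof (rule bounded_linear_intro[OF add scale])
    show "norm (pot \<mu> \<zeta>) \<le> norm \<zeta> * (2 * \<bar>c\<bar> / m)" for \<zeta>
      using order_trans[OF _ sum[of \<zeta>], of "norm (pot \<mu> \<zeta>)"] by (simp add: mult.commute)
  qed
  show "bounded_linear (\<lambda>\<zeta>. B (pot \<mu> \<zeta>))"
  proof (rule bounded_linear_intro)
    show "norm (B (pot \<mu> \<zeta>)) \<le> norm \<zeta> * (2 * \<bar>c\<bar> / m)" for \<zeta>
      using order_trans[OF _ sum[of \<zeta>], of "norm (B (pot \<mu> \<zeta>))"] by (simp add: mult.commute)
  qed (use d in \<open>simp_all add: add scale B_simps\<close>)
qed

text \<open>
  A bounded map into \<open>D\<close> with its graph norm may be followed by the trace.
\<close>

lemma t_comp_linear: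
  fixes f :: "'c::real_normed_vector \<Rightarrow> 'h"
  assumes f: "bounded_linear f" and Bf: "bounded_linear (\<lambda>x. B (f x))" and fD: "\<And>x. f x \<in> D"
  shows "bounded_linear (\<lambda>x. t (f x))"
proof -
  obtain c where c: "\<And>y. y \<in> D \<Longrightarrow> norm (t y) \<le> c * (norm (B y) + norm y)" using t_bound by blast
  obtain k where k: "\<And>x. norm (f x) \<le> norm x * k" using bounded_linear.bounded[OF f] by blast
  obtain k' where k': "\<And>x. norm (B (f x)) \<le> norm x * k'" using bounded_linear.bounded[OF Bf] by blast
  show ?thesis
  proof (rule bounded_linear_intro)
    show "t (f (x + y)) = t (f x) + t (f y)" "t (f (r *\<^sub>R x)) = r *\<^sub>R t (f x)" for x y r
      by (simp_all add: linear_simps[OF f] t_simps fD)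
    show "norm (t (f x)) \<le> norm x * (\<bar>c\<bar> * (k' + k))" for x
    proof -
      have "norm (t (f x)) \<le> c * (norm (B (f x)) + norm (f x))" by (rule c[OF fD])
      also have "\<dots> \<le> \<bar>c\<bar> * (norm (B (f x)) + norm (f x))" by (intro mult_right_mono) auto
      also have "\<dots> \<le> \<bar>c\<bar> * (norm x * k' + norm x * k)" by (intro mult_left_mono add_mono k k') auto
      finally show ?thesis by (simp add: algebra_simps)
    qed
  qed
qed

end

text \<open>
  The boundary data. The assumption \<open>transversal\<close> says that no nonzero component of the trace is
  continuous for the norm of the base space, \<open>t_Theta_surj\<close> and \<open>potentials_regular\<close> are the
  surjectivity of \<open>(y, a) \<mapsto> t y - \<Theta> a\<close> and the existence of the regularized trace on potentials.
\<close>

locale wave_core = wave_pencil D B K t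
  for D :: "'h::{real_inner, complete_space} set" and B K
    and t :: "'h \<Rightarrow> 'a::{real_inner, complete_space}" +
  fixes \<Theta> :: "'a \<Rightarrow> 'a" and J :: "real \<Rightarrow> 'h \<Rightarrow> 'h"
  assumes Theta: "pos_symmetric \<Theta>" and Theta_inj: "\<Theta> a = 0 \<Longrightarrow> a = 0"
    and J_linear: "\<nu> > 0 \<Longrightarrow> bounded_linear (J \<nu>)"
    and J_D: "\<nu> > 0 \<Longrightarrow> J \<nu> x \<in> D"
    and BJ_linear: "\<nu> > 0 \<Longrightarrow> bounded_linear (\<lambda>x. B (J \<nu> x))"
    and J_sym: "\<nu> > 0 \<Longrightarrow> J \<nu> x \<bullet> y = x \<bullet> J \<nu> y"
    and JB: "\<nu> > 0 \<Longrightarrow> x \<in> D \<Longrightarrow> J \<nu> (B x) = B (J \<nu> x)"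
    and JK: "\<nu> > 0 \<Longrightarrow> J \<nu> (K x) = K (J \<nu> x)"
    and J_lim: "((\<lambda>\<nu>. J \<nu> x) \<longlongrightarrow> x) (at_right 0)"
    and transversal: "(\<And>x. x \<in> D2 \<Longrightarrow> u \<bullet> B x = \<xi> \<bullet> t (B x)) \<Longrightarrow> \<xi> = 0"
    and t_Theta_surj: "\<exists>y\<in>D. \<exists>a. h = t y - \<Theta> a"
    and potentials_regular:
      "\<mu> \<noteq> 0 \<Longrightarrow> \<exists>L. ((\<lambda>\<nu>. t (J \<nu> (- K (B (pot \<mu> \<zeta>))))) \<longlongrightarrow> L) (at_right 0)"
begin

lemmas Theta_linear = Theta[unfolded pos_symmetric_def, THEN conjunct1]
lemmas Theta_simps = linear_simps[OF Theta_linear] linear_0[OF bounded_linear.linear[OF Theta_linear]]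

lemma Theta_pos: "0 \<le> \<Theta> a \<bullet> a" and Theta_sym: "\<Theta> a \<bullet> b = a \<bullet> \<Theta> b"
  using Theta unfolding pos_symmetric_def by blast+

subsection \<open>The regularized trace\<close>

definition dom_reg_trace :: "'h set" where
  "dom_reg_trace = {y. \<exists>L. ((\<lambda>\<nu>. t (J \<nu> y)) \<longlongrightarrow> L) (at_right 0)}"

definition reg_trace :: "'h \<Rightarrow> 'a" where
  "reg_trace y = Lim (at_right 0) (\<lambda>\<nu>. t (J \<nu> y))"

lemma reg_trace_eqI: "((\<lambda>\<nu>. t (J \<nu> y)) \<longlongrightarrow> L) (at_right 0) \<Longrightarrow> reg_trace y = L"
  unfolding reg_trace_def by (intro tendsto_Lim trivial_limit_at_right_real)

lemma dom_reg_traceI: "((\<lambda>\<nu>. t (J \<nu> y)) \<longlongrightarrow> L) (at_right 0) \<Longrightarrow> y \<in> dom_reg_trace"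
  unfolding dom_reg_trace_def by blast

lemma reg_trace: "y \<in> dom_reg_trace \<Longrightarrow> ((\<lambda>\<nu>. t (J \<nu> y)) \<longlongrightarrow> reg_trace y) (at_right 0)"
  using reg_trace_eqI unfolding dom_reg_trace_def by blast

lemma eventually_pos: "eventually (\<lambda>\<nu>::real. \<nu> > 0) (at_right 0)"
  by (rule eventually_at_right_less)

lemma reg_trace_add:
  assumes "x \<in> dom_reg_trace" "y \<in> dom_reg_trace" shows "x + y \<in> dom_reg_trace" "reg_trace (x + y) = reg_trace x + reg_trace y"
proof -
  have "((\<lambda>\<nu>. t (J \<nu> (x + y))) \<longlongrightarrow> reg_trace x + reg_trace y) (at_right 0)"
  proof (rule Lim_transform_eventually[OF tendsto_add[OF reg_trace reg_trace]])
    show "\<forall>\<^sub>F \<nu> in at_right 0. t (J \<nu> x) + t (J \<nu> y) = t (J \<nu> (x + y))"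
      using eventually_pos
      by eventually_elim (simp add: linear_simps[OF J_linear] t_simps J_D)
  qed (use assms in auto)
  then show "x + y \<in> dom_reg_trace" "reg_trace (x + y) = reg_trace x + reg_trace y" by (auto intro: dom_reg_traceI reg_trace_eqI)
qed

lemma reg_trace_scale:
  assumes "x \<in> dom_reg_trace" shows "r *\<^sub>R x \<in> dom_reg_trace" "reg_trace (r *\<^sub>R x) = r *\<^sub>R reg_trace x"
proof -
  have "((\<lambda>\<nu>. t (J \<nu> (r *\<^sub>R x))) \<longlongrightarrow> r *\<^sub>R reg_trace x) (at_right 0)"
  proof (rule Lim_transform_eventually[OF tendsto_scaleR[OF tendsto_const reg_trace]])
    show "\<forall>\<^sub>F \<nu> in at_right 0. r *\<^sub>R t (J \<nu> x) = t (J \<nu> (r *\<^sub>R x))"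
      using eventually_pos
      by eventually_elim (simp add: linear_simps[OF J_linear] t_simps J_D)
  qed (use assms in auto)
  then show "r *\<^sub>R x \<in> dom_reg_trace" "reg_trace (r *\<^sub>R x) = r *\<^sub>R reg_trace x" by (auto intro: dom_reg_traceI reg_trace_eqI)
qed

lemma reg_trace_D:
  assumes "y \<in> D" shows "y \<in> dom_reg_trace" "reg_trace y = t y"
proof -
  obtain c where c: "\<And>y. y \<in> D \<Longrightarrow> norm (t y) \<le> c * (norm (B y) + norm y)" using t_bound by blast
  have "((\<lambda>\<nu>. t (J \<nu> y) - t y) \<longlongrightarrow> 0) (at_right 0)"
  proof (rule Lim_null_comparison)
    show "\<forall>\<^sub>F \<nu> in at_right 0. norm (t (J \<nu> y) - t y) \<le> c * (norm (J \<nu> (B y) - B y) + norm (J \<nu> y - y))"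
      using eventually_pos
    proof eventually_elim
      case (elim \<nu>)
      then show ?case using c[of "J \<nu> y - y"] assms J_D by (simp add: JB B_simps t_simps)
    qed
    have "((\<lambda>\<nu>. c * (norm (J \<nu> (B y) - B y) + norm (J \<nu> y - y))) \<longlongrightarrow>
        c * (norm (B y - B y) + norm (y - y))) (at_right 0)"
      by (intro tendsto_intros J_lim)
    then show "((\<lambda>\<nu>. c * (norm (J \<nu> (B y) - B y) + norm (J \<nu> y - y))) \<longlongrightarrow> 0) (at_right 0)"
      by simp
  qed
  from tendsto_add[OF this tendsto_const[of "t y"]]
  have "((\<lambda>\<nu>. t (J \<nu> y)) \<longlongrightarrow> t y) (at_right 0)" by simp
  then show "y \<in> dom_reg_trace" "reg_trace y = t y" by (auto intro: dom_reg_traceI reg_trace_eqI)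
qed

lemma reg_trace_K_B_pot:
  assumes "\<mu> \<noteq> 0" shows "- K (B (pot \<mu> \<zeta>)) \<in> dom_reg_trace"
  using potentials_regular[OF assms] unfolding dom_reg_trace_def by blast

subsection \<open>The wave relation and its Green identity\<close>

text \<open>
  Formally \<open>v = B p - t\<^sup>* \<zeta>\<close>, tested against \<open>D\<close>, and \<open>q = K B p - B y\<close>, written such that it
  makes sense when neither \<open>p\<close> nor \<open>y\<close> lies in \<open>D\<close>. So \<open>wave_rel y p v q \<zeta>\<close> says that the wave
  operator maps the state \<open>(y, p)\<close> to \<open>(v, q)\<close> and that \<open>\<zeta>\<close> is the charge of the state; the
  spectral parameter does not occur.
\<close>

definition wave_rel :: "'h \<Rightarrow> 'h \<Rightarrow> 'h \<Rightarrow> 'h \<Rightarrow> 'a \<Rightarrow> bool" where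
  "wave_rel y p v q \<zeta> \<longleftrightarrow>
     (\<forall>x\<in>D. p \<bullet> B x = v \<bullet> x + \<zeta> \<bullet> t x) \<and> y - K p \<in> D \<and> q = - B (y - K p)"

lemma BJ_sym: "\<nu> > 0 \<Longrightarrow> B (J \<nu> x) \<bullet> z = x \<bullet> B (J \<nu> z)"
proof -
  assume nu: "\<nu> > 0"
  show "B (J \<nu> x) \<bullet> z = x \<bullet> B (J \<nu> z)"
  proof (rule continuous_eq_on_dense[OF dense, of "\<lambda>z. B (J \<nu> x) \<bullet> z" "\<lambda>z. x \<bullet> B (J \<nu> z)"])
    show "continuous_on UNIV (\<lambda>z. B (J \<nu> x) \<bullet> z)" by (intro continuous_intros)
    show "continuous_on UNIV (\<lambda>z. x \<bullet> B (J \<nu> z))"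
      by (intro continuous_intros linear_continuous_on BJ_linear nu)
    fix s assume s: "s \<in> D"
    have "B (J \<nu> x) \<bullet> s = J \<nu> x \<bullet> B s" by (rule sym[OF J_D[OF nu] s])
    also have "\<dots> = x \<bullet> B (J \<nu> s)" by (simp add: J_sym[OF nu] JB[OF nu s])
    finally show "B (J \<nu> x) \<bullet> s = x \<bullet> B (J \<nu> s)" .
  qed
qed

lemma green_limit:
  assumes rel: "wave_rel y p v q \<zeta>" and y': "y' \<in> dom_reg_trace"
  shows "((\<lambda>\<nu>. p \<bullet> B (J \<nu> y')) \<longlongrightarrow> v \<bullet> y' + \<zeta> \<bullet> reg_trace y') (at_right 0)"
proof (rule Lim_transform_eventually)
  show "((\<lambda>\<nu>. v \<bullet> J \<nu> y' + \<zeta> \<bullet> t (J \<nu> y')) \<longlongrightarrow> v \<bullet> y' + \<zeta> \<bullet> reg_trace y') (at_right 0)"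
    by (intro tendsto_intros J_lim reg_trace y')
  show "\<forall>\<^sub>F \<nu> in at_right 0. v \<bullet> J \<nu> y' + \<zeta> \<bullet> t (J \<nu> y') = p \<bullet> B (J \<nu> y')"
    using eventually_pos
    by eventually_elim (use rel J_D in \<open>simp add: wave_rel_def\<close>)
qed

text \<open>
  Pairing the relation of \<open>(y, p)\<close> with \<open>(y', p')\<close> leaves one term in which \<open>B\<close> acts on a vector
  outside its domain. The regularization \<open>J \<nu>\<close> gives it a meaning as a limit.
\<close>

lemma green_half:
  assumes rel: "wave_rel y p v q \<zeta>" and rel': "wave_rel y' p' v' q' \<zeta>'" and y': "y' \<in> dom_reg_trace"
  shows "((\<lambda>\<nu>. B (J \<nu> p) \<bullet> K p') \<longlongrightarrow> v \<bullet> y' + \<zeta> \<bullet> reg_trace y' + p \<bullet> q') (at_right 0)"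
proof (rule Lim_transform_eventually)
  show "((\<lambda>\<nu>. p \<bullet> B (J \<nu> y') + J \<nu> p \<bullet> q') \<longlongrightarrow> v \<bullet> y' + \<zeta> \<bullet> reg_trace y' + p \<bullet> q') (at_right 0)"
    by (intro tendsto_add green_limit[OF rel y'] tendsto_inner J_lim tendsto_const)
  show "\<forall>\<^sub>F \<nu> in at_right 0. p \<bullet> B (J \<nu> y') + J \<nu> p \<bullet> q' = B (J \<nu> p) \<bullet> K p'"
    using eventually_pos
  proof eventually_elim
    case (elim \<nu>)
    have "J \<nu> p \<bullet> q' = - (B (J \<nu> p) \<bullet> (y' - K p'))"
      using rel' sym[OF J_D[OF elim], of "y' - K p'" p] by (simp add: wave_rel_def)
    then show ?case using BJ_sym[OF elim, of p y'] by (simp add: inner_diff_right)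
  qed
qed

text \<open>
  Skew-symmetry up to the boundary terms. In the two instances of \<open>green_half\<close> the remaining
  limits are opposite to each other, because \<open>B (J \<nu>)\<close> is symmetric, \<open>K\<close> is skew, and \<open>K\<close> commutes
  with \<open>B\<close> and \<open>J \<nu>\<close>.
\<close>

lemma green:
  assumes rel: "wave_rel y p v q \<zeta>" and rel': "wave_rel y' p' v' q' \<zeta>'"
    and y: "y \<in> dom_reg_trace" and y': "y' \<in> dom_reg_trace"
  shows "v \<bullet> y' + q \<bullet> p' + \<zeta> \<bullet> reg_trace y' + (y \<bullet> v' + p \<bullet> q' + reg_trace y \<bullet> \<zeta>') = 0"
proof -
  have "((\<lambda>\<nu>. B (J \<nu> p') \<bullet> K p) \<longlongrightarrow> - (v \<bullet> y' + \<zeta> \<bullet> reg_trace y' + p \<bullet> q')) (at_right 0)"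
  proof (rule Lim_transform_eventually)
    show "((\<lambda>\<nu>. - (B (J \<nu> p) \<bullet> K p')) \<longlongrightarrow> - (v \<bullet> y' + \<zeta> \<bullet> reg_trace y' + p \<bullet> q')) (at_right 0)"
      by (intro tendsto_minus green_half[OF rel rel' y'])
    show "\<forall>\<^sub>F \<nu> in at_right 0. - (B (J \<nu> p) \<bullet> K p') = B (J \<nu> p') \<bullet> K p"
      using eventually_pos
    proof eventually_elim
      case (elim \<nu>)
      have "- (B (J \<nu> p) \<bullet> K p') = - (p \<bullet> B (K (J \<nu> p')))" by (simp add: BJ_sym[OF elim] JK[OF elim])
      also have "\<dots> = - (p \<bullet> K (B (J \<nu> p')))" by (simp add: BK[OF J_D[OF elim]])
      also have "\<dots> = B (J \<nu> p') \<bullet> K p" using K_skew[of p "B (J \<nu> p')"] by (simp add: inner_commute)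
      finally show ?case .
    qed
  qed
  from tendsto_unique[OF trivial_limit_at_right_real this green_half[OF rel' rel y]]
  show ?thesis by (simp add: inner_commute)
qed

lemma wave_rel_linear:
  assumes "wave_rel y p v q \<zeta>" "wave_rel y' p' v' q' \<zeta>'"
  shows "wave_rel (y + y') (p + p') (v + v') (q + q') (\<zeta> + \<zeta>')"
    and "wave_rel (y - y') (p - p') (v - v') (q - q') (\<zeta> - \<zeta>')"
proof -
  have e: "y + y' - K (p + p') = (y - K p) + (y' - K p')" "y - y' - K (p - p') = (y - K p) - (y' - K p')"
    by (simp_all add: K_simps)
  have d: "y - K p \<in> D" "y' - K p' \<in> D" "q = - B (y - K p)" "q' = - B (y' - K p')"
    using assms unfolding wave_rel_def by blast+
  show "wave_rel (y + y') (p + p') (v + v') (q + q') (\<zeta> + \<zeta>')"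
    "wave_rel (y - y') (p - p') (v - v') (q - q') (\<zeta> - \<zeta>')"
    using assms unfolding wave_rel_def e
    by (simp_all add: B_simps(1,5)[OF d(1,2)] D_simps(2,3)[OF d(1,2)] d(3,4) inner_add_left inner_diff_left)
qed

text \<open>
  The difference of two values of the same state satisfies \<open>v = - t\<^sup>* \<zeta>\<close>, and transversality
  excludes this unless the charge \<open>\<zeta>\<close> vanishes.
\<close>

lemma wave_rel_unique:
  assumes "wave_rel y p v q \<zeta>" "wave_rel y p v' q' \<zeta>'"
  shows "v = v' \<and> q = q' \<and> \<zeta> = \<zeta>'"
proof -
  have z: "wave_rel 0 0 (v - v') (q - q') (\<zeta> - \<zeta>')" using wave_rel_linear(2)[OF assms] by simp
  then have eq: "0 = (v - v') \<bullet> x + (\<zeta> - \<zeta>') \<bullet> t x" if "x \<in> D" for x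
    using that unfolding wave_rel_def by simp
  have "\<zeta> - \<zeta>' = 0"
  proof (rule transversal)
    show "(- (v - v')) \<bullet> B x = (\<zeta> - \<zeta>') \<bullet> t (B x)" if "x \<in> D2" for x
      using eq[OF D2D(2)[OF that]] by (simp add: inner_diff_left)
  qed
  moreover from this have "v - v' = 0" using eq by (intro orthogonal_to_dense[OF dense]) auto
  moreover have "q - q' = 0" using z by (simp add: wave_rel_def K_simps B_simps)
  ultimately show ?thesis by simp
qed

lemma wave_rel_regular:
  assumes "y \<in> D" "p \<in> D" shows "wave_rel y p (B p) (K (B p) - B y) 0"
  using assms K_D sym by (simp add: wave_rel_def B_simps BK)

text \<open>
  Potentials are the eigenvectors of the relation for the eigenvalue \<open>\<mu>\<close>. This holds for every
  charge, since the relation does not contain the boundary condition.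
\<close>

lemma wave_rel_potential:
  assumes mu: "\<mu> \<noteq> 0"
  shows "wave_rel (\<mu> *\<^sub>R pot \<mu> \<zeta> - K (B (pot \<mu> \<zeta>))) (- B (pot \<mu> \<zeta>))
    (\<mu> *\<^sub>R (\<mu> *\<^sub>R pot \<mu> \<zeta> - K (B (pot \<mu> \<zeta>)))) (\<mu> *\<^sub>R (- B (pot \<mu> \<zeta>))) (- \<zeta>)"
  using pot_solves(1)[OF mu, of \<zeta>] pot_solves(2)[OF mu, where \<zeta> = \<zeta>] K_skew[of "B (pot \<mu> \<zeta>)"]
  by (auto simp: wave_rel_def K_simps B_simps wform_def inner_diff_left algebra_simps power2_eq_square)

lemma potential_dom_reg_trace:
  assumes mu: "\<mu> \<noteq> 0"
  shows "\<mu> *\<^sub>R pot \<mu> \<zeta> - K (B (pot \<mu> \<zeta>)) \<in> dom_reg_trace"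
    "reg_trace (\<mu> *\<^sub>R pot \<mu> \<zeta> - K (B (pot \<mu> \<zeta>))) = \<mu> *\<^sub>R t (pot \<mu> \<zeta>) + reg_trace (- K (B (pot \<mu> \<zeta>)))"
  using reg_trace_add[OF reg_trace_D(1)[of "\<mu> *\<^sub>R pot \<mu> \<zeta>"] reg_trace_K_B_pot[OF mu]] pot_solves(1)[OF mu, of \<zeta>]
    reg_trace_D(2)[of "\<mu> *\<^sub>R pot \<mu> \<zeta>"]
  by (auto simp: t_simps)

text \<open>
  The decomposition into a regular and a singular part: the singular part, made from the potential
  of the charge \<open>\<zeta>\<close>, is itself in relation, and what remains has charge \<open>0\<close>, hence lies in the
  domain of \<open>B\<close>.
\<close>

lemma wave_rel_decompose:
  assumes mu: "\<mu> \<noteq> 0"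
  shows "wave_rel y p v q \<zeta> \<longleftrightarrow>
    (\<exists>y'\<in>D. \<exists>p'\<in>D. y = y' + K (B (pot \<mu> \<zeta>)) \<and> p = p' + B (pot \<mu> \<zeta>) \<and>
       v = B p' - \<mu> *\<^sub>R (- K (B (pot \<mu> \<zeta>)) + \<mu> *\<^sub>R pot \<mu> \<zeta>) \<and> q = K (B p') - B y')"
proof -
  define z where "z = pot \<mu> \<zeta>"
  \<comment> \<open>The velocity of the singular part \<open>(K B z, B z)\<close>, by the variational equation of \<open>z\<close>.\<close>
  define v1 where "v1 = - (\<mu> *\<^sub>R (- K (B z) + \<mu> *\<^sub>R z))"
  have pot: "wave_rel (K (B z)) (B z) v1 0 \<zeta>"
    using pot_solves(2)[OF mu, where \<zeta> = \<zeta>] K_skew[of "B z"] B_simps(3)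
    by (auto simp: wave_rel_def v1_def z_def wform_def inner_add_left inner_diff_left power2_eq_square
        algebra_simps)
  show ?thesis unfolding z_def[symmetric]
  proof
    assume rel: "wave_rel y p v q \<zeta>"
    have diff: "wave_rel (y - K (B z)) (p - B z) (v - v1) q 0"
      using wave_rel_linear(2)[OF rel pot] by simp
    then have p: "p - B z \<in> D \<and> B (p - B z) = v - v1"
      by (intro maximal) (simp add: wave_rel_def)
    have yD: "(y - K (B z)) - K (p - B z) \<in> D" and q: "q = - B ((y - K (B z)) - K (p - B z))"
      using diff by (auto simp: wave_rel_def)
    have KD: "K (p - B z) \<in> D" using K_D p by blast
    have "y - K (B z) \<in> D" using D_simps(2)[OF yD KD] by simp
    moreover from this have "q = K (B (p - B z)) - B (y - K (B z))"
      using q KD p by (simp add: B_simps(5) BK)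
    ultimately show "\<exists>y'\<in>D. \<exists>p'\<in>D. y = y' + K (B z) \<and> p = p' + B z \<and>
       v = B p' - \<mu> *\<^sub>R (- K (B z) + \<mu> *\<^sub>R z) \<and> q = K (B p') - B y'"
      using p by (intro bexI[of _ "y - K (B z)"] bexI[of _ "p - B z"]) (auto simp: v1_def)
  next
    assume "\<exists>y'\<in>D. \<exists>p'\<in>D. y = y' + K (B z) \<and> p = p' + B z \<and>
       v = B p' - \<mu> *\<^sub>R (- K (B z) + \<mu> *\<^sub>R z) \<and> q = K (B p') - B y'"
    then obtain y' p' where *: "y' \<in> D" "p' \<in> D" "y = y' + K (B z)" "p = p' + B z"
      "v = B p' + v1" "q = K (B p') - B y'" by (auto simp: v1_def)
    show "wave_rel y p v q \<zeta>"
      using wave_rel_linear(1)[OF wave_rel_regular[OF *(1,2)] pot] by (simp add: *)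
  qed
qed

subsection \<open>The operator-valued Weyl function\<close>

text \<open>
  The operator $\Gamma_\Theta(\mu)$.
\<close>

definition weyl :: "real \<Rightarrow> 'a \<Rightarrow> 'a" where
  "weyl \<mu> \<zeta> = - (\<mu> *\<^sub>R t (pot \<mu> \<zeta>)) - reg_trace (- K (B (pot \<mu> \<zeta>))) - (1 / \<mu>) *\<^sub>R \<Theta> \<zeta>"

text \<open>
  Up to its sign, this is the defect of the potential in the boundary condition when the third
  component is \<open>- \<zeta> / \<mu>\<close>.
\<close>

lemma weyl_eq:
  assumes "\<mu> \<noteq> 0"
  shows "weyl \<mu> \<zeta> = - reg_trace (\<mu> *\<^sub>R pot \<mu> \<zeta> - K (B (pot \<mu> \<zeta>))) - (1 / \<mu>) *\<^sub>R \<Theta> \<zeta>"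
  by (simp add: weyl_def potential_dom_reg_trace(2)[OF assms])

text \<open>
  The Green identity of a potential with itself.
\<close>

lemma weyl_energy:
  assumes mu: "\<mu> \<noteq> 0"
  shows "- (\<mu> *\<^sub>R weyl \<mu> \<zeta>) \<bullet> \<zeta> =
    \<mu>\<^sup>2 * ((norm (\<mu> *\<^sub>R pot \<mu> \<zeta> - K (B (pot \<mu> \<zeta>))))\<^sup>2 + (norm (B (pot \<mu> \<zeta>)))\<^sup>2) + \<Theta> \<zeta> \<bullet> \<zeta>"
proof -
  define y where "y = \<mu> *\<^sub>R pot \<mu> \<zeta> - K (B (pot \<mu> \<zeta>))"
  define p where "p = - B (pot \<mu> \<zeta>)"
  have rel: "wave_rel y p (\<mu> *\<^sub>R y) (\<mu> *\<^sub>R p) (- \<zeta>)" unfolding y_def p_def by (rule wave_rel_potential[OF mu])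
  have y: "y \<in> dom_reg_trace" unfolding y_def by (rule potential_dom_reg_trace(1)[OF mu])
  have "\<mu> * (y \<bullet> y) + \<mu> * (p \<bullet> p) = reg_trace y \<bullet> \<zeta>"
    using green[OF rel rel y y] by (simp add: inner_commute)
  then have "\<mu> * (\<mu> * (y \<bullet> y) + \<mu> * (p \<bullet> p)) = \<mu> * (reg_trace y \<bullet> \<zeta>)" by (rule arg_cong)
  then have "\<mu>\<^sup>2 * (y \<bullet> y + p \<bullet> p) = \<mu> * (reg_trace y \<bullet> \<zeta>)" by (simp add: power2_eq_square algebra_simps)
  moreover have "- (\<mu> *\<^sub>R weyl \<mu> \<zeta>) = \<mu> *\<^sub>R reg_trace y + \<Theta> \<zeta>"
    using mu by (simp add: weyl_eq[OF mu] scaleR_right_diff_distrib flip: y_def)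
  ultimately show ?thesis
    by (simp add: power2_norm_eq_inner inner_add_left p_def flip: y_def)
qed

text \<open>
  The summand with the regularized trace is a pointwise limit of bounded operators, so it is
  bounded by the uniform boundedness principle.
\<close>

lemma weyl_linear:
  assumes mu: "\<mu> \<noteq> 0" shows "bounded_linear (weyl \<mu>)"
proof -
  note wl = linear_simps[OF pot_linear(1)[OF mu]] linear_simps[OF pot_linear(2)[OF mu]]
  note lin_mK = bounded_linear_minus[OF bounded_linear_compose[OF K_linear pot_linear(2)[OF mu]]]
  have reg: "- K (B (pot \<mu> \<zeta>)) \<in> dom_reg_trace" for \<zeta> by (rule reg_trace_K_B_pot[OF mu])
  \<comment> \<open>A sequence \<open>\<nu> \<down> 0\<close>: pointwise convergence along the filter alone would not give pointwise bounds.\<close>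
  define T where "T n \<zeta> = t (J (1 / real (Suc n)) (- K (B (pot \<mu> \<zeta>))))" for n :: nat and \<zeta>
  have T_lin: "bounded_linear (T n)" for n
    unfolding T_def
    by (intro t_comp_linear bounded_linear_compose[OF J_linear lin_mK] bounded_linear_compose[OF BJ_linear lin_mK] J_D) auto
  have "filterlim (\<lambda>n. 1 / real (Suc n)) (at_right 0) sequentially"
    by (intro filterlim_at_withinI[OF lim_1_over_n[THEN LIMSEQ_Suc]] always_eventually) auto
  then have T_lim: "(\<lambda>n. T n \<zeta>) \<longlonglongrightarrow> reg_trace (- K (B (pot \<mu> \<zeta>)))" for \<zeta>
    unfolding T_def using reg_trace[OF reg, of \<zeta>] by (rule filterlim_compose[rotated])
  obtain C where C: "\<And>n \<zeta>. norm (T n \<zeta>) \<le> C * norm \<zeta>"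
  proof (rule uniform_boundedness[of UNIV T])
    show "bounded_linear (T n)" for n by (rule T_lin)
    show "\<exists>C. \<forall>n\<in>UNIV. norm (T n \<zeta>) \<le> C" for \<zeta>
      using convergent_imp_Bseq[OF convergentI[OF T_lim]] unfolding Bseq_def by blast
  qed blast
  have reg_trace_lin: "bounded_linear (\<lambda>\<zeta>. reg_trace (- K (B (pot \<mu> \<zeta>))))"
  proof (rule bounded_linear_intro)
    show "reg_trace (- K (B (pot \<mu> (x + y)))) = reg_trace (- K (B (pot \<mu> x))) + reg_trace (- K (B (pot \<mu> y)))" for x y
      using reg_trace_add(2)[OF reg reg, of x y] by (simp add: wl K_simps B_simps pot_solves(1)[OF mu])
    show "reg_trace (- K (B (pot \<mu> (r *\<^sub>R x)))) = r *\<^sub>R reg_trace (- K (B (pot \<mu> x)))" for r x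
      using reg_trace_scale(2)[OF reg, of r x] by (simp add: wl K_simps B_simps pot_solves(1)[OF mu])
    show "norm (reg_trace (- K (B (pot \<mu> x)))) \<le> norm x * C" for x
      by (rule LIMSEQ_le_const2[OF tendsto_norm[OF T_lim]]) (use C in \<open>auto simp: mult.commute\<close>)
  qed
  have "bounded_linear (\<lambda>\<zeta>. t (pot \<mu> \<zeta>))" by (intro t_comp_linear pot_linear pot_solves mu)
  then show ?thesis unfolding weyl_def
    by (intro bounded_linear_sub bounded_linear_minus bounded_linear_const_scaleR reg_trace_lin Theta_linear)
qed

text \<open>
  Coercivity is where the surjectivity of \<open>t y - \<Theta> a\<close> enters: it shows that the unit ball of the
  energy in \<open>weyl_energy\<close> is weakly bounded.
\<close>

lemma weyl_coercive:
  assumes mu: "\<mu> \<noteq> 0"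
  obtains c where "c > 0" "\<And>\<zeta>. c * (norm \<zeta>)\<^sup>2 \<le> - (\<mu> *\<^sub>R weyl \<mu> \<zeta>) \<bullet> \<zeta>"
proof (rule coercive_if_weakly_bounded[of "\<lambda>\<zeta>. - (\<mu> *\<^sub>R weyl \<mu> \<zeta>) \<bullet> \<zeta>"])
  interpret weyl: bounded_linear "weyl \<mu>" by (rule weyl_linear[OF mu])
  show "- (\<mu> *\<^sub>R weyl \<mu> (r *\<^sub>R \<zeta>)) \<bullet> (r *\<^sub>R \<zeta>) = r\<^sup>2 * (- (\<mu> *\<^sub>R weyl \<mu> \<zeta>) \<bullet> \<zeta>)" for r \<zeta>
    by (simp add: weyl.scale power2_eq_square)
  show "0 \<le> - (\<mu> *\<^sub>R weyl \<mu> \<zeta>) \<bullet> \<zeta>" for \<zeta>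
    unfolding weyl_energy[OF mu] by (intro add_nonneg_nonneg mult_nonneg_nonneg Theta_pos) auto
  fix h
  obtain y a where h: "y \<in> D" "h = t y - \<Theta> a" using t_Theta_surj by blast
  have "\<bar>\<zeta> \<bullet> h\<bar> \<le> norm (B y) / \<bar>\<mu>\<bar> + norm y + sqrt (\<Theta> a \<bullet> a)"
    if le: "- (\<mu> *\<^sub>R weyl \<mu> \<zeta>) \<bullet> \<zeta> \<le> 1" for \<zeta>
  proof -
    define z where "z = \<mu> *\<^sub>R pot \<mu> \<zeta> - K (B (pot \<mu> \<zeta>))"
    define p where "p = B (pot \<mu> \<zeta>)"
    have "\<mu>\<^sup>2 * ((norm z)\<^sup>2 + (norm p)\<^sup>2) + \<Theta> \<zeta> \<bullet> \<zeta> \<le> 1"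
      using le unfolding weyl_energy[OF mu] z_def p_def .
    moreover have "0 \<le> \<mu>\<^sup>2 * (norm z)\<^sup>2" "0 \<le> \<mu>\<^sup>2 * (norm p)\<^sup>2" "0 \<le> \<Theta> \<zeta> \<bullet> \<zeta>"
      using Theta_pos by auto
    ultimately have "\<mu>\<^sup>2 * (norm z)\<^sup>2 \<le> 1" "\<mu>\<^sup>2 * (norm p)\<^sup>2 \<le> 1" and th: "\<Theta> \<zeta> \<bullet> \<zeta> \<le> 1"
      unfolding distrib_left by linarith+
    then have "(\<bar>\<mu>\<bar> * norm z)\<^sup>2 \<le> 1\<^sup>2" "(\<bar>\<mu>\<bar> * norm p)\<^sup>2 \<le> 1\<^sup>2" by (auto simp: power_mult_distrib)
    then have nz: "\<bar>\<mu>\<bar> * norm z \<le> 1" and np: "\<bar>\<mu>\<bar> * norm p \<le> 1"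
      by (blast intro: power2_le_imp_le[OF _ zero_le_one])+
    have "(- p) \<bullet> B y = (\<mu> *\<^sub>R z) \<bullet> y + (- \<zeta>) \<bullet> t y"
      using wave_rel_potential[OF mu, of \<zeta>] h(1) unfolding wave_rel_def z_def p_def by blast
    then have "\<zeta> \<bullet> t y = p \<bullet> B y + (\<mu> *\<^sub>R z) \<bullet> y" by simp
    then have "\<bar>\<zeta> \<bullet> t y\<bar> \<le> norm p * norm (B y) + norm (\<mu> *\<^sub>R z) * norm y"
      using Cauchy_Schwarz_ineq2[of p "B y"] Cauchy_Schwarz_ineq2[of "\<mu> *\<^sub>R z" y] by linarith
    also have "\<dots> \<le> 1 / \<bar>\<mu>\<bar> * norm (B y) + 1 * norm y"
      using nz np mu by (intro add_mono mult_right_mono) (auto simp: field_simps)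
    finally have 1: "\<bar>\<zeta> \<bullet> t y\<bar> \<le> norm (B y) / \<bar>\<mu>\<bar> + norm y" by simp
    have "(\<zeta> \<bullet> \<Theta> a)\<^sup>2 = (\<Theta> \<zeta> \<bullet> a)\<^sup>2" by (simp add: Theta_sym)
    also have "\<dots> \<le> (\<Theta> \<zeta> \<bullet> \<zeta>) * (\<Theta> a \<bullet> a)" by (rule pos_symmetric_Cauchy_Schwarz[OF Theta])
    also have "\<dots> \<le> 1 * (\<Theta> a \<bullet> a)" by (intro mult_right_mono th Theta_pos)
    finally have 2: "\<bar>\<zeta> \<bullet> \<Theta> a\<bar> \<le> sqrt (\<Theta> a \<bullet> a)" by (simp add: real_le_rsqrt)
    show ?thesis using 1 2 by (simp add: h(2) inner_diff_right)
  qed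
  then show "\<exists>C. \<forall>\<zeta>. - (\<mu> *\<^sub>R weyl \<mu> \<zeta>) \<bullet> \<zeta> \<le> 1 \<longrightarrow> \<bar>\<zeta> \<bullet> h\<bar> \<le> C" by blast
qed (rule that)

lemma weyl_bij:
  assumes mu: "\<mu> \<noteq> 0"
  shows "bij (weyl \<mu>)" "\<exists>C. \<forall>\<zeta>. norm (inv (weyl \<mu>) \<zeta>) \<le> C * norm \<zeta>"
proof -
  interpret weyl: bounded_linear "weyl \<mu>" by (rule weyl_linear[OF mu])
  obtain c where c: "c > 0" "\<And>\<zeta>. c * (norm \<zeta>)\<^sup>2 \<le> - (\<mu> *\<^sub>R weyl \<mu> \<zeta>) \<bullet> \<zeta>"
    using weyl_coercive[OF mu] by blast
  have below: "norm \<zeta> \<le> \<bar>\<mu>\<bar> / c * norm (weyl \<mu> \<zeta>)" for \<zeta>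
  proof (cases "\<zeta> = 0")
    case False
    have "c * (norm \<zeta>)\<^sup>2 \<le> norm (- (\<mu> *\<^sub>R weyl \<mu> \<zeta>)) * norm \<zeta>"
      using c(2)[of \<zeta>] norm_cauchy_schwarz[of "- (\<mu> *\<^sub>R weyl \<mu> \<zeta>)" \<zeta>] by linarith
    then have "c * norm \<zeta> * norm \<zeta> \<le> \<bar>\<mu>\<bar> * norm (weyl \<mu> \<zeta>) * norm \<zeta>"
      by (simp add: power2_eq_square mult.assoc)
    then have "c * norm \<zeta> \<le> \<bar>\<mu>\<bar> * norm (weyl \<mu> \<zeta>)" using False by simp
    then show ?thesis using c(1) by (simp add: field_simps)
  qed (use c in simp)
  have "inj (weyl \<mu>)"
  proof (rule injI)
    fix x y assume "weyl \<mu> x = weyl \<mu> y"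
    then have "weyl \<mu> (x - y) = 0" by (simp add: weyl.diff)
    then show "x = y" using below[of "x - y"] by simp
  qed
  moreover have "surj (weyl \<mu>)"
  proof (rule surj_def[THEN iffD2], rule allI)
    fix f
    have "bounded_linear (\<lambda>x. - (\<mu> *\<^sub>R weyl \<mu> x))"
      by (intro bounded_linear_minus bounded_linear_const_scaleR weyl.bounded_linear_axioms)
    from bounded_bilinear.comp[OF bounded_bilinear_inner this bounded_linear_ident]
    have bil: "bounded_bilinear (\<lambda>x y. - (\<mu> *\<^sub>R weyl \<mu> x) \<bullet> y)" by simp
    obtain x where x: "\<And>y. - (\<mu> *\<^sub>R weyl \<mu> x) \<bullet> y = (- \<mu> *\<^sub>R f) \<bullet> y"
      by (rule lax_milgram[OF bil c(1) c(2) bounded_linear_inner_right]) blast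
    have "- (\<mu> *\<^sub>R weyl \<mu> x) = - \<mu> *\<^sub>R f" using x by (intro vector_eq_rdot[THEN iffD1]) blast
    then have "f = weyl \<mu> x" using mu by simp
    then show "\<exists>x. f = weyl \<mu> x" by blast
  qed
  ultimately show b: "bij (weyl \<mu>)" by (simp add: bij_def)
  show "\<exists>C. \<forall>\<zeta>. norm (inv (weyl \<mu>) \<zeta>) \<le> C * norm \<zeta>"
    using below[of "inv (weyl \<mu>) _"] by (metis b bij_inv_eq_iff)
qed

subsection \<open>The resolvent equation\<close>

text \<open>
  The two components of the solution of the resolvent equation without coupling.
\<close>

definition free_y where "free_y \<mu> f1 f2 = B (R \<mu> f2) - K (B (R \<mu> f1)) + \<mu> *\<^sub>R R \<mu> f1"
definition free_p where "free_p \<mu> f1 f2 = \<mu> *\<^sub>R R \<mu> f2 - B (R \<mu> f1)"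

lemma free_solution:
  assumes mu: "\<mu> \<noteq> 0"
  shows "free_y \<mu> f1 f2 \<in> D" "free_p \<mu> f1 f2 \<in> D"
    "\<mu> *\<^sub>R free_y \<mu> f1 f2 - B (free_p \<mu> f1 f2) = f1"
    "\<mu> *\<^sub>R free_p \<mu> f1 f2 - (K (B (free_p \<mu> f1 f2)) - B (free_y \<mu> f1 f2)) = f2"
proof -
  note d = R_D[OF mu]
  show "free_y \<mu> f1 f2 \<in> D" "free_p \<mu> f1 f2 \<in> D" using d K_D by (simp_all add: free_y_def free_p_def)
  show "\<mu> *\<^sub>R free_y \<mu> f1 f2 - B (free_p \<mu> f1 f2) = f1"
    using d K_D by (simp add: free_y_def free_p_def B_simps BBR[OF mu] algebra_simps power2_eq_square)
  show "\<mu> *\<^sub>R free_p \<mu> f1 f2 - (K (B (free_p \<mu> f1 f2)) - B (free_y \<mu> f1 f2)) = f2"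
    using d K_D
    by (simp add: free_y_def free_p_def B_simps BK BBR[OF mu] K_simps algebra_simps power2_eq_square)
qed

text \<open>
  Potentials are eigenvectors, so adding one to a regular solution leaves the right-hand side of
  the resolvent equation unchanged. The defect in the boundary condition is shifted by
  \<open>- weyl \<mu> \<zeta>\<close>.
\<close>

lemma krein_solution:
  assumes mu: "\<mu> \<noteq> 0" and y: "y \<in> D" and p: "p \<in> D"
    and zeta: "weyl \<mu> \<zeta> = t y - (1 / \<mu>) *\<^sub>R \<Theta> f3"
  defines "y0 \<equiv> y + (\<mu> *\<^sub>R pot \<mu> \<zeta> - K (B (pot \<mu> \<zeta>)))"
    and "v \<equiv> B p + \<mu> *\<^sub>R (\<mu> *\<^sub>R pot \<mu> \<zeta> - K (B (pot \<mu> \<zeta>)))"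
    and "q \<equiv> K (B p) - B y + \<mu> *\<^sub>R (- B (pot \<mu> \<zeta>))"
  shows "wave_rel y0 (p - B (pot \<mu> \<zeta>)) v q (- \<zeta>)"
    "y0 \<in> dom_reg_trace" "\<Theta> ((1 / \<mu>) *\<^sub>R f3 - (1 / \<mu>) *\<^sub>R \<zeta>) = reg_trace y0"
proof -
  show "wave_rel y0 (p - B (pot \<mu> \<zeta>)) v q (- \<zeta>)"
    using wave_rel_linear(1)[OF wave_rel_regular[OF y p] wave_rel_potential[OF mu, of \<zeta>]]
    by (simp add: y0_def v_def q_def)
  show "y0 \<in> dom_reg_trace" unfolding y0_def by (intro reg_trace_add(1) reg_trace_D(1)[OF y] potential_dom_reg_trace(1)[OF mu])
  have "reg_trace y0 = t y - weyl \<mu> \<zeta> - (1 / \<mu>) *\<^sub>R \<Theta> \<zeta>"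
    unfolding y0_def using reg_trace_add(2)[OF reg_trace_D(1)[OF y] potential_dom_reg_trace(1)[OF mu]] reg_trace_D(2)[OF y] weyl_eq[OF mu]
    by simp
  then show "\<Theta> ((1 / \<mu>) *\<^sub>R f3 - (1 / \<mu>) *\<^sub>R \<zeta>) = reg_trace y0"
    by (simp add: zeta Theta_simps)
qed

lemma wave_solvable:
  assumes mu: "\<mu> \<noteq> 0"
  obtains y p a v q \<zeta> where "wave_rel y p v q \<zeta>" "y \<in> dom_reg_trace" "\<Theta> a = reg_trace y"
    "\<mu> *\<^sub>R y - v = f1" "\<mu> *\<^sub>R p - q = f2" "\<mu> *\<^sub>R a - \<zeta> = f3"
proof -
  define \<zeta> where "\<zeta> = inv (weyl \<mu>) (t (free_y \<mu> f1 f2) - (1 / \<mu>) *\<^sub>R \<Theta> f3)"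
  have "weyl \<mu> \<zeta> = t (free_y \<mu> f1 f2) - (1 / \<mu>) *\<^sub>R \<Theta> f3"
    unfolding \<zeta>_def using weyl_bij(1)[OF mu] by (simp add: bij_is_surj surj_f_inv_f)
  note sol = krein_solution[OF mu free_solution(1,2)[OF mu] this]
  show ?thesis
  proof (rule that[OF sol])
    show "\<mu> *\<^sub>R ((1 / \<mu>) *\<^sub>R f3 - (1 / \<mu>) *\<^sub>R \<zeta>) - - \<zeta> = f3" using mu by (simp add: algebra_simps)
  qed (use free_solution(3,4)[OF mu, of f1 f2] in \<open>simp_all add: algebra_simps\<close>)
qed

text \<open>
  The square root \<open>Q\<close> of \<open>\<Theta>\<close> embeds the space with the norm of \<open>\<Theta>\<close> isometrically into the ambient
  Hilbert space. What is orthogonal there to all \<open>(y, Q a)\<close> with \<open>t y = \<Theta> a\<close> annihilates the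
  kernel of the surjective map \<open>(y, a) \<mapsto> t y - \<Theta> a\<close>, so it comes from some \<open>\<xi>\<close> by the adjoint of
  that map, and transversality gives \<open>\<xi> = 0\<close>.
\<close>

lemma trace_condition_dense:
  assumes e: "\<epsilon> > 0"
  obtains y a where "y \<in> D" "t y = \<Theta> a"
    "(norm (y0 - y))\<^sup>2 + \<Theta> (a0 - a) \<bullet> (a0 - a) < \<epsilon>"
proof -
  obtain Q where Q: "pos_symmetric Q" "\<And>x. Q (Q x) = \<Theta> x"
    using pos_symmetric_sqrt_exists[OF Theta] by metis
  have Qlin: "bounded_linear Q" and Qsym: "\<And>x y. Q x \<bullet> y = x \<bullet> Q y"
    using Q(1) unfolding pos_symmetric_def by blast+
  interpret Q: bounded_linear Q by (rule Qlin)
  define V where "V = {(y, Q a) | y a. y \<in> D \<and> t y = \<Theta> a}"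
  have "closure V = UNIV"
  proof (rule closure_subspace_eq_UNIV)
    show "subspace V"
    proof (rule subspaceI)
      show "0 \<in> V" unfolding V_def zero_prod_def
        using t_simps(3) Theta_simps Q.zero by (auto intro!: exI[of _ 0])
      show "x + y \<in> V" if "x \<in> V" "y \<in> V" for x y
      proof -
        from that obtain x1 a1 y1 a2 where *: "x = (x1, Q a1)" "y = (y1, Q a2)" "x1 \<in> D" "y1 \<in> D"
          "t x1 = \<Theta> a1" "t y1 = \<Theta> a2" by (auto simp: V_def)
        then have "x + y = (x1 + y1, Q (a1 + a2))" "x1 + y1 \<in> D" "t (x1 + y1) = \<Theta> (a1 + a2)"
          by (simp_all add: Q.add t_simps Theta_simps)
        then show ?thesis unfolding V_def by blast
      qed
      show "r *\<^sub>R x \<in> V" if "x \<in> V" for r x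
      proof -
        from that obtain x1 a1 where *: "x = (x1, Q a1)" "x1 \<in> D" "t x1 = \<Theta> a1" by (auto simp: V_def)
        then have "r *\<^sub>R x = (r *\<^sub>R x1, Q (r *\<^sub>R a1))" "r *\<^sub>R x1 \<in> D" "t (r *\<^sub>R x1) = \<Theta> (r *\<^sub>R a1)"
          by (simp_all add: Q.scale t_simps Theta_simps)
        then show ?thesis unfolding V_def by blast
      qed
    qed
    fix z assume z: "\<And>s. s \<in> V \<Longrightarrow> z \<bullet> s = 0"
    obtain u v where uv: "z = (u, v)" by (cases z)
    define M where "M z = t (S (fst z)) - \<Theta> (snd z)" for z
    have tS: "bounded_linear (\<lambda>x. t (S x))" by (intro t_comp_linear S_linear BS_linear S_in_D)
    have "bounded_linear M" unfolding M_def
      by (intro bounded_linear_sub bounded_linear_compose[OF tS] bounded_linear_compose[OF Theta_linear]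
          bounded_linear_fst bounded_linear_snd)
    moreover have "surj M"
    proof (rule surj_def[THEN iffD2], rule allI)
      fix h
      obtain y a where y: "y \<in> D" "h = t y - \<Theta> a" using t_Theta_surj by blast
      moreover obtain x where "y = S x" using y(1) range_S by blast
      ultimately have "h = M (x, a)" by (simp add: M_def)
      then show "\<exists>x. h = M x" by blast
    qed
    moreover have "(S u, Q v) \<bullet> x = 0" if "M x = 0" for x
    proof -
      have "(S (fst x), Q (snd x)) \<in> V" using that S_in_D unfolding V_def M_def by auto
      from z[OF this] show ?thesis by (simp add: uv inner_prod_def S_sym Qsym)
    qed
    ultimately obtain \<xi> where \<xi>: "\<And>x. (S u, Q v) \<bullet> x = \<xi> \<bullet> M x"
      using annihilator_of_kernel by metis
    have 1: "u \<bullet> y = \<xi> \<bullet> t y" if "y \<in> D" for y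
    proof -
      obtain x where "y = S x" using \<open>y \<in> D\<close> range_S by blast
      then show ?thesis using \<xi>[of "(x, 0)"] by (simp add: M_def inner_prod_def S_sym Theta_simps)
    qed
    have "\<xi> = 0" by (rule transversal[of u]) (use 1 D2D in auto)
    then have "u = 0" using 1 by (intro orthogonal_to_dense[OF dense]) auto
    moreover have "Q v \<bullet> Q v = 0" using \<xi>[of "(0, Q v)"] \<open>\<xi> = 0\<close> by (simp add: inner_prod_def)
    then have "v = 0" using Q(2)[of v] Q.zero Theta_inj by simp
    ultimately show "z = 0" by (simp add: uv zero_prod_def)
  qed
  then have "(y0, Q a0) \<in> closure V" by simp
  then obtain x where x: "x \<in> V" "dist x (y0, Q a0) < sqrt \<epsilon>"
    using e unfolding closure_approachable by (meson real_sqrt_gt_zero)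
  then obtain y a where ya: "x = (y, Q a)" "y \<in> D" "t y = \<Theta> a" by (auto simp: V_def)
  have "(norm (y0 - y))\<^sup>2 + \<Theta> (a0 - a) \<bullet> (a0 - a) = (dist (y0, Q a0) x)\<^sup>2"
    by (simp add: ya dist_Pair_Pair dist_norm power2_norm_eq_inner
        Q.diff[symmetric] Qsym Q(2) inner_commute)
  also have "\<dots> = (dist x (y0, Q a0))\<^sup>2" by (simp add: dist_commute)
  also have "\<dots> < (sqrt \<epsilon>)\<^sup>2" using x(2) by (intro power_strict_mono) auto
  finally show ?thesis using that[of y a] ya e by simp
qed

end

section \<open>Scalar products over the real or complex field\<close>

lemma kre_eqI: "(2 * r) *\<^sub>R 1 = x + kconj x \<Longrightarrow> kre (x::'k::rc_scalar) = r"
proof -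
  assume "(2 * r) *\<^sub>R 1 = x + kconj x"
  then have "(2 * kre x) *\<^sub>R (1::'k) = (2 * r) *\<^sub>R 1" by (simp only: kre_scaleR)
  then show ?thesis by simp
qed

lemma kre_add [simp]: "kre (x + y) = kre x + kre (y::'k::rc_scalar)"
  by (rule kre_eqI) (simp add: kconj_add distrib_left scaleR_left_distrib kre_scaleR)

lemma kre_scale [simp]: "kre (r *\<^sub>R x) = r * kre (x::'k::rc_scalar)"
proof (rule kre_eqI)
  have "(2 * (r * kre x)) *\<^sub>R (1::'k) = r *\<^sub>R ((2 * kre x) *\<^sub>R 1)" by simp
  then show "(2 * (r * kre x)) *\<^sub>R (1::'k) = r *\<^sub>R x + kconj (r *\<^sub>R x)"
    by (simp only: kre_scaleR kconj_scaleR scaleR_right_distrib)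
qed

lemma kre_minus [simp]: "kre (- x) = - kre (x::'k::rc_scalar)"
  using kre_scale[of "-1" x] by simp

lemma kre_zero [simp]: "kre (0::'k::rc_scalar) = 0"
  using kre_scale[of 0 0] by simp

lemma kre_diff [simp]: "kre (x - y) = kre x - kre (y::'k::rc_scalar)"
  using kre_add[of x "- y"] by simp

lemma kre_one [simp]: "kre (1::'k::rc_scalar) = 1"
  using mult_kconj[of "1::'k"] by (intro kre_eqI) (simp add: scaleR_2)

lemma kre_kconj [simp]: "kre (kconj x) = kre (x::'k::rc_scalar)"
  by (rule kre_eqI) (simp add: kconj_kconj kre_scaleR add.commute)

lemma kre_all_eq_0:
  assumes "\<And>a. kre (a * c) = 0" shows "(c::'k::rc_scalar) = 0"
  using assms[of "kconj c"] mult_kconj[of c] by (simp add: mult.commute)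

lemma hilbert_spaceD:
  assumes "hilbert_space X"
  shows "carrier X = UNIV" "sc X (of_real r) x = r *\<^sub>R x" "ip X x (y + z) = ip X x y + ip X x z"
    "ip X x (sc X a y) = a * ip X x y" "ip X y x = kconj (ip X x y)" "kre (ip X x y) = x \<bullet> y"
    "sc X a (x + y) = sc X a x + sc X a y" "sc X a (sc X b x) = sc X (a * b) x"
  using assms unfolding hilbert_space_def vector_space_def by iprover+

lemma inner_sc_left:
  assumes X: "hilbert_space X" shows "sc X a x \<bullet> y = x \<bullet> sc X (kconj a) y"
proof -
  note h = hilbert_spaceD[OF X]
  have "kre (ip X y (sc X a x)) = kre (a * kconj (ip X x y))" by (simp only: h(4) h(5)[of y x])
  also have "\<dots> = kre (kconj (a * kconj (ip X x y)))" by simp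
  also have "\<dots> = kre (ip X x (sc X (kconj a) y))" by (simp add: kconj_mult kconj_kconj h(4))
  finally show ?thesis by (simp add: h(6) inner_commute)
qed

lemma norm_sc:
  assumes X: "hilbert_space X" shows "norm (sc X a x) = norm a * norm x"
proof -
  note h = hilbert_spaceD[OF X]
  have "sc X a x \<bullet> sc X a x = x \<bullet> sc X (kconj a * a) x" by (simp add: inner_sc_left[OF X] h(8))
  also have "kconj a * a = of_real ((norm a)\<^sup>2)"
    using mult_kconj[of a] by (simp add: of_real_def mult.commute)
  finally have "sc X a x \<bullet> sc X a x = (norm a)\<^sup>2 * (x \<bullet> x)" unfolding h(2) by simp
  then have "(norm (sc X a x))\<^sup>2 = (norm a * norm x)\<^sup>2"
    by (simp add: power2_norm_eq_inner power_mult_distrib)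
  then show ?thesis by simp
qed

lemma sc_bounded_linear: assumes X: "hilbert_space X" shows "bounded_linear (sc X a)"
proof (rule bounded_linear_intro)
  note h = hilbert_spaceD[OF X]
  show "sc X a (x + y) = sc X a x + sc X a y" for x y by (rule h(7))
  show "sc X a (r *\<^sub>R x) = r *\<^sub>R sc X a x" for r x
    by (simp add: h(2)[symmetric] h(8) mult.commute)
  show "norm (sc X a x) \<le> norm x * norm a" for x by (simp add: norm_sc[OF X])
qed

lemmas sc_simps = linear_simps[OF sc_bounded_linear]

lemma nrm_hilbert: "hilbert_space X \<Longrightarrow> nrm X x = norm x"
  by (simp add: nrm_def hilbert_spaceD(6) norm_eq_sqrt_inner)

text \<open>The real part of a scalar product determines it, because it may be tested on all multiples.\<close>

lemma ip_eqI:
  assumes X: "hilbert_space X" and Y: "hilbert_space Y"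
    and eq: "\<And>a. x \<bullet> sc X a y = x' \<bullet> sc Y a y'"
  shows "ip X x y = ip Y x' y'"
proof -
  have "kre (a * (ip X x y - ip Y x' y')) = 0" for a
    by (simp only: right_diff_distrib kre_diff hilbert_spaceD(4)[OF X, symmetric]
        hilbert_spaceD(4)[OF Y, symmetric] hilbert_spaceD(6)[OF X] hilbert_spaceD(6)[OF Y] eq diff_self)
  then show ?thesis using kre_all_eq_0 by (metis right_minus_eq)
qed

lemma dense_in_hilbert:
  assumes X: "hilbert_space X" shows "dense_in X D \<longleftrightarrow> closure D = UNIV"
proof -
  have "dense_in X D \<longleftrightarrow> (\<forall>x. \<forall>\<epsilon>>0. \<exists>y\<in>D. dist y x < \<epsilon>)"
    by (simp add: dense_in_def hilbert_spaceD(1)[OF X] nrm_hilbert[OF X] dist_norm norm_minus_commute)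
  also have "\<dots> \<longleftrightarrow> closure D = UNIV" by (auto simp: closure_approachable set_eq_iff)
  finally show ?thesis .
qed

text \<open>
  Compatibility with the scalar multiplication, on a domain that it preserves. Together with real
  linearity it is linearity over the scalar field.
\<close>

definition sc_equivariant ::
  "('k, 'v::real_vector) kspace \<Rightarrow> ('k, 'w::real_vector) kspace \<Rightarrow> 'v set \<Rightarrow> ('v \<Rightarrow> 'w) \<Rightarrow> bool" where
  "sc_equivariant X Y D T \<longleftrightarrow> (\<forall>a. \<forall>x\<in>D. sc X a x \<in> D \<and> T (sc X a x) = sc Y a (T x))"

lemma sc_equivariantD:
  assumes "sc_equivariant X Y D T" "x \<in> D"
  shows "sc X a x \<in> D" "T (sc X a x) = sc Y a (T x)"
  using assms by (auto simp: sc_equivariant_def)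

lemma bops_hilbert:
  assumes X: "hilbert_space X" and Y: "hilbert_space Y"
  shows "T \<in> bops X Y \<longleftrightarrow> bounded_linear T \<and> (\<forall>a x. T (sc X a x) = sc Y a (T x))"
proof
  assume "T \<in> bops X Y"
  then have T: "\<And>x y. T (x + y) = T x + T y" "\<And>a x. T (sc X a x) = sc Y a (T x)"
    "\<exists>K. \<forall>x. norm (T x) \<le> K * norm x"
    by (auto simp: bops_def lin_on_def hilbert_spaceD(1)[OF X] nrm_hilbert[OF X] nrm_hilbert[OF Y])
  obtain K where K: "\<And>x. norm (T x) \<le> K * norm x" using T(3) by blast
  have "bounded_linear T"
  proof (rule bounded_linear_intro[OF T(1)])
    show "T (r *\<^sub>R x) = r *\<^sub>R T x" for r x
      using T(2)[of "of_real r" x] by (simp add: hilbert_spaceD(2)[OF X] hilbert_spaceD(2)[OF Y])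
    show "norm (T x) \<le> norm x * K" for x using K by (simp add: mult.commute)
  qed
  then show "bounded_linear T \<and> (\<forall>a x. T (sc X a x) = sc Y a (T x))" using T(2) by blast
next
  assume T: "bounded_linear T \<and> (\<forall>a x. T (sc X a x) = sc Y a (T x))"
  then interpret bounded_linear T by blast
  obtain K where "\<And>x. norm (T x) \<le> norm x * K" using bounded by blast
  then show "T \<in> bops X Y"
    using T by (auto simp: bops_def lin_on_def hilbert_spaceD(1)[OF X] hilbert_spaceD(1)[OF Y]
        nrm_hilbert[OF X] nrm_hilbert[OF Y] add mult.commute)
qed

lemma linear_on_graph:
  assumes X: "hilbert_space X" and T: "lin_operator X (op_graph D T)"
  shows "linear_map_on D T" "sc_equivariant X X D T"
proof -
  have 0: "0 \<in> D" and add: "\<And>x y. x \<in> D \<Longrightarrow> y \<in> D \<Longrightarrow> x + y \<in> D \<and> T (x + y) = T x + T y"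
    and sc: "\<And>a x. x \<in> D \<Longrightarrow> sc X a x \<in> D \<and> T (sc X a x) = sc X a (T x)"
    using T unfolding lin_operator_def op_graph_def by auto
  show "sc_equivariant X X D T" using sc by (simp add: sc_equivariant_def)
  have "r *\<^sub>R x \<in> D \<and> T (r *\<^sub>R x) = r *\<^sub>R T x" if "x \<in> D" for r x
    using sc[OF that, of "of_real r"] by (simp add: hilbert_spaceD(2)[OF X])
  then show "linear_map_on D T" using 0 add by (simp add: linear_map_on_def subspace_def)
qed

text \<open>
  The domain is closed under multiplication by scalars, so \<open>ip_eqI\<close> allows to work with the real
  scalar product only.
\<close>

lemma self_adjoint_selfadjoint:
  assumes X: "hilbert_space X" and T: "self_adjoint X (op_graph D T)"
  shows "selfadjoint D T" "sc_equivariant X X D T"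
proof -
  have lin: "lin_operator X (op_graph D T)" and dense: "dense_in X (Domain (op_graph D T))"
    and adj: "adj_graph X (op_graph D T) = op_graph D T"
    using T by (auto simp: self_adjoint_def)
  have Dom: "Domain (op_graph D T) = D" by (auto simp: op_graph_def)
  note l = linear_on_graph[OF X lin]
  show "sc_equivariant X X D T" by (rule l(2))
  have adj_iff: "(x, y) \<in> op_graph D T \<longleftrightarrow> (\<forall>u\<in>D. ip X x (T u) = ip X y u)" for x y
  proof -
    have "(x, y) \<in> op_graph D T \<longleftrightarrow> (x, y) \<in> adj_graph X (op_graph D T)" using adj by simp
    then show ?thesis by (auto simp: adj_graph_def op_graph_def hilbert_spaceD(1)[OF X])
  qed
  show "selfadjoint D T"
  proof
    show "linear_map_on D T" by (rule l(1))
    show "closure D = UNIV" using dense by (simp add: dense_in_hilbert[OF X] Dom)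
    show "T x \<bullet> y = x \<bullet> T y" if "x \<in> D" "y \<in> D" for x y
    proof -
      have "ip X x (T y) = ip X (T x) y"
        using adj_iff[of x "T x"] that by (auto simp: op_graph_def)
      then show ?thesis by (metis hilbert_spaceD(6)[OF X])
    qed
    show "x \<in> D \<and> T x = y" if "\<And>z. z \<in> D \<Longrightarrow> x \<bullet> T z = y \<bullet> z" for x y
    proof -
      have "ip X x (T u) = ip X y u" if u: "u \<in> D" for u
      proof (rule ip_eqI[OF X X])
        fix a show "x \<bullet> sc X a (T u) = y \<bullet> sc X a u"
          using \<open>\<And>z. z \<in> D \<Longrightarrow> x \<bullet> T z = y \<bullet> z\<close>[of "sc X a u"] sc_equivariantD[OF l(2) u, of a] by simp
      qed
      then have "(x, y) \<in> op_graph D T" using adj_iff by blast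
      then show ?thesis by (auto simp: op_graph_def)
    qed
  qed
qed

lemma skew_adjoint_skew:
  assumes X: "hilbert_space X" and T: "skew_adjoint X (op_graph D T)"
  shows "linear_map_on D T" "sc_equivariant X X D T"
    "\<And>x y. x \<in> D \<Longrightarrow> y \<in> D \<Longrightarrow> T x \<bullet> y = - (x \<bullet> T y)"
proof -
  have lin: "lin_operator X (op_graph D T)"
    and adj: "adj_graph X (op_graph D T) = (\<lambda>(x, y). (x, - y)) ` op_graph D T"
    using T by (auto simp: skew_adjoint_def)
  show "linear_map_on D T" "sc_equivariant X X D T" by (rule linear_on_graph[OF X lin])+
  show "T x \<bullet> y = - (x \<bullet> T y)" if "x \<in> D" "y \<in> D" for x y
  proof -
    have "(x, - T x) \<in> adj_graph X (op_graph D T)"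
      unfolding adj using \<open>x \<in> D\<close> by (force simp: op_graph_def)
    then have "ip X x (T y) = ip X (- T x) y"
      using \<open>y \<in> D\<close> by (auto simp: adj_graph_def op_graph_def)
    then have "x \<bullet> T y = (- T x) \<bullet> y" by (metis hilbert_spaceD(6)[OF X])
    then show ?thesis by simp
  qed
qed

lemma positive_op_iff:
  assumes X: "hilbert_space X"
  shows "positive_op X T \<longleftrightarrow> pos_symmetric T \<and> (\<forall>a x. T (sc X a x) = sc X a (T x))"
proof
  assume "positive_op X T"
  then have T: "T \<in> bops X X" "self_adjoint X (op_graph UNIV T)" "\<And>x. 0 \<le> T x \<bullet> x"
    by (auto simp: positive_op_def hilbert_spaceD(1)[OF X] hilbert_spaceD(6)[OF X])
  interpret selfadjoint UNIV T by (rule self_adjoint_selfadjoint[OF X T(2)])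
  show "pos_symmetric T \<and> (\<forall>a x. T (sc X a x) = sc X a (T x))"
    using T sym by (auto simp: pos_symmetric_def bops_hilbert[OF X X])
next
  assume T: "pos_symmetric T \<and> (\<forall>a x. T (sc X a x) = sc X a (T x))"
  then have lin: "bounded_linear T" and sym: "\<And>x y. T x \<bullet> y = x \<bullet> T y" and pos: "\<And>x. 0 \<le> T x \<bullet> x"
    and sc: "\<And>a x. T (sc X a x) = sc X a (T x)"
    unfolding pos_symmetric_def by blast+
  interpret bounded_linear T by (rule lin)
  have "lin_operator X (op_graph UNIV T)"
    by (auto simp: lin_operator_def op_graph_def hilbert_spaceD(1)[OF X] single_valued_def zero add sc)
  moreover have "adj_graph X (op_graph UNIV T) = op_graph UNIV T"
  proof -
    have "(\<forall>u. ip X x (T u) = ip X y u) \<longleftrightarrow> y = T x" for x y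
    proof
      assume "\<forall>u. ip X x (T u) = ip X y u"
      then have "x \<bullet> T u = y \<bullet> u" for u by (metis hilbert_spaceD(6)[OF X])
      then show "y = T x" by (intro vector_eq_rdot[THEN iffD1]) (simp add: sym)
    next
      assume "y = T x"
      then show "\<forall>u. ip X x (T u) = ip X y u"
        by (intro allI ip_eqI[OF X X]) (simp add: sym sc)
    qed
    then show ?thesis by (auto simp: adj_graph_def op_graph_def hilbert_spaceD(1)[OF X])
  qed
  moreover have "Domain (op_graph UNIV T) = UNIV" by (auto simp: op_graph_def)
  ultimately show "positive_op X T"
    using lin sc pos by (simp add: positive_op_def self_adjoint_def bops_hilbert[OF X X]
        hilbert_spaceD(1)[OF X] hilbert_spaceD(6)[OF X] dense_in_hilbert[OF X])
qed

context selfadjoint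
begin

lemma S_sc:
  assumes X: "hilbert_space X" and B: "sc_equivariant X X D B"
  shows "S (sc X a x) = sc X a (S x)"
proof (rule S_root(3)[symmetric])
  show "bounded_linear (sc X a)" by (rule sc_bounded_linear[OF X])
  fix x
  have d: "P x \<in> D" "B (P x) \<in> D" using P_solves(1)[of x] by (auto simp: D2_def)
  note s = sc_equivariantD[OF B]
  have "P (sc X a x) = sc X a (P x)"
  proof (rule P_eqI)
    show "sc X a (P x) \<in> D2" using d s by (simp add: D2_def)
    show "B (B (sc X a (P x))) + sc X a (P x) = sc X a x"
      using d s P_solves(2)[of x] hilbert_spaceD(7)[OF X] by metis
  qed
  then show "sc X a (P x) = P (sc X a x)" by simp
qed

lemma pos_sqrt_P:
  assumes X: "hilbert_space X" and B: "sc_equivariant X X D B"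
  shows "pos_sqrt X P = S"
  unfolding pos_sqrt_def
proof (rule the_equality)
  show "positive_op X S \<and> S \<circ> S = P"
    using S_root(1,2) S_sc[OF X B] by (auto simp: positive_op_iff[OF X])
  show "Q = S" if "positive_op X Q \<and> Q \<circ> Q = P" for Q
    using that by (intro S_unique) (auto simp: positive_op_iff[OF X] fun_eq_iff)
qed

end

text \<open>
  The target may carry a norm stronger than the one of its type. An extension bounded for the
  stronger norm is continuous for the weaker one, hence determined by its values on a dense set.
\<close>

lemma bdd_ext_eqI:
  assumes X: "hilbert_space X" and dense: "closure (e ` D) = UNIV"
    and T: "T \<in> bops X Y" and agree: "\<And>x. x \<in> D \<Longrightarrow> T (e x) = f x"
    and Y: "\<And>r z. sc Y (of_real r) z = r *\<^sub>R z" "\<And>z. z \<in> carrier Y \<Longrightarrow> norm z \<le> nrm Y z"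
  shows "bdd_ext X Y e D f = T"
  unfolding bdd_ext_def
proof (rule the_equality)
  have bl: "bounded_linear T'" if T': "T' \<in> bops X Y" for T'
  proof -
    obtain K where K: "\<And>x. T' x \<in> carrier Y" "\<And>x. nrm Y (T' x) \<le> K * norm x"
      using T' by (auto simp: bops_def hilbert_spaceD(1)[OF X] nrm_hilbert[OF X])
    have lin: "\<And>x y. T' (x + y) = T' x + T' y" "\<And>a x. T' (sc X a x) = sc Y a (T' x)"
      using T' by (auto simp: bops_def lin_on_def hilbert_spaceD(1)[OF X])
    show ?thesis
    proof (rule bounded_linear_intro[OF lin(1)])
      show "T' (r *\<^sub>R x) = r *\<^sub>R T' x" for r x
        using lin(2)[of "of_real r" x] by (simp add: hilbert_spaceD(2)[OF X] Y(1))
      show "norm (T' x) \<le> norm x * K" for x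
        using order_trans[OF Y(2)[OF K(1)] K(2)] by (simp add: mult.commute)
    qed
  qed
  show "T \<in> bops X Y \<and> (\<forall>x\<in>D. T (e x) = f x)" using T agree by blast
  fix T' assume T': "T' \<in> bops X Y \<and> (\<forall>x\<in>D. T' (e x) = f x)"
  show "T' = T"
  proof
    fix x show "T' x = T x"
      by (rule continuous_eq_on_dense[OF dense, of T' T])
        (use T' T agree bl in \<open>auto intro: linear_continuous_on\<close>)
  qed
qed

lemma bdd_ext_hilbert:
  assumes X: "hilbert_space X" and Y: "hilbert_space Y"
    and e: "linear_map_on D e" "sc_equivariant Z X D e"
    and f: "linear_map_on D f" "sc_equivariant Z Y D f"
    and dense: "closure (e ` D) = UNIV"
    and bound: "\<And>x. x \<in> D \<Longrightarrow> norm (f x) \<le> K * norm (e x)"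
  shows "bounded_linear (bdd_ext X Y e D f)"
    "\<And>x. x \<in> D \<Longrightarrow> bdd_ext X Y e D f (e x) = f x"
    "\<And>v. norm (bdd_ext X Y e D f v) \<le> K * norm v"
    "\<And>a v. bdd_ext X Y e D f (sc X a v) = sc Y a (bdd_ext X Y e D f v)"
proof -
  obtain T where T: "bounded_linear T" "\<And>x. x \<in> D \<Longrightarrow> T (e x) = f x" "\<And>v. norm (T v) \<le> K * norm v"
    using bounded_extension[OF e(1) f(1) dense bound] by blast
  have sc: "T (sc X a v) = sc Y a (T v)" for a v
  proof (rule continuous_eq_on_dense[OF dense, of "\<lambda>v. T (sc X a v)" "\<lambda>v. sc Y a (T v)"])
    show "continuous_on UNIV (\<lambda>v. T (sc X a v))" "continuous_on UNIV (\<lambda>v. sc Y a (T v))"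
      by (intro linear_continuous_on bounded_linear_compose[OF T(1)] sc_bounded_linear X
          bounded_linear_compose[OF sc_bounded_linear[OF Y]] T(1))+
    fix s assume "s \<in> e ` D"
    then obtain x where x: "x \<in> D" "s = e x" by blast
    then show "T (sc X a s) = sc Y a (T s)"
      using T(2)[OF x(1)] T(2)[OF sc_equivariantD(1)[OF e(2) x(1)], of a]
        sc_equivariantD(2)[OF e(2) x(1), of a] sc_equivariantD(2)[OF f(2) x(1), of a] by simp
  qed
  have "bdd_ext X Y e D f = T"
    using T(1,2) sc by (intro bdd_ext_eqI[OF X dense])
      (auto simp: bops_hilbert[OF X Y] hilbert_spaceD(2)[OF Y] nrm_hilbert[OF Y])
  then show "bounded_linear (bdd_ext X Y e D f)"
    "\<And>x. x \<in> D \<Longrightarrow> bdd_ext X Y e D f (e x) = f x"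
    "\<And>v. norm (bdd_ext X Y e D f v) \<le> K * norm v"
    "\<And>a v. bdd_ext X Y e D f (sc X a v) = sc Y a (bdd_ext X Y e D f v)"
    using T sc by auto
qed

lemma hadj_eqI:
  assumes X: "hilbert_space X" and Y: "hilbert_space Y"
    and sc: "\<And>a u. T (sc X a u) = sc Y a (T u)" and eq: "\<And>u. x \<bullet> u = y \<bullet> T u"
  shows "hadj X Y T y = x"
  unfolding hadj_def
proof (rule the_equality)
  show "x \<in> carrier X \<and> (\<forall>u\<in>carrier X. ip X x u = ip Y y (T u))"
  proof (intro conjI ballI ip_eqI[OF X Y])
    show "x \<bullet> sc X a u = y \<bullet> sc Y a (T u)" for a u using eq[of "sc X a u"] by (simp only: sc)
  qed (simp add: hilbert_spaceD(1)[OF X])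
  fix x' assume "x' \<in> carrier X \<and> (\<forall>u\<in>carrier X. ip X x' u = ip Y y (T u))"
  then have "x' \<bullet> u = x \<bullet> u" for u
    by (metis UNIV_I eq hilbert_spaceD(1)[OF X] hilbert_spaceD(6)[OF X] hilbert_spaceD(6)[OF Y])
  then show "x' = x" by (intro vector_eq_rdot[THEN iffD1]) blast
qed

section \<open>Skew-adjointness and resolvents in incomplete spaces\<close>

text \<open>
  The structure of $\bar{\mathcal H}_1\oplus\mathcal H_0\oplus\mathfrak h_\Theta$, where the norm
  of $\mathfrak h_\Theta$ may be incomplete.
\<close>

definition inner_space :: "('k::rc_scalar, 'v::real_vector) kspace \<Rightarrow> bool" where
  "inner_space X \<longleftrightarrow> carrier X = UNIV \<and>
     (\<forall>r x. sc X (of_real r) x = r *\<^sub>R x) \<and>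
     (\<forall>x y z. ip X x (y + z) = ip X x y + ip X x z) \<and>
     (\<forall>a x y. ip X x (sc X a y) = a * ip X x y) \<and>
     (\<forall>x y. ip X y x = kconj (ip X x y)) \<and>
     (\<forall>x. 0 \<le> kre (ip X x x)) \<and> (\<forall>x. kre (ip X x x) = 0 \<longrightarrow> x = 0)"

lemma inner_spaceD:
  assumes "inner_space X"
  shows "carrier X = UNIV" "sc X (of_real r) x = r *\<^sub>R x" "ip X x (y + z) = ip X x y + ip X x z"
    "ip X x (sc X a y) = a * ip X x y" "ip X y x = kconj (ip X x y)"
    "0 \<le> kre (ip X x x)" "kre (ip X x x) = 0 \<Longrightarrow> x = 0"
  using assms unfolding inner_space_def by iprover+

lemma inner_space_kre:
  assumes X: "inner_space X"
  shows "kre (ip X x (y + z)) = kre (ip X x y) + kre (ip X x z)"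
    "kre (ip X (y + z) x) = kre (ip X y x) + kre (ip X z x)"
    "kre (ip X x (r *\<^sub>R y)) = r * kre (ip X x y)" "kre (ip X (r *\<^sub>R y) x) = r * kre (ip X y x)"
    "kre (ip X y x) = kre (ip X x y)"
    "kre (ip X x (- y)) = - kre (ip X x y)" "kre (ip X (- y) x) = - kre (ip X y x)"
    "kre (ip X x (y - z)) = kre (ip X x y) - kre (ip X x z)"
    "kre (ip X (y - z) x) = kre (ip X y x) - kre (ip X z x)"
proof -
  note h = inner_spaceD[OF X]
  show c: "kre (ip X y x) = kre (ip X x y)" for x y by (subst h(5)) simp
  show a: "kre (ip X x (y + z)) = kre (ip X x y) + kre (ip X x z)" for x y z by (simp add: h(3))
  show s: "kre (ip X x (r *\<^sub>R y)) = r * kre (ip X x y)" for r x y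
  proof -
    have "ip X x (r *\<^sub>R y) = of_real r * ip X x y"
      using h(4)[of x "of_real r" y] unfolding h(2) .
    then show ?thesis by (simp flip: scaleR_conv_of_real)
  qed
  show "kre (ip X (y + z) x) = kre (ip X y x) + kre (ip X z x)"
    using a[of x y z] unfolding c[of x "y + z"] c[of x y] c[of x z] .
  show "kre (ip X (r *\<^sub>R y) x) = r * kre (ip X y x)"
    using s[of x r y] unfolding c[of x "r *\<^sub>R y"] c[of x y] .
  show m: "kre (ip X x (- y)) = - kre (ip X x y)" for x y using s[of x "-1" y] by simp
  show "kre (ip X (- y) x) = - kre (ip X y x)"
    using m[of x y] unfolding c[of x "- y"] c[of x y] .
  show d: "kre (ip X x (y - z)) = kre (ip X x y) - kre (ip X x z)" for x y z
    using a[of x y "- z"] m[of x z] by simp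
  show "kre (ip X (y - z) x) = kre (ip X y x) - kre (ip X z x)"
    using d[of x y z] unfolding c[of x "y - z"] c[of x y] c[of x z] .
qed

lemma inner_space_nrm:
  assumes X: "inner_space X" shows "0 \<le> nrm X x" "(nrm X x)\<^sup>2 = kre (ip X x x)"
  using inner_spaceD(6)[OF X] by (simp_all add: nrm_def)

text \<open>
  For a skew-symmetric relation that is onto after adding a multiple of the identity, the inverse
  is automatically a bounded operator, because $\|\lambda u-v\|^2=\lambda^2\|u\|^2+\|v\|^2$.
\<close>

lemma in_resolvent_setI:
  assumes X: "inner_space X"
    and add: "\<And>x y x' y'. (x, y) \<in> T \<Longrightarrow> (x', y') \<in> T \<Longrightarrow> (x + x', y + y') \<in> T"
    and sc: "\<And>a x y. (x, y) \<in> T \<Longrightarrow> (sc X a x, sc X a y) \<in> T"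
    and sc_lin: "\<And>a x y. sc X a (x + y) = sc X a x + sc X a y"
    and skew: "\<And>x y. (x, y) \<in> T \<Longrightarrow> kre (ip X x y) = 0"
    and l: "l \<noteq> 0" and surj: "\<And>f. \<exists>u v. (u, v) \<in> T \<and> l *\<^sub>R u - v = f"
  shows "in_resolvent_set X T l"
    and "(u, v) \<in> T \<Longrightarrow> resolvent T l (l *\<^sub>R u - v) = u"
proof -
  note h = inner_spaceD[OF X] and k = inner_space_kre[OF X]
  have neg: "(- x, - y) \<in> T" if "(x, y) \<in> T" for x y
    using sc[OF that, of "of_real (-1)"] by (simp only: h(2)) simp
  have scR: "sc X a (r *\<^sub>R x) = r *\<^sub>R sc X a x" for a r x
  proof -
    have "kre (ip X z (sc X a (r *\<^sub>R x) - r *\<^sub>R sc X a x)) = 0" for z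
    proof -
      have "kre (ip X z (sc X a (r *\<^sub>R x))) = kre (a * (of_real r * ip X z x))"
        using h(4)[of z "of_real r" x] by (simp add: h(2) h(4))
      also have "\<dots> = r * kre (ip X z (sc X a x))" by (simp add: h(4) flip: scaleR_conv_of_real)
      finally show ?thesis by (simp add: k(3,8))
    qed
    then show ?thesis using h(7) by (metis right_minus_eq)
  qed
  have energy: "(l * nrm X u)\<^sup>2 \<le> (nrm X (l *\<^sub>R u - v))\<^sup>2" if "(u, v) \<in> T" for u v
  proof -
    have "kre (ip X (l *\<^sub>R u - v) (l *\<^sub>R u - v)) = l\<^sup>2 * kre (ip X u u) + kre (ip X v v)"
      using skew[OF that] k(5)[of v u] by (simp add: k(3,4,8,9) power2_eq_square)
    then show ?thesis using h(6)[of v] by (simp add: inner_space_nrm[OF X] power_mult_distrib)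
  qed
  have uniq: "u = u'" if "(u, v) \<in> T" "(u', v') \<in> T" "l *\<^sub>R u - v = l *\<^sub>R u' - v'" for u v u' v'
  proof -
    have "(u - u', v - v') \<in> T" using add[OF that(1) neg[OF that(2)]] by simp
    from energy[OF this] have "(l * nrm X (u - u'))\<^sup>2 \<le> (nrm X (0::'b))\<^sup>2"
      using that(3) by (simp add: algebra_simps)
    also have "\<dots> = 0" using k(3)[of 0 0 0] by (simp add: inner_space_nrm[OF X])
    finally have "kre (ip X (u - u') (u - u')) = 0" using l by (simp add: flip: inner_space_nrm(2)[OF X])
    then show "u = u'" using h(7) by fastforce
  qed
  obtain R V where RV: "\<And>f. (R f, V f) \<in> T \<and> l *\<^sub>R R f - V f = f" using surj by metis
  have R_eq: "R (l *\<^sub>R u - v) = u" if "(u, v) \<in> T" for u v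
    using uniq[OF _ that] RV by blast
  have Radd: "R (f + g) = R f + R g" for f g
    using R_eq[OF add[OF conjunct1[OF RV] conjunct1[OF RV], of f g]] RV[of f] RV[of g]
    by (simp add: algebra_simps)
  have Rsc: "R (sc X a f) = sc X a (R f)" for a f
  proof -
    have "sc X a (- x) = - sc X a x" for x using scR[of a "-1" x] by simp
    then have "l *\<^sub>R sc X a (R f) - sc X a (V f) = sc X a (l *\<^sub>R R f - V f)"
      using sc_lin[of a "l *\<^sub>R R f" "- V f"] by (simp add: scR)
    then show ?thesis using R_eq[OF sc[OF conjunct1[OF RV], of a f]] RV[of f] by simp
  qed
  have "nrm X (R f) \<le> 1 / \<bar>l\<bar> * nrm X f" for f
  proof -
    have "(\<bar>l\<bar> * nrm X (R f))\<^sup>2 \<le> (nrm X f)\<^sup>2"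
      using energy[OF conjunct1[OF RV], of f] RV[of f] by (simp add: power_mult_distrib)
    then have "\<bar>l\<bar> * nrm X (R f) \<le> nrm X f"
      by (rule power2_le_imp_le) (rule inner_space_nrm(1)[OF X])
    then show ?thesis using l by (simp add: field_simps)
  qed
  then have "\<exists>K. \<forall>f. nrm X (R f) \<le> K * nrm X f" by blast
  then have "R \<in> bops X X" using Radd Rsc by (auto simp: bops_def lin_on_def h(1))
  moreover have "(minus_plus T l)\<inverse> = op_graph (carrier X) R"
  proof -
    have "(f, u) \<in> (minus_plus T l)\<inverse> \<longleftrightarrow> (f, u) \<in> op_graph (carrier X) R" for f u
    proof
      assume "(f, u) \<in> (minus_plus T l)\<inverse>"
      then obtain v where "(u, v) \<in> T" "f = - v + l *\<^sub>R u" by (auto simp: minus_plus_def)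
      then show "(f, u) \<in> op_graph (carrier X) R" using R_eq by (simp add: op_graph_def h(1))
    next
      assume "(f, u) \<in> op_graph (carrier X) R"
      then have "u = R f" by (simp add: op_graph_def)
      then show "(f, u) \<in> (minus_plus T l)\<inverse>" using RV[of f]
        unfolding minus_plus_def by (auto intro!: exI[of _ "V f"] simp: algebra_simps)
    qed
    then show ?thesis by auto
  qed
  ultimately show "in_resolvent_set X T l" unfolding in_resolvent_set_def by blast
  assume uv: "(u, v) \<in> T"
  show "resolvent T l (l *\<^sub>R u - v) = u"
    unfolding resolvent_def
  proof (rule the_equality)
    show "(u, l *\<^sub>R u - v) \<in> minus_plus T l" using uv by (auto simp: minus_plus_def algebra_simps)
    fix x assume "(x, l *\<^sub>R u - v) \<in> minus_plus T l"
    then obtain y where "(x, y) \<in> T" "l *\<^sub>R x - y = l *\<^sub>R u - v" by (auto simp: minus_plus_def)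
    then show "x = u" using uniq uv by blast
  qed
qed

text \<open>
  If \<open>(x, y)\<close> is in the adjoint, subtract the element \<open>(u0, v0)\<close> of \<open>T\<close> with
  \<open>l u0 - v0 = y + l x\<close>; the difference \<open>x - u0\<close> is orthogonal to the range of \<open>l + T\<close>, which is
  the whole space.
\<close>

lemma skew_adjointI:
  assumes X: "inner_space X" and T: "lin_operator X T" and dense: "dense_in X (Domain T)"
    and skew: "\<And>x y x' y'. (x, y) \<in> T \<Longrightarrow> (x', y') \<in> T \<Longrightarrow> kre (ip X x y') = - kre (ip X y x')"
    and surj1: "\<And>f. \<exists>u v. (u, v) \<in> T \<and> l *\<^sub>R u - v = f"
    and surj2: "\<And>f. \<exists>u v. (u, v) \<in> T \<and> (- l) *\<^sub>R u - v = f"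
  shows "skew_adjoint X T"
proof -
  note h = inner_spaceD[OF X] and k = inner_space_kre[OF X]
  have sc: "(x, y) \<in> T \<Longrightarrow> (sc X a x, sc X a y) \<in> T" for a x y
    using T unfolding lin_operator_def by blast
  have "adj_graph X T = (\<lambda>(x, y). (x, - y)) ` T"
  proof (intro equalityI subrelI)
    fix x y assume "(x, y) \<in> adj_graph X T"
    then have xy: "kre (ip X x v) = kre (ip X y u)" if "(u, v) \<in> T" for u v
      using that by (auto simp: adj_graph_def)
    obtain u0 v0 where u0: "(u0, v0) \<in> T" "l *\<^sub>R u0 - v0 = y + l *\<^sub>R x" using surj1 by blast
    define x' where "x' = x - u0"
    obtain u v where uv: "(u, v) \<in> T" "(- l) *\<^sub>R u - v = - x'" using surj2 by blast
    have v: "v = x' - l *\<^sub>R u" using uv(2) by (simp add: algebra_simps)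
    have "y = l *\<^sub>R u0 - v0 - l *\<^sub>R x" using u0(2) by (simp add: algebra_simps)
    then have y: "y = - (l *\<^sub>R x') - v0" by (simp add: x'_def algebra_simps)
    have "kre (ip X x' v) = kre (ip X y u) - kre (ip X u0 v)"
      using xy[OF uv(1)] by (simp add: x'_def k)
    also have "\<dots> = kre (ip X (y + v0) u)" using skew[OF u0(1) uv(1)] by (simp add: k(2))
    also have "\<dots> = - l * kre (ip X x' u)" by (simp add: y k(4,7))
    finally have "kre (ip X x' x') = 0" by (simp add: v k(3,8))
    then have "x' = 0" by (rule h(7))
    then have "x = u0" "y = - v0" by (simp_all add: y x'_def)
    then show "(x, y) \<in> (\<lambda>(x, y). (x, - y)) ` T" using u0(1) by force
  next
    fix x y assume "(x, y) \<in> (\<lambda>(x, y). (x, - y)) ` T"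
    then have xy: "(x, - y) \<in> T" by auto
    have "ip X x v = ip X y u" if uv: "(u, v) \<in> T" for u v
    proof -
      have "kre (a * (ip X x v - ip X y u)) = 0" for a
        using skew[OF xy sc[OF uv], of a]
        by (simp add: right_diff_distrib k(7) flip: h(4))
      then show ?thesis using kre_all_eq_0 by (metis right_minus_eq)
    qed
    then show "(x, y) \<in> adj_graph X T" by (auto simp: adj_graph_def h(1))
  qed
  then show ?thesis using T dense by (simp add: skew_adjoint_def)
qed

section \<open>The wave data in transported form\<close>

lemma completion_ofD:
  assumes "completion_of P X e"
  shows "hilbert_space X" "lin_on P X e"
    "\<And>x y. x \<in> carrier P \<Longrightarrow> y \<in> carrier P \<Longrightarrow> ip X (e x) (e y) = ip P x y"
    "closure (e ` carrier P) = UNIV"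
  using assms dense_in_hilbert[of X] by (auto simp: completion_of_def)

lemma lin_on_linear_map_on:
  assumes "lin_on P Y f" "subspace (carrier P)"
    and "\<And>r x. sc P (of_real r) x = r *\<^sub>R x" "\<And>r x. sc Y (of_real r) x = r *\<^sub>R x"
  shows "linear_map_on (carrier P) f"
  using assms by (auto simp: linear_map_on_def lin_on_def) (metis assms(3,4))

locale wave =
  fixes d :: "('k::rc_scalar, 'h::{real_inner, complete_space}, 'b::{real_inner, complete_space},
    'p::{real_inner, complete_space}, 'q::{real_inner, complete_space},
    'a::{real_inner, complete_space}) wave_data"
  assumes setting: "wave_setting d"
    and tau_adj_inj: "inj (tau_adj d)"
    and H3_0: "{tau d x - Theta d \<zeta> | x \<zeta>. x \<in> carrier (Hbar d 2)} = UNIV"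
    and H3_1: "range (tau_adj d) \<inter> range (incl_neg d) = {0}"
    and H4_1: "\<exists>c. \<forall>x\<in>domB d. norm (opC d x) \<le> c * norm (opB d x)"
    and H4_2: "\<forall>x\<in>domBpow d 2. opC d x \<in> domB d \<and> opB d (opC d x) = opC d (opB d x)"
    and H4_3: "\<forall>\<mu>. \<mu> \<noteq> 0 \<longrightarrow> range (\<lambda>\<zeta>. Cbar_adj d (Gop d \<mu> \<zeta>)) \<subseteq> dom_taubar d"
begin

abbreviation B where "B \<equiv> opB d"
abbreviation D where "D \<equiv> domB d"
abbreviation C where "C \<equiv> opC d"
abbreviation U where "U \<equiv> Bbar d"
abbreviation V where "V \<equiv> Bbar_inv d"

lemma settingD:
  "hilbert_space (H0 d)" "self_adjoint (H0 d) (op_graph D B)"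
  "\<And>x. x \<in> D \<Longrightarrow> B x = 0 \<Longrightarrow> x = 0"
  "completion_of (preHbar1 d) (Hbar1 d) (emb1 d)"
  "completion_of (preHneg d 1) (Hm1 d) (embm1 d)"
  "completion_of (preHneg d 2) (Hm2 d) (embm2 d)"
  "hilbert_space (haux d)" "positive_op (haux d) (Theta d)" "inj (Theta d)"
  "tau d \<in> bops (Hbar d 2) (haux d)"
  "skew_adjoint (H0 d) (op_graph D C)"
  "\<And>\<nu>. \<nu> > 0 \<Longrightarrow> self_adjoint (H0 d) (op_graph UNIV (Jreg d \<nu>))"
  "\<And>\<nu> k. \<nu> > 0 \<Longrightarrow> Jreg d \<nu> \<in> bops (Hpos d k) (Hpos d (Suc k))"
  "\<And>\<nu> x. \<nu> > 0 \<Longrightarrow> x \<in> D \<Longrightarrow> Jreg d \<nu> (B x) = B (Jreg d \<nu> x)"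
  "\<And>\<nu> x. \<nu> > 0 \<Longrightarrow> x \<in> D \<Longrightarrow> Jreg d \<nu> (C x) = C (Jreg d \<nu> x)"
  "\<And>x. ((\<lambda>\<nu>. norm (Jreg d \<nu> x - x)) \<longlongrightarrow> 0) (at_right 0)"
  using setting unfolding wave_setting_def by (elim conjE; (assumption | simp))+

lemmas hH0 = settingD(1) and hh = settingD(7)
lemmas hHb = completion_ofD(1)[OF settingD(4)]
lemmas H0D = hilbert_spaceD[OF hH0] and HbD = hilbert_spaceD[OF hHb] and hD = hilbert_spaceD[OF hh]
lemmas hHm1 = completion_ofD(1)[OF settingD(5)] and hHm2 = completion_ofD(1)[OF settingD(6)]

lemmas B_sc = self_adjoint_selfadjoint(2)[OF hH0 settingD(2)]
lemmas C_skew = skew_adjoint_skew[OF hH0 settingD(11)]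

sublocale B1: injective_selfadjoint D B
proof -
  interpret selfadjoint D B by (rule self_adjoint_selfadjoint(1)[OF hH0 settingD(2)])
  show "injective_selfadjoint D B" by unfold_locales (rule settingD(3))
qed

sublocale B2: selfadjoint B1.D2 "\<lambda>x. B (B x)" by (rule B1.selfadjoint_square)

lemma domBpow_simps: "domBpow d 1 = D" "domBpow d (Suc 0) = D" "domBpow d 2 = B1.D2"
  by (auto simp: numeral_2_eq_2 B1.D2_def)

lemma domBpow_4: "domBpow d 4 = B2.D2"
  unfolding B2.D2_def by (auto simp: eval_nat_numeral B1.D2_def)

lemma B2_sc: "sc_equivariant (H0 d) (H0 d) B1.D2 (\<lambda>x. B (B x))"
  using B_sc by (auto simp: sc_equivariant_def B1.D2_def)

subsection \<open>The isometry between the completed domain and the base space\<close>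

lemma emb:
  "linear_map_on D (emb1 d)" "sc_equivariant (H0 d) (Hbar1 d) D (emb1 d)"
  "closure (emb1 d ` D) = UNIV" "\<And>x. x \<in> D \<Longrightarrow> norm (emb1 d x) = norm (B x)"
proof -
  note c = completion_ofD[OF settingD(4)]
  have car: "carrier (preHbar1 d) = D" "sc (preHbar1 d) = sc (H0 d)" by (simp_all add: preHbar1_def)
  show "linear_map_on D (emb1 d)"
    using lin_on_linear_map_on[OF c(2)] B1.sub by (simp add: car H0D(2) HbD(2))
  show "sc_equivariant (H0 d) (Hbar1 d) D (emb1 d)"
    using c(2) B_sc by (auto simp: sc_equivariant_def lin_on_def car)
  show "closure (emb1 d ` D) = UNIV" using c(4) by (simp add: car)
  show "norm (emb1 d x) = norm (B x)" if "x \<in> D" for x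
  proof -
    have "ip (Hbar1 d) (emb1 d x) (emb1 d x) = ip (H0 d) (B x) (B x)"
      using c(3)[of x x] that by (simp add: car) (simp add: preHbar1_def)
    then have "emb1 d x \<bullet> emb1 d x = B x \<bullet> B x" by (metis HbD(6) H0D(6))
    then show ?thesis by (simp add: norm_eq_sqrt_inner)
  qed
qed

lemma
  shows U_lin: "bounded_linear U" and U_emb: "\<And>x. x \<in> D \<Longrightarrow> U (emb1 d x) = B x"
    and U_sc: "\<And>a v. U (sc (Hbar1 d) a v) = sc (H0 d) a (U v)"
  using bdd_ext_hilbert(1,2,4)[OF hHb hH0 emb(1,2) B1.lin B_sc emb(3), of 1, folded Bbar_def]
  by (auto simp: emb(4))

lemmas U_simps = linear_simps[OF U_lin]

text \<open>
  The operator $\bar B$ is unitary from the completion onto the base space: it is isometric on the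
  image of \<open>D\<close>, and the range of \<open>B\<close> is dense.
\<close>

lemma norm_U: "norm (U v) = norm v"
  by (rule continuous_eq_on_dense[OF emb(3), of "\<lambda>v. norm (U v)" norm])
    (auto intro!: continuous_intros linear_continuous_on[OF U_lin] simp: U_emb emb(4))

lemma inner_U: "U v \<bullet> U v' = v \<bullet> v'"
  using norm_U[of "v + v'"] by (simp add: dot_norm norm_U U_simps)

lemma U_surj: "\<exists>v. U v = f"
proof -
  have "f \<in> closure (B ` D)" using B1.range_B_dense by simp
  then obtain s where s: "\<And>n. s n \<in> B ` D" "s \<longlonglongrightarrow> f" by (auto simp: closure_sequential)
  then have "\<forall>n. \<exists>x\<in>D. s n = B x" by blast
  then obtain x where x: "\<And>n. x n \<in> D" "\<And>n. s n = B (x n)" by metis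
  have "dist (emb1 d (x m)) (emb1 d (x n)) = dist (s m) (s n)" for m n
    using emb(4)[of "x m - x n"] x linear_map_onD(6)[OF emb(1) x(1) x(1), of m n] B1.B_simps(5)[OF x(1) x(1), of m n]
    by (simp add: dist_norm)
  then obtain v where "(\<lambda>n. emb1 d (x n)) \<longlonglongrightarrow> v"
    using convergent_if_dist_le[OF LIMSEQ_imp_Cauchy[OF s(2)], of "\<lambda>n. emb1 d (x n)" 1] by auto
  then have "(\<lambda>n. U (emb1 d (x n))) \<longlonglongrightarrow> U v" by (rule bounded_linear.tendsto[OF U_lin])
  moreover have "(\<lambda>n. U (emb1 d (x n))) = s" using x by (auto simp: U_emb)
  ultimately have "s \<longlonglongrightarrow> U v" by simp
  then show ?thesis using LIMSEQ_unique s(2) by blast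
qed

lemma U_inj: "U v = U v' \<Longrightarrow> v = v'"
  using norm_U[of "v - v'"] by (simp add: U_simps)

lemma UV [simp]: "U (V y) = y" and VU [simp]: "V (U v) = v"
proof -
  have "surj U" using U_surj unfolding surj_def by metis
  then show UV: "U (V y) = y" for y unfolding Bbar_inv_def by (rule surj_f_inv_f)
  show "V (U v) = v" by (rule U_inj) (rule UV)
qed

lemma V_eq_iff: "V y = v \<longleftrightarrow> y = U v" by auto

lemma V_simps: "V (x + y) = V x + V y" "V (x - y) = V x - V y" "V (- x) = - V x"
  "V (r *\<^sub>R x) = r *\<^sub>R V x" "V (sc (H0 d) a x) = sc (Hbar1 d) a (V x)"
  by (simp_all add: V_eq_iff U_simps U_sc)

lemma V_B: "x \<in> D \<Longrightarrow> V (B x) = emb1 d x" by (simp add: V_eq_iff U_emb)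

lemma inner_V: "V y \<bullet> v = y \<bullet> U v" using inner_U[of "V y" v] by simp

subsection \<open>The damping, the trace and the regularization on the base space\<close>

text \<open>
  The bounded operator $CB^{-1}$. The completed damping is \<open>K \<circ> U\<close>.
\<close>

definition K :: "'h \<Rightarrow> 'h" where "K = bdd_ext (H0 d) (H0 d) B D C"

lemma
  shows K_lin: "bounded_linear K" and K_B: "\<And>x. x \<in> D \<Longrightarrow> K (B x) = C x"
    and K_sc: "\<And>a v. K (sc (H0 d) a v) = sc (H0 d) a (K v)"
proof -
  obtain c where c: "\<And>x. x \<in> D \<Longrightarrow> norm (C x) \<le> c * norm (B x)" using H4_1 by blast
  note * = bdd_ext_hilbert[OF hH0 hH0 B1.lin B_sc C_skew(1,2) B1.range_B_dense, of c, OF c, folded K_def]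
  show "bounded_linear K" "\<And>x. x \<in> D \<Longrightarrow> K (B x) = C x"
    "\<And>a v. K (sc (H0 d) a v) = sc (H0 d) a (K v)"
    using *(1,2,4) by auto
qed

text \<open>
  On \<open>B x\<close> with \<open>x\<close> in the domain of \<open>B\<^sup>2\<close> this is the skew-symmetry of \<open>C\<close> together with its
  commutation with \<open>B\<close>.
\<close>

lemma K_skew: "K x \<bullet> y = - (x \<bullet> K y)"
proof -
  have dense2: "closure (B ` B1.D2) = UNIV"
  proof (rule closure_subspace_eq_UNIV)
    have "linear_map_on B1.D2 B"
      using linear_map_onD(1)[OF B1.square_linear] by (auto simp: linear_map_on_def B1.B_simps B1.D2D(1))
    then show "subspace (B ` B1.D2)" by (rule subspace_linear_map_on_image)
    show "z = 0" if "\<And>s. s \<in> B ` B1.D2 \<Longrightarrow> z \<bullet> s = 0" for z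
      using that by (intro B1.orthogonal_to_B_D2) auto
  qed
  have 1: "K (B p) \<bullet> B q = - (B p \<bullet> K (B q))" if p: "p \<in> B1.D2" and q: "q \<in> D" for p q
  proof -
    note pD = B1.D2D[OF p]
    have Cp: "C p \<in> D" "B (C p) = C (B p)" using H4_2 p by (auto simp: domBpow_simps)
    have "C p \<bullet> B q = C (B p) \<bullet> q" using B1.sym[OF Cp(1) q] Cp(2) by simp
    also have "\<dots> = - (B p \<bullet> C q)" by (rule C_skew(3)[OF pD(2) q])
    finally show ?thesis using pD q by (simp add: K_B)
  qed
  have 2: "K x \<bullet> B q = - (x \<bullet> K (B q))" if q: "q \<in> D" for x q
    by (rule continuous_eq_on_dense[OF dense2, of "\<lambda>x. K x \<bullet> B q" "\<lambda>x. - (x \<bullet> K (B q))"])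
      (use 1 q in \<open>auto intro!: continuous_intros linear_continuous_on[OF K_lin]\<close>)
  show ?thesis
    by (rule continuous_eq_on_dense[OF B1.range_B_dense, of "\<lambda>y. K x \<bullet> y" "\<lambda>y. - (x \<bullet> K y)"])
      (use 2 in \<open>auto intro!: continuous_intros linear_continuous_on[OF K_lin]\<close>)
qed

lemma K_D: "x \<in> D \<Longrightarrow> K x \<in> D" and BK: "x \<in> D \<Longrightarrow> B (K x) = K (B x)"
proof -
  have "K x \<in> D \<and> B (K x) = C x" if x: "x \<in> D"
  proof (rule B1.maximal)
    fix z assume z: "z \<in> D"
    show "K x \<bullet> B z = C x \<bullet> z"
      using K_skew[of x "B z"] C_skew(3)[OF x z] by (simp add: K_B z)
  qed
  then show "x \<in> D \<Longrightarrow> K x \<in> D" "x \<in> D \<Longrightarrow> B (K x) = K (B x)" by (auto simp: K_B)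
qed

definition t :: "'h \<Rightarrow> 'a" where "t y = tau d (V y)"

lemma B_pow2: "(B ^^ 2) x = B (B x)" by (simp add: numeral_2_eq_2)

lemma tau_t: "tau d v = t (U v)" by (simp add: t_def)

lemma Hbar_carrier: "carrier (Hbar d 2) = {v. U v \<in> D}" "carrier (Hbar d 3) = {v. U v \<in> B1.D2}"
  "sc (Hbar d k) = sc (Hbar1 d)"
  by (simp_all add: Hbar_def Hpos_def domBpow_simps)

lemma Hbar_nrm:
  "nrm (Hbar d 2) v = sqrt ((norm (B (U v)))\<^sup>2 + (norm (U v))\<^sup>2)"
  "nrm (Hbar d 3) v = sqrt ((norm (B (B (U v))))\<^sup>2 + (norm (U v))\<^sup>2)"
  by (simp_all add: Hbar_def Hpos_def nrm_def H0D(6) power2_norm_eq_inner B_pow2)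

lemma norm_le_Hbar_nrm: "norm v \<le> nrm (Hbar d 2) v" "norm v \<le> nrm (Hbar d 3) v"
  unfolding Hbar_nrm by (rule real_le_rsqrt; simp add: norm_U)+

lemma
  shows t_lin: "linear_map_on D t" and t_sc: "sc_equivariant (H0 d) (haux d) D t"
    and t_bound: "\<exists>c. \<forall>y\<in>D. norm (t y) \<le> c * (norm (B y) + norm y)"
proof -
  have lin: "lin_on (Hbar d 2) (haux d) (tau d)"
    and "\<exists>c. \<forall>x\<in>carrier (Hbar d 2). nrm (haux d) (tau d x) \<le> c * nrm (Hbar d 2) x"
    using settingD(10) by (auto simp: bops_def)
  then obtain c where c: "\<And>v. U v \<in> D \<Longrightarrow> norm (tau d v) \<le> c * nrm (Hbar d 2) v"
    by (auto simp: Hbar_carrier nrm_hilbert[OF hh])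
  have add: "t (x + y) = t x + t y" if "x \<in> D" "y \<in> D" for x y
    using lin that by (simp add: lin_on_def Hbar_carrier t_def V_simps)
  have sc: "t (sc (H0 d) a x) = sc (haux d) a (t x)" if "x \<in> D" for a x
    using lin that by (simp add: lin_on_def Hbar_carrier t_def V_simps)
  show "sc_equivariant (H0 d) (haux d) D t" using sc B_sc by (auto simp: sc_equivariant_def)
  have "t (r *\<^sub>R x) = r *\<^sub>R t x" if "x \<in> D" for r x
    using sc[OF that, of "of_real r"] by (simp add: H0D(2) hD(2))
  then show "linear_map_on D t" using add B1.sub by (simp add: linear_map_on_def)
  have "norm (t y) \<le> \<bar>c\<bar> * (norm (B y) + norm y)" if y: "y \<in> D" for y
  proof -
    have "norm (t y) \<le> c * sqrt ((norm (B y))\<^sup>2 + (norm y)\<^sup>2)"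
      using c[of "V y"] y by (simp add: t_def Hbar_nrm)
    also have "\<dots> \<le> \<bar>c\<bar> * sqrt ((norm (B y))\<^sup>2 + (norm y)\<^sup>2)" by (intro mult_right_mono) auto
    also have "\<dots> \<le> \<bar>c\<bar> * (norm (B y) + norm y)"
      by (intro mult_left_mono) (auto intro: sqrt_sum_squares_le_sum)
    finally show ?thesis .
  qed
  then show "\<exists>c. \<forall>y\<in>D. norm (t y) \<le> c * (norm (B y) + norm y)" by blast
qed

sublocale pencil: wave_pencil D B K t
  by (rule wave_pencil.intro[OF B1.injective_selfadjoint_axioms], rule wave_pencil_axioms.intro)
    (rule K_lin K_skew K_D BK t_lin t_bound; assumption?)+

abbreviation R where "R \<equiv> pencil.R"
abbreviation pot where "pot \<equiv> pencil.pot"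

lemma inner_sc_B:
  assumes "y \<in> D"
  shows "sc (H0 d) a x \<bullet> B y = x \<bullet> B (sc (H0 d) (kconj a) y)"
  using sc_equivariantD(2)[OF B_sc assms] by (simp add: inner_sc_left[OF hH0])

lemma inner_sc_t:
  assumes "y \<in> D"
  shows "sc (haux d) a \<zeta> \<bullet> t y = \<zeta> \<bullet> t (sc (H0 d) (kconj a) y)"
  using sc_equivariantD(2)[OF t_sc assms] by (simp add: inner_sc_left[OF hh])

lemma R_sc:
  assumes mu: "\<mu> \<noteq> 0" shows "R \<mu> (sc (H0 d) a x) = sc (H0 d) a (R \<mu> x)"
proof (rule pencil.R_eqI[OF mu])
  note r = pencil.R_solves[OF mu, of x] and rd = pencil.R_D[OF mu, of x]
  note s = sc_equivariantD[OF B_sc]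
  show "sc (H0 d) a (R \<mu> x) \<in> B1.D2" using r s by (auto simp: B1.D2_def)
  show "B (B (sc (H0 d) a (R \<mu> x))) - \<mu> *\<^sub>R K (B (sc (H0 d) a (R \<mu> x))) + \<mu>\<^sup>2 *\<^sub>R sc (H0 d) a (R \<mu> x)
      = sc (H0 d) a x"
    using arg_cong[OF r(2), of "sc (H0 d) a"] s rd by (simp add: K_sc sc_simps[OF hH0])
qed

lemma pot_sc:
  assumes mu: "\<mu> \<noteq> 0" shows "pot \<mu> (sc (haux d) a \<zeta>) = sc (H0 d) a (pot \<mu> \<zeta>)"
proof (rule pencil.pot_eqI[OF mu])
  note wd = pencil.pot_solves(1)[OF mu, of \<zeta>] and s = sc_equivariantD[OF B_sc]
  show "sc (H0 d) a (pot \<mu> \<zeta>) \<in> D" by (rule s(1)[OF wd])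
  fix y assume y: "y \<in> D"
  have "pencil.wform \<mu> (sc (H0 d) a (pot \<mu> \<zeta>)) y = pencil.wform \<mu> (pot \<mu> \<zeta>) (sc (H0 d) (kconj a) y)"
    using s[OF wd, of a] s[OF y, of "kconj a"]
    by (simp add: pencil.wform_def inner_sc_left[OF hH0] K_sc)
  then show "pencil.wform \<mu> (sc (H0 d) a (pot \<mu> \<zeta>)) y = sc (haux d) a \<zeta> \<bullet> t y"
    using pencil.pot_solves(2)[OF mu s(1)[OF y]] inner_sc_t[OF y] by simp
qed

subsection \<open>The operators of the theorem in transported form\<close>

lemma Rop_eq: "\<mu> \<noteq> 0 \<Longrightarrow> Rop d \<mu> x = R \<mu> x"
proof -
  have "(z \<in> B1.D2 \<and> B (B z) - \<mu> *\<^sub>R C z + \<mu>\<^sup>2 *\<^sub>R z = x) =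
      (z \<in> B1.D2 \<and> B (B z) - \<mu> *\<^sub>R K (B z) + \<mu>\<^sup>2 *\<^sub>R z = x)" for z
    by (auto simp: K_B B1.D2D(1))
  then show ?thesis by (simp add: Rop_def pencil.R_def inv_into_def domBpow_simps)
qed

lemma Gbreve_eq: "\<mu> \<noteq> 0 \<Longrightarrow> Gbreve d \<mu> x = t (B (R \<mu> x))"
  using pencil.R_D(1)[of \<mu> x] by (simp add: Gbreve_def Rop_eq t_def V_B)

text \<open>
  Solutions of the pencil with parameter \<open>- \<mu>\<close> are test vectors for the potential with parameter
  \<open>\<mu>\<close>, because \<open>K\<close> is skew. These two identities identify the adjoints \<open>Gop\<close> and \<open>Gbar\<close>.
\<close>

lemma pot_pairing:
  assumes mu: "\<mu> \<noteq> 0"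
  shows "pot \<mu> \<zeta> \<bullet> f = \<zeta> \<bullet> t (R (- \<mu>) f)" "B (pot \<mu> \<zeta>) \<bullet> f = \<zeta> \<bullet> t (B (R (- \<mu>) f))"
proof -
  have mu': "- \<mu> \<noteq> 0" using mu by simp
  define x where "x = R (- \<mu>) f"
  note r = pencil.R_solves[OF mu', of f, folded x_def] and wd = pencil.pot_solves(1)[OF mu, of \<zeta>]
  note xD = B1.D2D[OF r(1)]
  have f: "f = B (B x) + \<mu> *\<^sub>R K (B x) + \<mu>\<^sup>2 *\<^sub>R x" using r(2) by simp
  have "pencil.wform \<mu> (pot \<mu> \<zeta>) x = pot \<mu> \<zeta> \<bullet> f"
    using B1.sym[OF wd xD(2)] B1.sym[OF wd K_D[OF xD(1)]] BK[OF xD(1)]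
    by (simp add: pencil.wform_def f inner_add_right)
  then show "pot \<mu> \<zeta> \<bullet> f = \<zeta> \<bullet> t (R (- \<mu>) f)" using pencil.pot_solves(2)[OF mu xD(1)] by (simp add: x_def)
  have "pencil.wform \<mu> (pot \<mu> \<zeta>) (B x) = B (pot \<mu> \<zeta>) \<bullet> f"
    using B1.sym[OF wd xD(1)] by (simp add: pencil.wform_def f inner_add_right)
  then show "B (pot \<mu> \<zeta>) \<bullet> f = \<zeta> \<bullet> t (B (R (- \<mu>) f))" using pencil.pot_solves(2)[OF mu xD(2)] by (simp add: x_def)
qed

lemma Gop_eq: assumes mu: "\<mu> \<noteq> 0" shows "Gop d \<mu> \<zeta> = B (pot \<mu> \<zeta>)"
  unfolding Gop_def
proof (rule hadj_eqI[OF hH0 hh])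
  have mu': "- \<mu> \<noteq> 0" using mu by simp
  show "Gbreve d (- \<mu>) (sc (H0 d) a u) = sc (haux d) a (Gbreve d (- \<mu>) u)" for a u
    using sc_equivariantD(2)[OF B_sc pencil.R_D(1)[OF mu']] sc_equivariantD(2)[OF t_sc pencil.R_D(2)[OF mu']]
    by (simp add: Gbreve_eq[OF mu'] R_sc[OF mu'])
  show "B (pot \<mu> \<zeta>) \<bullet> u = \<zeta> \<bullet> Gbreve d (- \<mu>) u" for u
    by (simp add: pot_pairing(2)[OF mu] Gbreve_eq[OF mu'])
qed

lemma Binv_pot: "\<mu> \<noteq> 0 \<Longrightarrow> Binv d (B (pot \<mu> \<zeta>)) = pot \<mu> \<zeta>"
  unfolding Binv_def by (rule inv_into_f_f[OF B1.B_inj_on pencil.pot_solves(1)])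

lemma Cbar_eq: "Cbar d v = K (U v)"
proof -
  have "Cbar d = (\<lambda>v. K (U v))"
    unfolding Cbar_def
  proof (rule bdd_ext_eqI[OF hHb emb(3)])
    show "(\<lambda>v. K (U v)) \<in> bops (Hbar1 d) (H0 d)"
      by (simp add: bops_hilbert[OF hHb hH0] bounded_linear_compose[OF K_lin U_lin] U_sc K_sc)
  qed (simp_all add: U_emb K_B H0D(2) nrm_hilbert[OF hH0])
  then show ?thesis by simp
qed

lemma Cbar_adj_eq: "Cbar_adj d y = V (- K y)"
  unfolding Cbar_adj_def
proof (rule hadj_eqI[OF hHb hH0])
  show "Cbar d (sc (Hbar1 d) a u) = sc (H0 d) a (Cbar d u)" for a u by (simp add: Cbar_eq U_sc K_sc)
  show "V (- K y) \<bullet> u = y \<bullet> Cbar d u" for u using K_skew[of y "U u"] by (simp add: inner_V Cbar_eq)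
qed

lemma Rbar_eq: assumes mu: "\<mu> \<noteq> 0" shows "Rbar d \<mu> v = V (R \<mu> (U v))"
proof -
  have "Rbar d \<mu> = (\<lambda>v. V (R \<mu> (U v)))"
    unfolding Rbar_def
  proof (rule bdd_ext_eqI[OF hHb emb(3)])
    obtain c where c: "c > 0" "\<And>f. norm (B (B (R \<mu> f))) \<le> c * norm f" "\<And>f. norm (R \<mu> f) \<le> c * norm f"
      using pencil.R_bounds[OF mu] by metis
    have "nrm (Hbar d 3) (V (R \<mu> (U v))) \<le> (2 * c) * nrm (Hbar1 d) v" for v
    proof -
      have "nrm (Hbar d 3) (V (R \<mu> (U v))) \<le> norm (B (B (R \<mu> (U v)))) + norm (R \<mu> (U v))"
        by (simp add: Hbar_nrm sqrt_sum_squares_le_sum)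
      also have "\<dots> \<le> c * norm (U v) + c * norm (U v)" by (intro add_mono c)
      finally show ?thesis by (simp add: norm_U nrm_hilbert[OF hHb])
    qed
    then have "\<exists>k. \<forall>v. nrm (Hbar d 3) (V (R \<mu> (U v))) \<le> k * nrm (Hbar1 d) v" by blast
    then show "(\<lambda>v. V (R \<mu> (U v))) \<in> bops (Hbar1 d) (Hbar d 3)"
      by (simp add: bops_def lin_on_def HbD(1) Hbar_carrier pencil.R_solves(1)[OF mu]
          U_simps pencil.R_linear[OF mu] V_simps U_sc R_sc[OF mu])
    show "V (R \<mu> (U (emb1 d x))) = emb1 d (Rop d \<mu> x)" if "x \<in> D" for x
      using that by (simp add: U_emb Rop_eq[OF mu] pencil.R_B[OF mu] V_B pencil.R_D[OF mu])
    show "sc (Hbar d 3) (of_real r) z = r *\<^sub>R z" for r z by (simp add: Hbar_carrier HbD(2))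
  qed (rule norm_le_Hbar_nrm)
  then show ?thesis by simp
qed

lemma Gbar_breve_eq: "\<mu> \<noteq> 0 \<Longrightarrow> Gbar_breve d \<mu> v = t (R \<mu> (U v))"
  by (simp add: Gbar_breve_def Rbar_eq t_def)

lemma Gbar_eq: assumes mu: "\<mu> \<noteq> 0" shows "Gbar d \<mu> \<zeta> = V (pot \<mu> \<zeta>)"
  unfolding Gbar_def
proof (rule hadj_eqI[OF hHb hh])
  have mu': "- \<mu> \<noteq> 0" using mu by simp
  show "Gbar_breve d (- \<mu>) (sc (Hbar1 d) a u) = sc (haux d) a (Gbar_breve d (- \<mu>) u)" for a u
    using sc_equivariantD(2)[OF t_sc pencil.R_D(1)[OF mu']]
    by (simp add: Gbar_breve_eq[OF mu'] R_sc[OF mu'] U_sc)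
  show "V (pot \<mu> \<zeta>) \<bullet> u = \<zeta> \<bullet> Gbar_breve d (- \<mu>) u" for u
    by (simp add: inner_V pot_pairing(1)[OF mu] Gbar_breve_eq[OF mu'])
qed

subsection \<open>The regularization\<close>

lemma
  assumes nu: "\<nu> > 0"
  shows J_lin: "bounded_linear (Jreg d \<nu>)" and J_D: "Jreg d \<nu> x \<in> D"
    and BJ_lin: "bounded_linear (\<lambda>x. B (Jreg d \<nu> x))"
    and J_sc: "Jreg d \<nu> (sc (H0 d) a x) = sc (H0 d) a (Jreg d \<nu> x)"
    and J_sym: "Jreg d \<nu> x \<bullet> y = x \<bullet> Jreg d \<nu> y"
    and J_K: "Jreg d \<nu> (K x) = K (Jreg d \<nu> x)"
proof -
  let ?J = "Jreg d \<nu>"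
  have Jb: "?J \<in> bops (H0 d) (Hpos d (Suc 0))" using settingD(13)[OF nu, of 0] by (simp add: Hpos_def)
  then have D: "?J x \<in> D" for x by (simp add: bops_def H0D(1) Hpos_def domBpow_simps)
  then show "?J x \<in> D" .
  have add: "?J (x + y) = ?J x + ?J y" and sc: "?J (sc (H0 d) a x) = sc (H0 d) a (?J x)" for a x y
    using Jb by (auto simp: bops_def lin_on_def H0D(1) Hpos_def)
  show "?J (sc (H0 d) a x) = sc (H0 d) a (?J x)" by (rule sc)
  have scale: "?J (r *\<^sub>R x) = r *\<^sub>R ?J x" for r x
    using sc[of "of_real r" x] by (simp add: H0D(2))
  have "\<exists>k. \<forall>x. sqrt ((norm (B (?J x)))\<^sup>2 + (norm (?J x))\<^sup>2) \<le> k * norm x"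
  proof -
    have "nrm (Hpos d (Suc 0)) z = sqrt ((norm (B z))\<^sup>2 + (norm z)\<^sup>2)" for z
      by (simp add: Hpos_def nrm_def H0D(6) power2_norm_eq_inner)
    then show ?thesis using Jb by (auto simp: bops_def H0D(1) nrm_hilbert[OF hH0])
  qed
  then obtain k where k: "\<And>x. sqrt ((norm (B (?J x)))\<^sup>2 + (norm (?J x))\<^sup>2) \<le> k * norm x" by blast
  show J_lin: "bounded_linear ?J"
  proof (rule bounded_linear_intro[OF add scale])
    show "norm (?J x) \<le> norm x * k" for x
      using order_trans[OF real_sqrt_sum_squares_ge2 k] by (simp add: mult.commute)
  qed
  show "bounded_linear (\<lambda>x. B (?J x))"
  proof (rule bounded_linear_intro)
    show "norm (B (?J x)) \<le> norm x * k" for x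
      using order_trans[OF real_sqrt_sum_squares_ge1 k] by (simp add: mult.commute)
  qed (simp_all add: add scale B1.B_simps D)
  interpret J: selfadjoint UNIV ?J by (rule self_adjoint_selfadjoint(1)[OF hH0 settingD(12)[OF nu]])
  show "?J x \<bullet> y = x \<bullet> ?J y" by (rule J.sym) auto
  show "?J (K x) = K (?J x)"
  proof (rule continuous_eq_on_dense[OF B1.range_B_dense, of "\<lambda>x. ?J (K x)" "\<lambda>x. K (?J x)"])
    fix s assume "s \<in> B ` D"
    then obtain x where x: "x \<in> D" "s = B x" by blast
    then show "?J (K s) = K (?J s)" using D by (simp add: K_B settingD(14,15)[OF nu])
  qed (intro linear_continuous_on bounded_linear_compose[OF K_lin] bounded_linear_compose[OF J_lin] K_lin J_lin)+
qed

lemma J_lim: "((\<lambda>\<nu>. Jreg d \<nu> x) \<longlongrightarrow> x) (at_right 0)"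
proof -
  have "((\<lambda>\<nu>. Jreg d \<nu> x - x) \<longlongrightarrow> 0) (at_right 0)"
    using settingD(16)[of x] by (rule tendsto_norm_zero_cancel)
  from tendsto_add[OF this tendsto_const[of x]] show ?thesis by simp
qed

lemma Jbar_eq: assumes nu: "\<nu> > 0" shows "Jbar d \<nu> v = V (Jreg d \<nu> (U v))"
proof -
  let ?J = "Jreg d \<nu>"
  have "Jbar d \<nu> = (\<lambda>v. V (?J (U v)))"
    unfolding Jbar_def
  proof (rule bdd_ext_eqI[OF hHb emb(3)])
    obtain k where k: "\<And>x. norm (B (?J x)) \<le> norm x * k" using bounded_linear.bounded[OF BJ_lin[OF nu]] by blast
    obtain k' where k': "\<And>x. norm (?J x) \<le> norm x * k'" using bounded_linear.bounded[OF J_lin[OF nu]] by blast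
    have "nrm (Hbar d 2) (V (?J (U v))) \<le> (k + k') * nrm (Hbar1 d) v" for v
    proof -
      have "nrm (Hbar d 2) (V (?J (U v))) \<le> norm (B (?J (U v))) + norm (?J (U v))"
        by (simp add: Hbar_nrm sqrt_sum_squares_le_sum)
      also have "\<dots> \<le> norm (U v) * k + norm (U v) * k'" by (intro add_mono k k')
      finally show ?thesis by (simp add: norm_U nrm_hilbert[OF hHb] algebra_simps)
    qed
    then have "\<exists>k. \<forall>v. nrm (Hbar d 2) (V (?J (U v))) \<le> k * nrm (Hbar1 d) v" by blast
    then show "(\<lambda>v. V (?J (U v))) \<in> bops (Hbar1 d) (Hbar d 2)"
      by (simp add: bops_def lin_on_def HbD(1) Hbar_carrier J_D[OF nu]
          U_simps linear_simps[OF J_lin[OF nu]] V_simps U_sc J_sc[OF nu])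
    show "V (?J (U (emb1 d x))) = emb1 d (?J x)" if "x \<in> D" for x
      using that by (simp add: U_emb settingD(14)[OF nu] V_B J_D[OF nu])
    show "sc (Hbar d 2) (of_real r) z = r *\<^sub>R z" for r z by (simp add: Hbar_carrier HbD(2))
  qed (rule norm_le_Hbar_nrm)
  then show ?thesis by simp
qed

lemma tau_Jbar: "\<nu> > 0 \<Longrightarrow> tau d (Jbar d \<nu> v) = t (Jreg d \<nu> (U v))"
  by (simp add: Jbar_eq t_def)

lemma tau_Jbar_lim:
  "((\<lambda>\<nu>. tau d (Jbar d \<nu> v)) \<longlongrightarrow> L) (at_right 0) \<longleftrightarrow> ((\<lambda>\<nu>. t (Jreg d \<nu> (U v))) \<longlongrightarrow> L) (at_right 0)"
  by (rule tendsto_cong) (use eventually_at_right_less[of 0] in \<open>eventually_elim; simp add: tau_Jbar\<close>)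

lemma dom_taubar_iff: "v \<in> dom_taubar d \<longleftrightarrow> (\<exists>L. ((\<lambda>\<nu>. t (Jreg d \<nu> (U v))) \<longlongrightarrow> L) (at_right 0))"
  by (simp add: dom_taubar_def tau_Jbar_lim)

subsection \<open>Transversality\<close>

lemma Bsqrt_eq: "Bsqrt d 1 = B1.S" "Bsqrt d 2 = B2.S"
proof -
  have 1: "inv_into (domBpow d (2 * 1)) (\<lambda>x. (B ^^ (2 * 1)) x + x) = B1.P"
    by (simp add: B1.P_def domBpow_simps B_pow2)
  show "Bsqrt d 1 = B1.S" unfolding Bsqrt_def 1 by (rule B1.pos_sqrt_P[OF hH0 B_sc])
  have 2: "inv_into (domBpow d (2 * 2)) (\<lambda>x. (B ^^ (2 * 2)) x + x) = B2.P"
    using domBpow_4 by (simp add: B2.P_def) (simp add: eval_nat_numeral)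
  show "Bsqrt d 2 = B2.S" unfolding Bsqrt_def 2 by (rule B2.pos_sqrt_P[OF hH0 B2_sc])
qed

lemma embm:
  assumes comp: "completion_of (preHneg d k) X E"
    and S: "bounded_linear (Bsqrt d k)"
  shows "linear_map_on UNIV E" "sc_equivariant (H0 d) X UNIV E" "closure (range E) = UNIV"
    "norm (E x) = norm (Bsqrt d k x)"
proof -
  note c = completion_ofD[OF comp]
  have car: "carrier (preHneg d k) = UNIV" "sc (preHneg d k) = sc (H0 d)"
    by (simp_all add: preHneg_def H0D(1))
  show "linear_map_on UNIV E"
    using lin_on_linear_map_on[OF c(2)] by (simp add: car subspace_UNIV H0D(2) hilbert_spaceD(2)[OF c(1)])
  show "sc_equivariant (H0 d) X UNIV E"
    using c(2) by (auto simp: sc_equivariant_def lin_on_def car)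
  show "closure (range E) = UNIV" using c(4) by (simp add: car)
  have "ip X (E x) (E x) = ip (H0 d) (Bsqrt d k x) (Bsqrt d k x)"
    using c(3)[of x x] by (simp add: car) (simp add: preHneg_def)
  then have "E x \<bullet> E x = Bsqrt d k x \<bullet> Bsqrt d k x"
    by (metis hilbert_spaceD(6)[OF c(1)] H0D(6))
  then show "norm (E x) = norm (Bsqrt d k x)" by (simp add: norm_eq_sqrt_inner)
qed

lemma linear_map_on_UNIV: "bounded_linear f \<Longrightarrow> linear_map_on UNIV f"
  by (simp add: linear_map_on_def linear_simps subspace_UNIV)

text \<open>
  The norm of $\mathcal H_{-2}$ is dominated by the one of $\mathcal H_{-1}$, by duality from the
  interpolation inequality \<open>\<parallel>B y\<parallel>\<^sup>2 \<le> \<parallel>y\<parallel> \<parallel>B\<^sup>2 y\<parallel>\<close>.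
\<close>

lemma S2_le_S1: "norm (B2.S x) \<le> 2 * norm (B1.S x)"
proof (cases "B2.S x = 0")
  case False
  define y where "y = B2.S (B2.S x)"
  have y2: "y \<in> B1.D2" unfolding y_def by (rule B2.S_in_D)
  have iso: "(norm (B (B y)))\<^sup>2 + (norm y)\<^sup>2 = (norm (B2.S x))\<^sup>2" unfolding y_def by (rule B2.S_isometry)
  obtain z where z: "y = B1.S z" using B1.range_S B1.D2D(1)[OF y2] by blast
  have "(norm (B y))\<^sup>2 = y \<bullet> B (B y)"
    using B1.sym[OF B1.D2D[OF y2]] by (simp add: power2_norm_eq_inner)
  also have "\<dots> \<le> norm y * norm (B (B y))" by (rule norm_cauchy_schwarz)
  also have "\<dots> \<le> (norm (B (B y)))\<^sup>2 + (norm y)\<^sup>2"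
  proof -
    have "0 \<le> norm y * norm (B (B y))" by simp
    then show ?thesis
      using sum_squares_bound[of "norm y" "norm (B (B y))"] unfolding mult.assoc by linarith
  qed
  finally have By: "(norm (B y))\<^sup>2 \<le> (norm (B (B y)))\<^sup>2 + (norm y)\<^sup>2" .
  have "(norm (B y))\<^sup>2 + (norm y)\<^sup>2 \<le> (2 * norm (B2.S x))\<^sup>2"
  proof -
    have "(2 * norm (B2.S x))\<^sup>2 = 4 * (norm (B2.S x))\<^sup>2" by (simp add: power_mult_distrib)
    then show ?thesis
      using By iso zero_le_power2[of "norm (B (B y))"] zero_le_power2[of "norm (B2.S x)"] by linarith
  qed
  then have "(norm z)\<^sup>2 \<le> (2 * norm (B2.S x))\<^sup>2" using B1.S_isometry[of z] by (simp add: z)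
  then have nz: "norm z \<le> 2 * norm (B2.S x)" by (rule power2_le_imp_le) simp
  have "norm (B2.S x) * norm (B2.S x) = x \<bullet> B2.S (B2.S x)"
    by (simp add: B2.S_sym[symmetric] power2_norm_eq_inner[symmetric] power2_eq_square)
  also have "\<dots> = B1.S x \<bullet> z" using z by (simp add: B1.S_sym y_def)
  also have "\<dots> \<le> norm (B1.S x) * norm z" by (rule norm_cauchy_schwarz)
  also have "\<dots> \<le> norm (B1.S x) * (2 * norm (B2.S x))" by (intro mult_left_mono nz) simp
  finally show ?thesis using False by simp
qed simp

text \<open>
  The extension of $(B^4+1)^{-1/2}$ to $\mathcal H_{-2}$, an isometry.
\<close>

definition S2hat :: "'q \<Rightarrow> 'h" where
  "S2hat = bdd_ext (Hm2 d) (H0 d) (embm2 d) UNIV (Bsqrt d 2)"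

lemma embm1:
  "linear_map_on UNIV (embm1 d)" "sc_equivariant (H0 d) (Hm1 d) UNIV (embm1 d)"
  "closure (range (embm1 d)) = UNIV" "norm (embm1 d x) = norm (B1.S x)"
  by (rule embm[OF settingD(5), unfolded Bsqrt_eq, OF B1.S_linear])+

lemma embm2:
  "linear_map_on UNIV (embm2 d)" "sc_equivariant (H0 d) (Hm2 d) UNIV (embm2 d)"
  "closure (range (embm2 d)) = UNIV" "norm (embm2 d x) = norm (B2.S x)"
  by (rule embm[OF settingD(6), unfolded Bsqrt_eq, OF B2.S_linear])+

lemma S2_sc: "B2.S (sc (H0 d) a x) = sc (H0 d) a (B2.S x)"
  by (rule B2.S_sc[OF hH0 B2_sc])

lemma S2hat: "bounded_linear S2hat" "S2hat (embm2 d x) = B2.S x" "norm (S2hat v) = norm v"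
proof -
  have "sc_equivariant (H0 d) (H0 d) UNIV B2.S" by (simp add: sc_equivariant_def S2_sc)
  note * = bdd_ext_hilbert[OF hHm2 hH0 embm2(1,2) linear_map_on_UNIV[OF B2.S_linear] this embm2(3), of 1]
  have S2: "S2hat = bdd_ext (Hm2 d) (H0 d) (embm2 d) UNIV B2.S" by (simp add: S2hat_def Bsqrt_eq)
  show lin: "bounded_linear S2hat" unfolding S2 by (rule *(1)) (simp add: embm2)
  show ext: "S2hat (embm2 d x) = B2.S x" for x unfolding S2 by (rule *(2)) (simp_all add: embm2)
  show "norm (S2hat v) = norm v"
    by (rule continuous_eq_on_dense[OF embm2(3), of "\<lambda>v. norm (S2hat v)" norm])
      (auto intro!: continuous_intros linear_continuous_on[OF lin] simp: ext embm2(4))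
qed

lemma incl_neg: "bounded_linear (incl_neg d)" "incl_neg d (embm1 d x) = embm2 d x"
  using bdd_ext_hilbert(1,2)[OF hHm1 hHm2 embm1(1,2) embm2(1,2) embm1(3), of 2, folded incl_neg_def]
  by (auto simp: embm1(4) embm2(4) S2_le_S1)

lemma inj_S2: "inj B2.S"
proof (rule injI)
  fix x y assume "B2.S x = B2.S y"
  then have "B2.S (x - y) = 0" by (simp add: linear_simps[OF B2.S_linear])
  then show "x = y" using B2.S_inj by fastforce
qed

lemma tau_adj_eqI:
  assumes eq: "\<And>p. S2hat v \<bullet> p = \<xi> \<bullet> tau d (emb1 d (B2.S p))"
  shows "tau_adj d \<xi> = v"
proof -
  have car: "carrier (Hpos d 2) = range B2.S" by (simp add: Hpos_def domBpow_simps B2.range_S)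
  have inv: "inv (Bsqrt d 2) (B2.S p) = p" for p by (simp add: Bsqrt_eq inv_f_f[OF inj_S2])
  have te: "tau d (emb1 d (B2.S p)) = t (B (B2.S p))" for p
    using B1.D2D(1)[OF B2.S_in_D, of p] by (simp add: t_def V_B)
  have sc: "tau d (emb1 d (B2.S (sc (H0 d) a p))) = sc (haux d) a (tau d (emb1 d (B2.S p)))" for a p
  proof -
    have "B2.S p \<in> D" "B (B2.S p) \<in> D" using B1.D2D[OF B2.S_in_D] by auto
    then show ?thesis unfolding te unfolding S2_sc
      using sc_equivariantD(2)[OF B_sc] sc_equivariantD(2)[OF t_sc] by simp
  qed
  show ?thesis
    unfolding tau_adj_def S2hat_def[symmetric]
  proof (rule the_equality)
    show "\<forall>x\<in>carrier (Hpos d 2). ip (H0 d) (S2hat v) (inv (Bsqrt d 2) x) = ip (haux d) \<xi> (tau d (emb1 d x))"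
      unfolding car using eq by (auto simp: inv sc intro!: ip_eqI[OF hH0 hh])
    fix u assume u: "\<forall>x\<in>carrier (Hpos d 2). ip (H0 d) (S2hat u) (inv (Bsqrt d 2) x) = ip (haux d) \<xi> (tau d (emb1 d x))"
    have "S2hat u \<bullet> p = S2hat v \<bullet> p" for p
    proof -
      have "ip (H0 d) (S2hat u) p = ip (haux d) \<xi> (tau d (emb1 d (B2.S p)))"
        using u unfolding car by (metis inv rangeI)
      then have "S2hat u \<bullet> p = \<xi> \<bullet> tau d (emb1 d (B2.S p))"
        by (metis H0D(6) hD(6))
      then show ?thesis by (simp add: eq)
    qed
    then have "S2hat u = S2hat v" by (intro vector_eq_rdot[THEN iffD1]) blast
    then have "norm (S2hat (u - v)) = 0" by (simp add: linear_simps[OF S2hat(1)])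
    then show "u = v" by (simp add: S2hat(3))
  qed
qed

text \<open>
  The functional \<open>x \<mapsto> \<langle>u, B x\<rangle>\<close> is continuous for the norm of $\mathcal H_1$, so it is represented
  by an element of $\mathcal H_{-1}$. If it equals \<open>x \<mapsto> \<langle>\<xi>, \<tau> x\<rangle>\<close>, that element is $\tau^*\xi$,
  and the hypotheses on $\tau^*$ give \<open>\<xi> = 0\<close>.
\<close>

lemma transversal:
  assumes eq: "\<And>x. x \<in> B1.D2 \<Longrightarrow> u \<bullet> B x = \<xi> \<bullet> t (B x)"
  shows "\<xi> = 0"
proof -
  have "bounded_linear (\<lambda>q. u \<bullet> B (B1.S q))"
    by (rule bounded_linear_compose[OF bounded_linear_inner_right B1.BS_linear])
  then obtain g where g: "\<And>q. u \<bullet> B (B1.S q) = g \<bullet> q" by (rule riesz_representation) blast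
  \<comment> \<open>Vectors \<open>x n\<close> of the base space that converge in $\mathcal H_{-1}$ to the representing element \<open>v\<close>.\<close>
  have "g \<in> closure (range B1.S)" using B1.S_range_dense by simp
  then obtain s where s: "\<And>n. s n \<in> range B1.S" "s \<longlonglongrightarrow> g" by (auto simp: closure_sequential)
  then have "\<forall>n. \<exists>x. s n = B1.S x" by blast
  then obtain x where x: "\<And>n. s n = B1.S (x n)" by metis
  have "dist (embm1 d (x m)) (embm1 d (x n)) = dist (s m) (s n)" for m n
    using embm1(4)[of "x m - x n"] linear_map_onD(6)[OF embm1(1)]
    by (simp add: dist_norm x linear_simps[OF B1.S_linear])
  then obtain v where v: "(\<lambda>n. embm1 d (x n)) \<longlonglongrightarrow> v"
    using convergent_if_dist_le[OF LIMSEQ_imp_Cauchy[OF s(2)], of "\<lambda>n. embm1 d (x n)" 1] by auto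
  define z where "z = incl_neg d v"
  have "(\<lambda>n. S2hat (incl_neg d (embm1 d (x n)))) \<longlonglongrightarrow> S2hat z"
    unfolding z_def by (intro bounded_linear.tendsto[OF S2hat(1)] bounded_linear.tendsto[OF incl_neg(1)] v)
  then have lim: "(\<lambda>n. B2.S (x n)) \<longlonglongrightarrow> S2hat z" by (simp add: incl_neg(2) S2hat(2))
  have "S2hat z \<bullet> p = \<xi> \<bullet> tau d (emb1 d (B2.S p))" for p
  proof -
    have D2: "B2.S p \<in> B1.D2" by (rule B2.S_in_D)
    obtain q where q: "B2.S p = B1.S q" using B1.range_S B1.D2D(1)[OF D2] by blast
    have "(\<lambda>n. B2.S (x n) \<bullet> p) \<longlonglongrightarrow> S2hat z \<bullet> p" by (intro tendsto_intros lim)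
    moreover have "B2.S (x n) \<bullet> p = s n \<bullet> q" for n by (simp add: B2.S_sym q x B1.S_sym)
    moreover have "(\<lambda>n. s n \<bullet> q) \<longlonglongrightarrow> g \<bullet> q" by (intro tendsto_intros s)
    ultimately have "S2hat z \<bullet> p = g \<bullet> q" using LIMSEQ_unique by simp
    also have "\<dots> = u \<bullet> B (B2.S p)" by (simp add: q flip: g)
    also have "\<dots> = \<xi> \<bullet> t (B (B2.S p))" by (rule eq[OF D2])
    finally show ?thesis using B1.D2D(1)[OF D2] by (simp add: t_def V_B)
  qed
  then have "tau_adj d \<xi> = z" by (rule tau_adj_eqI)
  then have "tau_adj d \<xi> \<in> range (incl_neg d)" by (simp add: z_def)
  then have "tau_adj d \<xi> \<in> range (tau_adj d) \<inter> range (incl_neg d)" by (intro IntI rangeI)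
  then have "tau_adj d \<xi> = 0" unfolding H3_1 by simp
  moreover have "tau_adj d 0 = 0"
    by (rule tau_adj_eqI) (simp add: linear_0[OF bounded_linear.linear[OF S2hat(1)]])
  ultimately show "\<xi> = 0" using tau_adj_inj by (metis injD)
qed

lemma Theta_props:
  "pos_symmetric (Theta d)" "Theta d (sc (haux d) a \<zeta>) = sc (haux d) a (Theta d \<zeta>)"
  "Theta d \<zeta> = 0 \<Longrightarrow> \<zeta> = 0"
proof -
  show P: "pos_symmetric (Theta d)" "Theta d (sc (haux d) a \<zeta>) = sc (haux d) a (Theta d \<zeta>)"
    using settingD(8) by (auto simp: positive_op_iff[OF hh])
  have "Theta d 0 = 0" using P(1) linear_0[OF bounded_linear.linear] unfolding pos_symmetric_def by blast
  then show "Theta d \<zeta> = 0 \<Longrightarrow> \<zeta> = 0" using settingD(9) by (metis injD)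
qed

sublocale core: wave_core D B K t "Theta d" "Jreg d"
proof (rule wave_core.intro[OF pencil.wave_pencil_axioms], rule wave_core_axioms.intro)
  show "\<xi> = 0" if "\<And>x. x \<in> B1.D2 \<Longrightarrow> u \<bullet> B x = \<xi> \<bullet> t (B x)" for u \<xi>
    by (rule transversal[OF that])
  show "\<exists>y\<in>D. \<exists>a. h = t y - Theta d a" for h
  proof -
    have "h \<in> {tau d x - Theta d \<zeta> | x \<zeta>. x \<in> carrier (Hbar d 2)}"
      unfolding H3_0 by (rule UNIV_I)
    then obtain v a where "U v \<in> D" "h = t (U v) - Theta d a" by (auto simp: Hbar_carrier tau_t)
    then show ?thesis by blast
  qed
  show "\<exists>L. ((\<lambda>\<nu>. t (Jreg d \<nu> (- K (B (pot \<mu> \<zeta>))))) \<longlongrightarrow> L) (at_right 0)" if mu: "\<mu> \<noteq> 0" for \<mu> \<zeta>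
  proof -
    have "Cbar_adj d (Gop d \<mu> \<zeta>) \<in> dom_taubar d" using H4_3 mu by blast
    then show ?thesis by (simp add: dom_taubar_iff Cbar_adj_eq Gop_eq[OF mu])
  qed
qed (use Theta_props J_lin J_D BJ_lin J_sym J_K J_lim settingD(14) in \<open>auto\<close>)

end

context wave
begin

section \<open>The operator and its resolvent\<close>

lemma Theta_ip: "ip (haux d) (Theta d b) a = ip (haux d) b (Theta d a)"
  by (rule ip_eqI[OF hh hh]) (simp add: core.Theta_sym Theta_props(2))

lemma Wspace_simps:
  "carrier (Wspace d) = UNIV"
  "sc (Wspace d) a (x, y, z) = (sc (Hbar1 d) a x, sc (H0 d) a y, sc (haux d) a z)"
  "ip (Wspace d) (x, y, z) (x', y', z') = ip (Hbar1 d) x x' + ip (H0 d) y y' + ip (haux d) (Theta d z) z'"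
  by (simp_all add: Wspace_def dsum3_def hTheta_def HbD(1) H0D(1)
      hD(1))

lemma kre_Wspace:
  "kre (ip (Wspace d) (x, y, z) (x', y', z')) = U x \<bullet> U x' + y \<bullet> y' + Theta d z \<bullet> z'"
  by (simp add: Wspace_simps HbD(6) H0D(6) hD(6) inner_U)

lemma Wspace_inner: "inner_space (Wspace d)"
  unfolding inner_space_def
proof (intro conjI allI impI)
  show "carrier (Wspace d) = UNIV" by (rule Wspace_simps(1))
  fix x y z :: "'b \<times> 'h \<times> 'a" and r :: real and a :: 'k
  obtain x1 x2 x3 where x: "x = (x1, x2, x3)" by (cases x)
  obtain y1 y2 y3 where y: "y = (y1, y2, y3)" by (cases y)
  obtain z1 z2 z3 where z: "z = (z1, z2, z3)" by (cases z)
  show "sc (Wspace d) (of_real r) x = r *\<^sub>R x"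
    by (simp add: x Wspace_simps HbD(2) H0D(2) hD(2))
  show "ip (Wspace d) x (y + z) = ip (Wspace d) x y + ip (Wspace d) x z"
    by (simp add: x y z Wspace_simps HbD(3) H0D(3) hD(3))
  show "ip (Wspace d) x (sc (Wspace d) a y) = a * ip (Wspace d) x y"
    by (simp add: x y Wspace_simps HbD(4) H0D(4) hD(4)
        distrib_left)
  show "ip (Wspace d) y x = kconj (ip (Wspace d) x y)"
    unfolding x y Wspace_simps kconj_add Theta_ip[of y3 x3]
    by (simp only: HbD(5)[of y1 x1] H0D(5)[of y2 x2]
        hD(5)[of y3 "Theta d x3"])
  show "0 \<le> kre (ip (Wspace d) x x)" by (simp add: x kre_Wspace core.Theta_pos)
  assume "kre (ip (Wspace d) x x) = 0"
  then have s: "U x1 \<bullet> U x1 + x2 \<bullet> x2 + Theta d x3 \<bullet> x3 = 0" by (simp add: x kre_Wspace)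
  moreover have "0 \<le> U x1 \<bullet> U x1" "0 \<le> x2 \<bullet> x2" "0 \<le> Theta d x3 \<bullet> x3" using core.Theta_pos by auto
  ultimately have "U x1 \<bullet> U x1 = 0" "x2 \<bullet> x2 = 0" "Theta d x3 \<bullet> x3 = 0" by linarith+
  then have "x1 = 0" "x2 = 0" "Theta d x3 = 0"
    using pos_symmetric_eq_0[OF Theta_props(1)] by (auto simp: inner_U)
  then show "x = 0" using Theta_props(3) by (simp add: x zero_prod_def)
qed

lemma taubar_eq: "taubar d v = core.reg_trace (U v)" and dom_taubar_dom_reg_trace: "v \<in> dom_taubar d \<longleftrightarrow> U v \<in> core.dom_reg_trace"
  by (simp_all add: taubar_def core.reg_trace_def t2_space_class.Lim_def tau_Jbar_lim dom_taubar_iff core.dom_reg_trace_def)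

text \<open>
  The decompositions in the definition of the operator are exactly those of \<open>wave_rel_decompose\<close>.
  The right-hand side does not depend on \<open>l\<close>, which is why surjectivity at \<open>l\<close> and at \<open>- l\<close> can be
  used together.
\<close>

lemma WTheta_iff:
  assumes l: "l \<noteq> 0"
  shows "((x, y, a), (v, q, \<zeta>)) \<in> WTheta d l \<longleftrightarrow>
    core.wave_rel (U x) y (U v) q \<zeta> \<and> U x \<in> core.dom_reg_trace \<and> Theta d a = core.reg_trace (U x)"
    (is "?L \<longleftrightarrow> ?R")
proof -
  define z where "z = pot l \<zeta>"
  have zD: "z \<in> D" unfolding z_def by (rule pencil.pot_solves(1)[OF l])
  have Cz: "C z = K (B z)" using zD by (simp add: K_B)
  have "?L \<longleftrightarrow> (\<exists>xl yl. U xl \<in> D \<and> yl \<in> D \<and> x = xl + V (C z) \<and> y = yl + B z \<and>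
      v = emb1 d yl - l *\<^sub>R V (- C z + l *\<^sub>R z) \<and> q = C yl + Abar d xl) \<and>
      x \<in> dom_taubar d \<and> Theta d a = taubar d x"
    unfolding WTheta_def by (auto simp: Binv_pot[OF l] Hbar_carrier z_def Gop_eq[OF l])
  also have "\<dots> \<longleftrightarrow> (\<exists>y'\<in>D. \<exists>p'\<in>D. U x = y' + K (B z) \<and> y = p' + B z \<and>
       U v = B p' - l *\<^sub>R (- K (B z) + l *\<^sub>R z) \<and> q = K (B p') - B y') \<and>
       U x \<in> core.dom_reg_trace \<and> Theta d a = core.reg_trace (U x)"
  proof -
    have "(\<exists>xl yl. U xl \<in> D \<and> yl \<in> D \<and> x = xl + V (C z) \<and> y = yl + B z \<and>
      v = emb1 d yl - l *\<^sub>R V (- C z + l *\<^sub>R z) \<and> q = C yl + Abar d xl) \<longleftrightarrow>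
      (\<exists>y'\<in>D. \<exists>p'\<in>D. U x = y' + K (B z) \<and> y = p' + B z \<and>
       U v = B p' - l *\<^sub>R (- K (B z) + l *\<^sub>R z) \<and> q = K (B p') - B y')" (is "?A \<longleftrightarrow> ?B")
    proof
      assume ?A
      then obtain xl yl where *: "U xl \<in> D" "yl \<in> D" "x = xl + V (C z)" "y = yl + B z"
        "v = emb1 d yl - l *\<^sub>R V (- C z + l *\<^sub>R z)" "q = C yl + Abar d xl" by blast
      then have "U x = U xl + K (B z)" "U v = B yl - l *\<^sub>R (- K (B z) + l *\<^sub>R z)" "q = K (B yl) - B (U xl)"
        by (simp_all add: U_simps U_emb Cz K_B Abar_def)
      then show ?B using * by blast
    next
      assume ?B
      then obtain y' p' where *: "y' \<in> D" "p' \<in> D" "U x = y' + K (B z)" "y = p' + B z"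
        "U v = B p' - l *\<^sub>R (- K (B z) + l *\<^sub>R z)" "q = K (B p') - B y'" by blast
      have "x = V y' + V (C z)" by (rule U_inj) (simp add: U_simps *(3) Cz)
      moreover have "v = emb1 d p' - l *\<^sub>R V (- C z + l *\<^sub>R z)"
        by (rule U_inj) (simp add: U_simps *(2,5) Cz U_emb)
      moreover have "q = C p' + Abar d (V y')" using * by (simp add: Abar_def K_B)
      ultimately show ?A using *(1,2,4) by (intro exI[of _ "V y'"] exI[of _ p']) simp
    qed
    then show ?thesis by (simp add: dom_taubar_dom_reg_trace taubar_eq)
  qed
  also have "\<dots> \<longleftrightarrow> ?R" unfolding core.wave_rel_decompose[OF l] z_def ..
  finally show ?thesis .
qed

lemma wave_rel_sc:
  assumes "core.wave_rel y p v q \<zeta>"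
  shows "core.wave_rel (sc (H0 d) a y) (sc (H0 d) a p) (sc (H0 d) a v) (sc (H0 d) a q) (sc (haux d) a \<zeta>)"
proof -
  have d: "y - K p \<in> D" "q = - B (y - K p)" and e: "\<And>x. x \<in> D \<Longrightarrow> p \<bullet> B x = v \<bullet> x + \<zeta> \<bullet> t x"
    using assms unfolding core.wave_rel_def by blast+
  have "sc (H0 d) a y - K (sc (H0 d) a p) = sc (H0 d) a (y - K p)" by (simp add: K_sc sc_simps[OF hH0])
  moreover have "sc (H0 d) a p \<bullet> B x = sc (H0 d) a v \<bullet> x + sc (haux d) a \<zeta> \<bullet> t x" if x: "x \<in> D" for x
    using e[OF sc_equivariantD(1)[OF B_sc x]]
    by (simp only: inner_sc_B[OF x] inner_sc_t[OF x] inner_sc_left[OF hH0, of a v])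
  ultimately show ?thesis
    using sc_equivariantD[OF B_sc d(1), of a] by (simp add: core.wave_rel_def d(2) sc_simps[OF hH0])
qed

lemma reg_trace_sc:
  assumes y: "y \<in> core.dom_reg_trace"
  shows "sc (H0 d) a y \<in> core.dom_reg_trace" "core.reg_trace (sc (H0 d) a y) = sc (haux d) a (core.reg_trace y)"
proof -
  have "((\<lambda>\<nu>. t (Jreg d \<nu> (sc (H0 d) a y))) \<longlongrightarrow> sc (haux d) a (core.reg_trace y)) (at_right 0)"
  proof (rule Lim_transform_eventually[OF bounded_linear.tendsto[OF sc_bounded_linear[OF hh] core.reg_trace[OF y]]])
    show "\<forall>\<^sub>F \<nu> in at_right 0. sc (haux d) a (t (Jreg d \<nu> y)) = t (Jreg d \<nu> (sc (H0 d) a y))"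
      using core.eventually_pos
      by eventually_elim (simp add: J_sc sc_equivariantD(2)[OF t_sc J_D])
  qed
  then show "sc (H0 d) a y \<in> core.dom_reg_trace" "core.reg_trace (sc (H0 d) a y) = sc (haux d) a (core.reg_trace y)"
    by (auto intro: core.dom_reg_traceI core.reg_trace_eqI)
qed

lemma WTheta_lin:
  assumes l: "l \<noteq> 0" shows "lin_operator (Wspace d) (WTheta d l)"
  unfolding lin_operator_def
proof (intro conjI allI impI)
  show "WTheta d l \<subseteq> carrier (Wspace d) \<times> carrier (Wspace d)" by (simp add: Wspace_simps(1))
  show "single_valued (WTheta d l)"
  proof (rule single_valuedI)
    fix X Y Z assume XY: "(X, Y) \<in> WTheta d l" "(X, Z) \<in> WTheta d l"
    obtain x1 x2 x3 y1 y2 y3 z1 z2 z3 where e: "X = (x1, x2, x3)" "Y = (y1, y2, y3)" "Z = (z1, z2, z3)"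
      by (metis prod_cases3)
    have "core.wave_rel (U x1) x2 (U y1) y2 y3" "core.wave_rel (U x1) x2 (U z1) z2 z3"
      using XY by (simp_all add: e WTheta_iff[OF l])
    from core.wave_rel_unique[OF this] show "Y = Z" using U_inj by (simp add: e)
  qed
  show "(0, 0) \<in> WTheta d l"
    using core.wave_rel_regular[of 0 0] core.reg_trace_D[of 0]
    by (simp add: zero_prod_def WTheta_iff[OF l] U_simps
        linear_0[OF bounded_linear.linear[OF U_lin]] B1.B_simps pencil.K_simps core.Theta_simps pencil.t_simps)
next
  fix X Y X' Y' assume XY: "(X, Y) \<in> WTheta d l" "(X', Y') \<in> WTheta d l"
  obtain x1 x2 x3 y1 y2 y3 where e: "X = (x1, x2, x3)" "Y = (y1, y2, y3)" by (metis prod_cases3)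
  obtain u1 u2 u3 v1 v2 v3 where e': "X' = (u1, u2, u3)" "Y' = (v1, v2, v3)" by (metis prod_cases3)
  show "(X + X', Y + Y') \<in> WTheta d l"
    using XY core.wave_rel_linear(1)[of "U x1" x2 "U y1" y2 y3 "U u1" u2 "U v1" v2 v3]
      core.reg_trace_add[of "U x1" "U u1"]
    by (simp add: e e' WTheta_iff[OF l] U_simps core.Theta_simps)
next
  fix a X Y assume XY: "(X, Y) \<in> WTheta d l"
  obtain x1 x2 x3 y1 y2 y3 where e: "X = (x1, x2, x3)" "Y = (y1, y2, y3)" by (metis prod_cases3)
  show "(sc (Wspace d) a X, sc (Wspace d) a Y) \<in> WTheta d l"
    using XY wave_rel_sc[of "U x1" x2 "U y1" y2 y3 a] reg_trace_sc[of "U x1" a]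
    by (simp add: e WTheta_iff[OF l] Wspace_simps U_sc Theta_props(2))
qed

lemma WTheta_skew:
  assumes l: "l \<noteq> 0" and "(X, Y) \<in> WTheta d l" "(X', Y') \<in> WTheta d l"
  shows "kre (ip (Wspace d) X Y') = - kre (ip (Wspace d) Y X')"
proof -
  obtain x1 x2 x3 y1 y2 y3 where e: "X = (x1, x2, x3)" "Y = (y1, y2, y3)" by (metis prod_cases3)
  obtain u1 u2 u3 v1 v2 v3 where e': "X' = (u1, u2, u3)" "Y' = (v1, v2, v3)" by (metis prod_cases3)
  have r: "core.wave_rel (U x1) x2 (U y1) y2 y3" "U x1 \<in> core.dom_reg_trace" "Theta d x3 = core.reg_trace (U x1)"
    "core.wave_rel (U u1) u2 (U v1) v2 v3" "U u1 \<in> core.dom_reg_trace" "Theta d u3 = core.reg_trace (U u1)"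
    using assms(2,3) by (simp_all add: e e' WTheta_iff[OF l])
  show ?thesis
    using core.green[OF r(1,4,2,5)] by (simp add: e e' kre_Wspace core.Theta_sym[of y3] r(3,6))
qed

lemma WTheta_surj:
  assumes l: "l \<noteq> 0" and mu: "\<mu> \<noteq> 0"
  shows "\<exists>X Y. (X, Y) \<in> WTheta d l \<and> \<mu> *\<^sub>R X - Y = F"
proof -
  obtain f1 f2 f3 where F: "F = (f1, f2, f3)" by (cases F)
  obtain y p a v q \<zeta> where s: "core.wave_rel y p v q \<zeta>" "y \<in> core.dom_reg_trace" "Theta d a = core.reg_trace y"
    "\<mu> *\<^sub>R y - v = U f1" "\<mu> *\<^sub>R p - q = f2" "\<mu> *\<^sub>R a - \<zeta> = f3"
    using core.wave_solvable[OF mu] by metis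
  have "((V y, p, a), (V v, q, \<zeta>)) \<in> WTheta d l" using s by (simp add: WTheta_iff[OF l])
  moreover have "\<mu> *\<^sub>R V y - V v = f1" by (rule U_inj) (simp add: U_simps s)
  ultimately show ?thesis using s(5,6) by (intro exI[of _ "(V y, p, a)"] exI[of _ "(V v, q, \<zeta>)"]) (simp add: F)
qed

lemma NTheta_iff: "(x, y, a) \<in> NTheta d \<longleftrightarrow> U x \<in> D \<and> y \<in> D \<and> t (U x) = Theta d a"
  by (simp add: NTheta_def Hbar_carrier tau_t)

lemma NTheta_dense: "dense_in (Wspace d) (NTheta d)"
  unfolding dense_in_def
proof (intro conjI ballI allI impI)
  show "NTheta d \<subseteq> carrier (Wspace d)" by (simp add: Wspace_simps(1))
  fix X :: "'b \<times> 'h \<times> 'a" and \<epsilon> :: real assume e: "\<epsilon> > 0"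
  obtain x y a where X: "X = (x, y, a)" by (cases X)
  obtain z b where z: "z \<in> D" "t z = Theta d b"
    "(norm (U x - z))\<^sup>2 + Theta d (a - b) \<bullet> (a - b) < \<epsilon>\<^sup>2 / 2"
    using core.trace_condition_dense[of "\<epsilon>\<^sup>2 / 2" "U x" a] e by auto
  have "y \<in> closure D" using B1.dense by simp
  then obtain p where p: "p \<in> D" "dist p y < sqrt (\<epsilon>\<^sup>2 / 2)"
    using e unfolding closure_approachable by (meson half_gt_zero real_sqrt_gt_zero zero_less_power)
  have "(norm (y - p))\<^sup>2 < (sqrt (\<epsilon>\<^sup>2 / 2))\<^sup>2"
    using p(2) by (intro power_strict_mono) (auto simp: dist_norm norm_minus_commute)
  then have np: "(norm (y - p))\<^sup>2 < \<epsilon>\<^sup>2 / 2" by simp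
  have "(nrm (Wspace d) (X - (V z, p, b)))\<^sup>2 = (norm (U x - z))\<^sup>2 + (norm (y - p))\<^sup>2 + Theta d (a - b) \<bullet> (a - b)"
    unfolding inner_space_nrm(2)[OF Wspace_inner]
    by (simp add: X kre_Wspace U_simps power2_norm_eq_inner)
  also have "\<dots> < \<epsilon>\<^sup>2" using z(3) np by linarith
  finally have "nrm (Wspace d) (X - (V z, p, b)) < \<epsilon>" using e by (simp add: power2_less_imp_less)
  moreover have "(V z, p, b) \<in> NTheta d" using z p by (simp add: NTheta_iff)
  ultimately show "\<exists>Y\<in>NTheta d. nrm (Wspace d) (X - Y) < \<epsilon>" by blast
qed

lemma Wg_iff:
  "((x, y, a), (v, q, \<zeta> :: 'a)) \<in> Wg d \<longleftrightarrow> U x \<in> D \<and> y \<in> D \<and> U v = B y \<and> q = K (B y) - B (U x) \<and> \<zeta> = 0"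
proof -
  have "v = emb1 d y \<longleftrightarrow> U v = B y" if "y \<in> D" using that U_emb U_inj by metis
  then show ?thesis by (auto simp: Wg_def op_graph_def Hbar_carrier Abar_def K_B)
qed

lemma Wg_NTheta_WTheta: assumes l: "l \<noteq> 0" shows "restr (Wg d) (NTheta d) \<subseteq> WTheta d l"
proof (rule subrelI)
  fix X Y :: "'b \<times> 'h \<times> 'a" assume XY: "(X, Y) \<in> restr (Wg d) (NTheta d)"
  obtain x1 x2 x3 y1 y2 y3 where e: "X = (x1, x2, x3)" "Y = (y1, y2, y3)" by (metis prod_cases3)
  have *: "U x1 \<in> D" "x2 \<in> D" "U y1 = B x2" "y2 = K (B x2) - B (U x1)" "y3 = 0" "t (U x1) = Theta d x3"
    using XY by (simp_all add: restr_def e Wg_iff NTheta_iff)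
  show "(X, Y) \<in> WTheta d l"
    using core.wave_rel_regular[OF *(1,2)] core.reg_trace_D[OF *(1)] *(3-6) by (simp add: e WTheta_iff[OF l])
qed

lemma WTheta_skew_adjoint: assumes l: "l \<noteq> 0" shows "skew_adjoint (Wspace d) (WTheta d l)"
proof (rule skew_adjointI[OF Wspace_inner WTheta_lin[OF l], of l])
  have "NTheta d \<subseteq> Domain (WTheta d l)"
  proof
    fix X assume X: "X \<in> NTheta d"
    obtain x y a where e: "X = (x, y, a)" by (cases X)
    have "(X, (V (B y), K (B y) - B (U x), 0 :: 'a)) \<in> restr (Wg d) (NTheta d)"
      using X by (simp add: restr_def e Wg_iff NTheta_iff)
    then show "X \<in> Domain (WTheta d l)" using Wg_NTheta_WTheta[OF l] by blast
  qed
  then show "dense_in (Wspace d) (Domain (WTheta d l))"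
    using NTheta_dense unfolding dense_in_def by (simp add: Wspace_simps(1)) blast
  show "\<exists>u v. (u, v) \<in> WTheta d l \<and> l *\<^sub>R u - v = f" for f by (rule WTheta_surj[OF l l])
  show "\<exists>u v. (u, v) \<in> WTheta d l \<and> (- l) *\<^sub>R u - v = f" for f by (rule WTheta_surj[OF l]) (use l in simp)
qed (rule WTheta_skew[OF l])

lemma Wspace_sc_add: "sc (Wspace d) a (x + y) = sc (Wspace d) a x + sc (Wspace d) a y"
  by (cases x; cases y) (simp add: Wspace_simps sc_simps[OF hHb] sc_simps[OF hH0] sc_simps[OF hh])

lemma WTheta_resolvent:
  assumes l: "l \<noteq> 0"
  shows "in_resolvent_set (Wspace d) (WTheta d l) l"
    and "(X, Y) \<in> WTheta d l \<Longrightarrow> resolvent (WTheta d l) l (l *\<^sub>R X - Y) = X"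
proof -
  have T: "(x, y) \<in> WTheta d l \<Longrightarrow> (x', y') \<in> WTheta d l \<Longrightarrow> (x + x', y + y') \<in> WTheta d l"
    "(x, y) \<in> WTheta d l \<Longrightarrow> (sc (Wspace d) a x, sc (Wspace d) a y) \<in> WTheta d l" for x y x' y' a
    using WTheta_lin[OF l] unfolding lin_operator_def by blast+
  have s: "kre (ip (Wspace d) x y) = 0" if "(x, y) \<in> WTheta d l" for x y
    using WTheta_skew[OF l that that] inner_space_kre(5)[OF Wspace_inner, of y x] by simp
  note * = in_resolvent_setI[OF Wspace_inner T Wspace_sc_add s l WTheta_surj[OF l l]]
  show "in_resolvent_set (Wspace d) (WTheta d l) l"
    and "(X, Y) \<in> WTheta d l \<Longrightarrow> resolvent (WTheta d l) l (l *\<^sub>R X - Y) = X"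
    by (rule *; assumption)+
qed

lemma Wg_solution:
  assumes l: "l \<noteq> 0"
  defines "y \<equiv> core.free_y l" and "p \<equiv> core.free_p l"
  obtains Y :: "'b \<times> 'h \<times> 'a" where "((V (y (U f1) f2), p (U f1) f2, (1 / l) *\<^sub>R f3), Y) \<in> Wg d"
    "l *\<^sub>R (V (y (U f1) f2), p (U f1) f2, (1 / l) *\<^sub>R f3) - Y = (f1, f2, f3)"
proof -
  note fs = core.free_solution[OF l, of "U f1" f2, folded y_def p_def]
  define q where "q = K (B (p (U f1) f2)) - B (y (U f1) f2)"
  have f1: "l *\<^sub>R V (y (U f1) f2) - V (B (p (U f1) f2)) = f1"
    by (rule U_inj) (simp add: U_simps fs(3))
  show ?thesis
  proof (rule that)
    show "((V (y (U f1) f2), p (U f1) f2, (1 / l) *\<^sub>R f3), (V (B (p (U f1) f2)), q, 0 :: 'a)) \<in> Wg d"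
      using fs by (simp add: Wg_iff q_def)
    show "l *\<^sub>R (V (y (U f1) f2), p (U f1) f2, (1 / l) *\<^sub>R f3) - (V (B (p (U f1) f2)), q, 0) = (f1, f2, f3)"
      using l f1 fs(4) by (simp add: q_def)
  qed
qed

lemma Wg_resolvent:
  fixes X Y :: "'b \<times> 'h \<times> 'a"
  assumes l: "l \<noteq> 0"
  shows "in_resolvent_set (Wspace d) (Wg d) l"
    and "(X, Y) \<in> Wg d \<Longrightarrow> resolvent (Wg d) l (l *\<^sub>R X - Y) = X"
proof -
  have add: "(X + X', Y + Y') \<in> Wg d" if "(X, Y) \<in> Wg d" "(X', Y') \<in> Wg d"
    for X Y X' Y' :: "'b \<times> 'h \<times> 'a"
  proof -
    obtain x1 x2 x3 y1 y2 y3 where e: "X = (x1, x2, x3)" "Y = (y1, y2, y3)" by (metis prod_cases3)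
    obtain u1 u2 u3 v1 v2 v3 where e': "X' = (u1, u2, u3)" "Y' = (v1, v2, v3)" by (metis prod_cases3)
    show ?thesis using that
      by (simp add: e e' Wg_iff U_simps B1.B_simps pencil.K_simps)
  qed
  have sc: "(sc (Wspace d) a X, sc (Wspace d) a Y) \<in> Wg d" if "(X, Y) \<in> Wg d"
    for a and X Y :: "'b \<times> 'h \<times> 'a"
  proof -
    obtain x1 x2 x3 y1 y2 y3 where e: "X = (x1, x2, x3)" "Y = (y1, y2, y3)" by (metis prod_cases3)
    show ?thesis using that sc_equivariantD[OF B_sc, of _ a]
      by (simp add: e Wg_iff Wspace_simps U_sc K_sc sc_simps[OF hH0] sc_simps[OF hh]
          linear_0[OF bounded_linear.linear[OF sc_bounded_linear[OF hh]]])
  qed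
  have skew: "kre (ip (Wspace d) X Y) = 0" if "(X, Y) \<in> Wg d"
    for X Y :: "'b \<times> 'h \<times> 'a"
  proof -
    obtain x1 x2 x3 y1 y2 y3 where e: "X = (x1, x2, x3)" "Y = (y1, y2, y3)" by (metis prod_cases3)
    have *: "U x1 \<in> D" "x2 \<in> D" "U y1 = B x2" "y2 = K (B x2) - B (U x1)" "y3 = 0"
      using that by (simp_all add: e Wg_iff)
    have "x2 \<bullet> K (B x2) = 0"
      using pencil.B_K_inner_self[OF *(2)] K_skew[of x2 "B x2"] by (simp add: inner_commute)
    then show ?thesis
      using B1.sym[OF *(1,2)] by (simp add: e kre_Wspace * inner_diff_right inner_commute)
  qed
  have surj: "\<exists>X Y. (X, Y) \<in> Wg d \<and> l *\<^sub>R X - Y = F"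
    for F :: "'b \<times> 'h \<times> 'a"
  proof -
    obtain f1 f2 f3 where F: "F = (f1, f2, f3)" by (cases F)
    show ?thesis unfolding F by (rule Wg_solution[OF l, of f1 f2 f3]) blast
  qed
  note * = in_resolvent_setI[OF Wspace_inner add sc Wspace_sc_add skew l surj]
  show "in_resolvent_set (Wspace d) (Wg d) l"
    and "(X, Y) \<in> Wg d \<Longrightarrow> resolvent (Wg d) l (l *\<^sub>R X - Y) = X"
    by (rule *; assumption)+
qed

lemma GammaTheta_eq: assumes l: "l \<noteq> 0" shows "GammaTheta d l = core.weyl l"
  using l by (auto simp: GammaTheta_def core.weyl_def Binv_pot Gop_eq Cbar_adj_eq tau_t taubar_eq)

lemma GammaTheta_bops:
  assumes l: "l \<noteq> 0"
  shows "GammaTheta d l \<in> bops (haux d) (haux d)" "bij (GammaTheta d l)"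
    "inv (GammaTheta d l) \<in> bops (haux d) (haux d)"
proof -
  let ?G = "GammaTheta d l"
  have lin: "bounded_linear ?G" and bij: "bij ?G"
    and "\<exists>c. \<forall>\<zeta>. norm (inv ?G \<zeta>) \<le> c * norm \<zeta>"
    using core.weyl_linear[OF l] core.weyl_bij[OF l] by (simp_all add: GammaTheta_eq[OF l])
  then obtain c where c: "\<And>\<zeta>. norm (inv ?G \<zeta>) \<le> c * norm \<zeta>" by blast
  have sc: "?G (sc (haux d) a \<zeta>) = sc (haux d) a (?G \<zeta>)" for a \<zeta>
  proof -
    have wd: "pot l \<zeta> \<in> D" by (rule pencil.pot_solves(1)[OF l])
    have "core.reg_trace (- K (B (pot l (sc (haux d) a \<zeta>)))) = sc (haux d) a (core.reg_trace (- K (B (pot l \<zeta>))))"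
      using reg_trace_sc(2)[OF core.reg_trace_K_B_pot[OF l], of a \<zeta>] sc_equivariantD(2)[OF B_sc wd, of a]
      by (simp add: pot_sc[OF l] sc_simps[OF hH0] K_sc)
    then show ?thesis
      using sc_equivariantD(2)[OF t_sc wd, of a]
      by (simp add: GammaTheta_eq[OF l] core.weyl_def pot_sc[OF l] Theta_props(2) sc_simps[OF hh])
  qed
  show "?G \<in> bops (haux d) (haux d)" using lin sc by (simp add: bops_hilbert[OF hh hh])
  show "bij ?G" by (rule bij)
  interpret G: bounded_linear ?G by (rule lin)
  have inv: "inv ?G x = y" if "?G y = x" for x y using bij that bij_inv_eq_iff by metis
  have Ginv: "?G (inv ?G x) = x" for x using bij by (simp add: bij_is_surj surj_f_inv_f)
  have "bounded_linear (inv ?G)"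
  proof (rule bounded_linear_intro)
    show "inv ?G (x + y) = inv ?G x + inv ?G y" for x y by (rule inv) (simp add: G.add Ginv)
    show "inv ?G (r *\<^sub>R x) = r *\<^sub>R inv ?G x" for r x by (rule inv) (simp add: G.scale Ginv)
    show "norm (inv ?G x) \<le> norm x * c" for x using c by (simp add: mult.commute)
  qed
  moreover have "inv ?G (sc (haux d) a x) = sc (haux d) a (inv ?G x)" for a x
    by (rule inv) (simp add: sc Ginv)
  ultimately show "inv ?G \<in> bops (haux d) (haux d)" by (simp add: bops_hilbert[OF hh hh])
qed

lemma GTheta_breve_eq:
  assumes l: "l \<noteq> 0"
  shows "GTheta_breve d l (f1, f2, f3) = t (core.free_y l (U f1) f2) - (1 / l) *\<^sub>R Theta d f3"
proof -
  note rd = pencil.R_D[OF l]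
  have "R l (- K (U f1) + f2) = R l f2 - K (R l (U f1))"
    using pencil.R_linear(3)[OF l, of f2 "K (U f1)"] pencil.R_K[OF l, of "U f1"] by simp
  then have "core.free_y l (U f1) f2 = l *\<^sub>R R l (U f1) + B (R l (- K (U f1) + f2))"
    using rd K_D by (simp add: core.free_y_def B1.B_simps BK)
  moreover have "B (R l (- K (U f1) + f2)) \<in> D" by (rule rd)
  ultimately show ?thesis
    using rd by (simp add: GTheta_breve_def Gbar_breve_eq[OF l] Gbreve_eq[OF l] Cbar_eq pencil.t_simps)
qed

lemma GTheta_eq:
  assumes l: "l \<noteq> 0"
  shows "GTheta d l \<zeta> = (V (l *\<^sub>R pot l \<zeta> - K (B (pot l \<zeta>))), - B (pot l \<zeta>), - ((1 / l) *\<^sub>R \<zeta>))"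
  by (simp add: GTheta_def Gbar_eq[OF l] Cbar_adj_eq Gop_eq[OF l] V_simps)

text \<open>
  The Krein solution is written as the uncoupled solution plus \<open>GTheta\<close> of the charge; resolvents
  are unique.
\<close>

lemma resolvent_formula:
  assumes l: "l \<noteq> 0"
  shows "resolvent (WTheta d l) l F =
    resolvent (Wg d) l F + GTheta d l (inv (GammaTheta d l) (GTheta_breve d l F))"
proof -
  obtain f1 f2 f3 where F: "F = (f1, f2, f3)" by (cases F)
  define y where "y = core.free_y l (U f1) f2"
  define p where "p = core.free_p l (U f1) f2"
  define \<zeta> where "\<zeta> = inv (GammaTheta d l) (GTheta_breve d l F)"
  note fs = core.free_solution[OF l, of "U f1" f2, folded y_def p_def]
  have "core.weyl l \<zeta> = t y - (1 / l) *\<^sub>R Theta d f3"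
    using GammaTheta_bops(2)[OF l] GTheta_breve_eq[OF l, of f1 f2 f3]
    by (simp add: \<zeta>_def F y_def bij_is_surj surj_f_inv_f flip: GammaTheta_eq[OF l])
  note k = core.krein_solution[OF l fs(1,2) this]
  define y0 where "y0 = y + (l *\<^sub>R pot l \<zeta> - K (B (pot l \<zeta>)))"
  define v where "v = B p + l *\<^sub>R (l *\<^sub>R pot l \<zeta> - K (B (pot l \<zeta>)))"
  define q where "q = K (B p) - B y + l *\<^sub>R (- B (pot l \<zeta>))"
  define X where "X = (V y0, p - B (pot l \<zeta>), (1 / l) *\<^sub>R f3 - (1 / l) *\<^sub>R \<zeta>)"
  have W: "(X, (V v, q, - \<zeta>)) \<in> WTheta d l"
    using k by (simp add: X_def WTheta_iff[OF l] y0_def v_def q_def)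
  have "l *\<^sub>R V y0 - V v = f1"
    using fs(3) by (intro U_inj) (simp add: U_simps y0_def v_def algebra_simps)
  moreover have "l *\<^sub>R (p - B (pot l \<zeta>)) - q = f2" using fs(4) by (simp add: q_def algebra_simps)
  ultimately have "l *\<^sub>R X - (V v, q, - \<zeta>) = F" using l by (simp add: X_def F algebra_simps)
  then have 1: "resolvent (WTheta d l) l F = X" using WTheta_resolvent(2)[OF l W] by simp
  have 2: "resolvent (Wg d) l F = (V y, p, (1 / l) *\<^sub>R f3)"
    using Wg_solution[OF l, of f1 f2 f3] Wg_resolvent(2)[OF l] unfolding F y_def p_def by metis
  show ?thesis unfolding 1 2 \<zeta>_def[symmetric] GTheta_eq[OF l] X_def y0_def
    by (simp add: V_simps)
qed

end

theorem theorem4p7: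
  fixes d :: "('k::rc_scalar, 'h::{real_inner, complete_space}, 'b::{real_inner, complete_space},
    'p::{real_inner, complete_space}, 'q::{real_inner, complete_space},
    'a::{real_inner, complete_space}) wave_data"
    and l :: real
  assumes setting: "wave_setting d"
    and tau_adj_inj: "inj (tau_adj d)"
    and H3_0: "{tau d x - Theta d \<zeta> | x \<zeta>. x \<in> carrier (Hbar d 2)} = UNIV"
    and H3_1: "range (tau_adj d) \<inter> range (incl_neg d) = {0}"
    and H4_1: "\<exists>c. \<forall>x\<in>domB d. norm (opC d x) \<le> c * norm (opB d x)"
    and H4_2: "\<forall>x\<in>domBpow d 2. opC d x \<in> domB d \<and> opB d (opC d x) = opC d (opB d x)"
    and H4_3: "\<forall>\<mu>. \<mu> \<noteq> 0 \<longrightarrow> range (\<lambda>\<zeta>. Cbar_adj d (Gop d \<mu> \<zeta>)) \<subseteq> dom_taubar d"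
    and l: "l \<noteq> 0"
  shows "skew_adjoint (Wspace d) (WTheta d l)
    \<and> dense_in (Wspace d) (NTheta d)
    \<and> restr (Wg d) (NTheta d) \<subseteq> WTheta d l
    \<and> in_resolvent_set (Wspace d) (WTheta d l) l
    \<and> in_resolvent_set (Wspace d) (Wg d) l
    \<and> GammaTheta d l \<in> bops (haux d) (haux d)
    \<and> bij (GammaTheta d l)
    \<and> inv (GammaTheta d l) \<in> bops (haux d) (haux d)
    \<and> (\<forall>u. resolvent (WTheta d l) l u =
          resolvent (Wg d) l u + GTheta d l (inv (GammaTheta d l) (GTheta_breve d l u)))"
proof -
  interpret wave d
    by (rule wave.intro) (rule setting tau_adj_inj H3_0 H3_1 H4_1 H4_2 H4_3)+
  show ?thesis
    using WTheta_skew_adjoint[OF l] NTheta_dense Wg_NTheta_WTheta[OF l] WTheta_resolvent(1)[OF l]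
      Wg_resolvent(1)[OF l] GammaTheta_bops[OF l] resolvent_formula[OF l]
    by blast
qed

end
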